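(* Consider the system $$\dot x_0=u_0,\quad \dot x_i=u_0x_{i+1}+\phi_i(t,u,x)\ (i=1,\dots,n-1),\quad \dot x_n=u+\phi_n(t,u,x),\quad y=[x_0,x_1]^{\mathrm T},$$ under Assumption 1. Let $T>0$, $\gamma_0=1/T$, $\gamma(t)=\frac{T}{T-t}\gamma_0$, and $\beta=\max\{\beta_1,\beta_2\}$ with $$\beta_1=8\sqrt2\, n d\Lambda\, cQ_nP_nQ_nc^{\mathrm T}+2\Big(2+\frac{\delta_c}{n}\Big),\qquad \beta_2=4\sqrt2\, d\Lambda+2\Big(2n+2-\frac1n\Big).$$ Apply $u_0(t)=-\frac{3}{T-t}x_0(t)-\frac{\beta}{2}(T-t)$ together with the observer-based output feedback $$\dot\xi(t)=\beta A\xi(t)+bu(t)+\beta Q(\gamma(t))c^{\mathrm T}\big(\gamma(t)^{n-1}x_1(t)-c\xi(t)\big),\qquad u(t)=-\beta b^{\mathrm T}P(\gamma(t))\xi(t),$$ with $\xi(t)\in\mathbf{R}^n$. Then there exist positive constants $\upsilon_3,\upsilon_{30},\upsilon_4,\upsilon_{40},\upsilon_5,\upsilon_{50}$ such that for any initial condition and all $t\in[0,T)$, $$|x_0(t)|\le (T-t)^2\Big(\frac{T-t}{T^3}|x_0(0)|+\frac{\beta t}{2T}\Big),\quad |u_0(t)|\le (T-t)\Big(3(T-t)\Big(\frac{|x_0(0)|}{T^3}+\frac{\beta}{2T}\Big)+\beta\Big),$$ $$\|x(t)\|\le \upsilon_3e^{\upsilon_{30}|x_0(0)|t}(T-t)^{3/2}(\|x(0)\|+\|\xi(0)\|),$$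 $$\|\xi(t)\|\le \upsilon_4e^{\upsilon_{40}|x_0(0)|t}(T-t)^{3/2}(\|x(0)\|+\|\xi(0)\|),$$ $$\|u(t)\|\le \upsilon_5e^{\upsilon_{50}|x_0(0)|t}(T-t)^{1/2}(\|x(0)\|+\|\xi(0)\|).$$
   Context: Assumption 1: $\phi_i$ are unknown continuous functions with $|\phi_i(t,u,x)|\le c_{i1}|x_1|+\cdots+c_{ii}|x_i|$, $c_{ij}\ge0$ known. $A$ is the $n\times n$ matrix with ones on the superdiagonal and zeros elsewhere, $b=[0,\dots,0,1]^{\mathrm T}$, $c=[1,0,\dots,0]$. For $\gamma>0$, $P(\gamma)$ is the unique positive definite solution of $A^{\mathrm T}P+PA-Pbb^{\mathrm T}P=-\gamma P$ and $Q(\gamma)$ is the unique positive definite solution of $AQ+QA^{\mathrm T}-Qc^{\mathrm T}cQ=-\gamma Q$; $P_n=P(1)$, $Q_n=Q(1)$, $\Lambda=\lambda_{\max}(P_n)$. $E_n=\mathrm{diag}\{n-1,\dots,1,0\}$, $\delta_c=n(1+\lambda_{\max}(E_n+P_nE_nP_n^{-1}))$. With $\gamma_0=1/T$, $g_{ij}=c_{ij}T^{i+1-j}$ ($j<i$), $g_{ii}=c_{ii}T+n-i$, and $d^2=\max_{j=1,\dots,n}\sum_{i=j}^n g_{ij}^2\, i\,\gamma_0^{-2(i-j)}$. *)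

theory Defs
  imports "HOL-Analysis.Analysis"
begin

text \<open>Vectors in R^n are functions nat => real with entries indexed 1..n;
  n x n matrices are functions nat => nat => real with entries indexed 1..n
  (and zero outside this range).\<close>

type_synonym rvec = "nat \<Rightarrow> real"
type_synonym rmat = "nat \<Rightarrow> nat \<Rightarrow> real"

definition is_mat :: "nat \<Rightarrow> rmat \<Rightarrow> bool" where
  "is_mat n M \<longleftrightarrow> (\<forall>i j. (i \<notin> {1..n} \<or> j \<notin> {1..n}) \<longrightarrow> M i j = 0)"

definition mmul :: "nat \<Rightarrow> rmat \<Rightarrow> rmat \<Rightarrow> rmat" where
  "mmul n M N = (\<lambda>i j. \<Sum>k=1..n. M i k * N k j)"

definition madd :: "rmat \<Rightarrow> rmat \<Rightarrow> rmat" where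
  "madd M N = (\<lambda>i j. M i j + N i j)"

definition mtr :: "rmat \<Rightarrow> rmat" where
  "mtr M = (\<lambda>i j. M j i)"

definition mvec :: "nat \<Rightarrow> rmat \<Rightarrow> rvec \<Rightarrow> rvec" where
  "mvec n M v = (\<lambda>i. \<Sum>k=1..n. M i k * v k)"

definition dotp :: "nat \<Rightarrow> rvec \<Rightarrow> rvec \<Rightarrow> real" where
  "dotp n v w = (\<Sum>k=1..n. v k * w k)"

definition vnorm :: "nat \<Rightarrow> rvec \<Rightarrow> real" where
  "vnorm n v = sqrt (\<Sum>k=1..n. (v k)\<^sup>2)"

definition outer :: "nat \<Rightarrow> rvec \<Rightarrow> rvec \<Rightarrow> rmat" where
  "outer n v w = (\<lambda>i j. if i \<in> {1..n} \<and> j \<in> {1..n} then v i * w j else 0)"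

definition idm :: "nat \<Rightarrow> rmat" where
  "idm n = (\<lambda>i j. if i = j \<and> i \<in> {1..n} then 1 else 0)"

definition pos_def :: "nat \<Rightarrow> rmat \<Rightarrow> bool" where
  "pos_def n M \<longleftrightarrow> is_mat n M \<and> (\<forall>i j. M i j = M j i) \<and>
     (\<forall>v. (\<exists>k\<in>{1..n}. v k \<noteq> 0) \<longrightarrow> dotp n v (mvec n M v) > 0)"

definition Amat :: "nat \<Rightarrow> rmat" where
  "Amat n = (\<lambda>i j. if i \<in> {1..n} \<and> j \<in> {1..n} \<and> j = i + 1 then 1 else 0)"

definition bvec :: "nat \<Rightarrow> rvec" where
  "bvec n = (\<lambda>i. if i = n then 1 else 0)"

definition cvec :: "nat \<Rightarrow> rvec" where
  "cvec n = (\<lambda>i. if i = 1 then 1 else 0)"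

definition Pm :: "nat \<Rightarrow> real \<Rightarrow> rmat" where
  "Pm n \<gamma> = (THE P. pos_def n P \<and>
     madd (madd (mmul n (mtr (Amat n)) P) (mmul n P (Amat n)))
          (\<lambda>i j. - mmul n (mmul n P (outer n (bvec n) (bvec n))) P i j)
     = (\<lambda>i j. - \<gamma> * P i j))"

definition Qm :: "nat \<Rightarrow> real \<Rightarrow> rmat" where
  "Qm n \<gamma> = (THE Q. pos_def n Q \<and>
     madd (madd (mmul n (Amat n) Q) (mmul n Q (mtr (Amat n))))
          (\<lambda>i j. - mmul n (mmul n Q (outer n (cvec n) (cvec n))) Q i j)
     = (\<lambda>i j. - \<gamma> * Q i j))"

definition eigenvalue_of :: "nat \<Rightarrow> rmat \<Rightarrow> real \<Rightarrow> bool" where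
  "eigenvalue_of n M k \<longleftrightarrow> (\<exists>v. (\<exists>i\<in>{1..n}. v i \<noteq> 0) \<and> (\<forall>i\<in>{1..n}. mvec n M v i = k * v i))"

definition lam_max :: "nat \<Rightarrow> rmat \<Rightarrow> real" where
  "lam_max n M = Max {k. eigenvalue_of n M k}"

definition minv :: "nat \<Rightarrow> rmat \<Rightarrow> rmat" where
  "minv n M = (THE N. is_mat n N \<and> mmul n N M = idm n)"

definition Em :: "nat \<Rightarrow> rmat" where
  "Em n = (\<lambda>i j. if i = j \<and> i \<in> {1..n} then real (n - i) else 0)"

definition Lam :: "nat \<Rightarrow> real" where
  "Lam n = lam_max n (Pm n 1)"

definition delta_c :: "nat \<Rightarrow> real" where
  "delta_c n = real n * (1 + lam_max n (madd (Em n) (mmul n (mmul n (Pm n 1) (Em n)) (minv n (Pm n 1)))))"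

text \<open>g_ij (1 <= j <= i <= n), gamma_0 = 1/T.\<close>
definition gcoef :: "nat \<Rightarrow> (nat \<Rightarrow> nat \<Rightarrow> real) \<Rightarrow> real \<Rightarrow> nat \<Rightarrow> nat \<Rightarrow> real" where
  "gcoef n c T i j = (if j < i then c i j * T ^ (i + 1 - j) else c i i * T + real (n - i))"

definition dcoef :: "nat \<Rightarrow> (nat \<Rightarrow> nat \<Rightarrow> real) \<Rightarrow> real \<Rightarrow> real" where
  "dcoef n c T = sqrt (Max ((\<lambda>j. \<Sum>i=j..n. (gcoef n c T i j)\<^sup>2 * real i * inverse ((1/T) ^ (2 * (i - j)))) ` {1..n}))"

definition cQPQc :: "nat \<Rightarrow> real" where
  "cQPQc n = dotp n (cvec n) (mvec n (Qm n 1) (mvec n (Pm n 1) (mvec n (Qm n 1) (cvec n))))"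

definition beta :: "nat \<Rightarrow> (nat \<Rightarrow> nat \<Rightarrow> real) \<Rightarrow> real \<Rightarrow> real" where
  "beta n c T = max
     (8 * sqrt 2 * real n * dcoef n c T * Lam n * cQPQc n + 2 * (2 + delta_c n / real n))
     (4 * sqrt 2 * dcoef n c T * Lam n + 2 * (2 * real n + 2 - 1 / real n))"

definition gam :: "real \<Rightarrow> real \<Rightarrow> real" where
  "gam T t = T / (T - t) * (1 / T)"

definition u0_fb :: "nat \<Rightarrow> (nat \<Rightarrow> nat \<Rightarrow> real) \<Rightarrow> real \<Rightarrow> real \<Rightarrow> real \<Rightarrow> real" where
  "u0_fb n c T t x0t = - 3 / (T - t) * x0t - beta n c T / 2 * (T - t)"

definition u_fb :: "nat \<Rightarrow> (nat \<Rightarrow> nat \<Rightarrow> real) \<Rightarrow> real \<Rightarrow> real \<Rightarrow> rvec \<Rightarrow> real" where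
  "u_fb n c T t \<xi>t = - beta n c T * dotp n (bvec n) (mvec n (Pm n (gam T t)) \<xi>t)"

text \<open>(x0, x, xi) is a solution on [0,T) of the closed-loop system (system + u_0 + observer-based
  output feedback).  phi i t u0 u x is phi_i(t,u,x) with u = (u_0,u).\<close>
definition closed_loop ::
  "nat \<Rightarrow> (nat \<Rightarrow> nat \<Rightarrow> real) \<Rightarrow> real \<Rightarrow> (nat \<Rightarrow> real \<Rightarrow> real \<Rightarrow> real \<Rightarrow> rvec \<Rightarrow> real)
   \<Rightarrow> (real \<Rightarrow> real) \<Rightarrow> (real \<Rightarrow> rvec) \<Rightarrow> (real \<Rightarrow> rvec) \<Rightarrow> bool" where
  "closed_loop n c T \<phi> x0 x \<xi> \<longleftrightarrow>
    (\<forall>t\<in>{0..<T}.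
      (x0 has_real_derivative u0_fb n c T t (x0 t)) (at t within {0..<T}) \<and>
      (\<forall>i\<in>{1..<n}. ((\<lambda>s. x s i) has_real_derivative
          (u0_fb n c T t (x0 t) * x t (i + 1) + \<phi> i t (u0_fb n c T t (x0 t)) (u_fb n c T t (\<xi> t)) (x t)))
          (at t within {0..<T})) \<and>
      ((\<lambda>s. x s n) has_real_derivative
          (u_fb n c T t (\<xi> t) + \<phi> n t (u0_fb n c T t (x0 t)) (u_fb n c T t (\<xi> t)) (x t)))
          (at t within {0..<T}) \<and>
      (\<forall>k\<in>{1..n}. ((\<lambda>s. \<xi> s k) has_real_derivative
          (beta n c T * mvec n (Amat n) (\<xi> t) k + bvec n k * u_fb n c T t (\<xi> t)
           + beta n c T * mvec n (Qm n (gam T t)) (cvec n) k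
               * ((gam T t) ^ (n - 1) * x t 1 - dotp n (cvec n) (\<xi> t))))
          (at t within {0..<T})))"

end

theory Submission
  imports "Jordan_Normal_Form.Char_Poly" Defs
begin

text \<open>
  Write \<open>s = T - t = 1 / \<gamma>(t)\<close>. In the scaled variables \<open>\<eta>\<^sub>i = \<xi>\<^sub>i / s\<^bsup>n-i\<^esup>\<close>,
  \<open>\<zeta>\<^sub>i = x\<^sub>i / s\<^bsup>2(n-i)\<^esup>\<close>, \<open>\<epsilon> = \<zeta> - \<eta>\<close> the closed loop becomes \<open>1/s\<close> times a system
  with constant coefficients, a nonlinearity \<open>\<Psi>\<close> with \<open>\<bar>\<Psi>\<bar> \<le> d \<bar>\<zeta>\<bar>\<close>, and a perturbation
  \<open>\<delta> A \<zeta>\<close> with \<open>\<delta> = u\<^sub>0 / s - \<beta> = O(s)\<close>, by the explicit solution of the \<open>x\<^sub>0\<close>-equation.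
  For \<open>P = P\<^sub>n\<close>, \<open>R = Q\<^sub>n\<^sup>-\<^sup>1\<close> and \<open>q = c Q P Q c\<^sup>T\<close> the Lyapunov function
  \<open>Z = \<eta>\<^sup>T P \<eta> + 2 q \<epsilon>\<^sup>T R \<epsilon>\<close> then satisfies \<open>s Z' + 3 Z \<le> K \<bar>\<delta>\<bar> Z\<close>, so \<open>Z / s\<^sup>3\<close> grows at most
  exponentially, with a rate that is affine in \<open>\<bar>x\<^sub>0(0)\<bar>\<close>.

  The algebra behind it is explicit: \<open>P\<close> and \<open>R\<close> are, up to signs and reversal of the indices,
  the Gram matrices of the columns and of the rows of the Pascal triangle. As the Pascal matrix is
  conjugate to its inverse by signs, the same \<open>\<Lambda>\<close> bounds \<open>P\<close>, \<open>R\<close> and their inverses.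
\<close>

section \<open>Linear algebra and the Rayleigh quotient\<close>

text \<open>The gain \<open>beta\<close> contains \<open>Lam n\<close>, \<open>delta_c n\<close> and
  \<open>cQPQc n\<close>, but no eigenvalue of \<open>Q_n\<close>. So every estimate on the observer
  side has to be expressed through P, and this calls for closed forms of the Riccati solutions
  rather than their mere existence.

  The weight 2q is dictated by the coupling. The innovation enters the \<eta>-equation as \<beta>
  \<epsilon>_1 Q c^T. Cauchy-Schwarz in the form of P, followed by Young's inequality, spends half
  of the decay of \<eta>^T P \<eta> and leaves 2 q \<beta> \<epsilon>_1^2. This is exactly what 2q
  times the output injection in the \<epsilon>-equation takes away.

  The exponent 3 has two sources: the margins in \<beta>_1 and \<beta>_2 leave -2 Z, and the bounds
  on the terms with E hold one more copy of Z in reserve. Square roots turn s^3 into the exponent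
  3/2 of the states. The control is a fixed linear form of \<eta> divided by s, which lowers its
  exponent to 1/2.\<close>

lemma finite_eigenvalues: "finite {k. eigenvalue_of n M k}"
proof -
  \<comment> \<open>\<open>lam_max\<close> is a \<open>Max\<close>, which bounds the eigenvalues
    only if their set is finite. The characteristic polynomial supplies this, after moving the
    indices from \<open>1..n\<close> to \<open>0..<n\<close>.\<close>
  define A where "A = Matrix.mat n n (\<lambda>(i,j). M (Suc i) (Suc j))"
  have A: "A \<in> carrier_mat n n" by (simp add: A_def)
  have "eigenvalue A k" if ev: "eigenvalue_of n M k" for k
  proof -
    obtain v i where i: "i \<in> {1..n}" "v i \<noteq> 0"
      and v: "\<And>i. i \<in> {1..n} \<Longrightarrow> mvec n M v i = k * v i"
      using ev by (auto simp: eigenvalue_of_def)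
    define w where "w = Matrix.vec n (\<lambda>i. v (Suc i))"
    have "vec_index w (i - 1) \<noteq> 0" using i by (cases i) (simp_all add: w_def)
    hence "w \<noteq> 0\<^sub>v n" using i by (intro notI) auto
    moreover have "A *\<^sub>v w = k \<cdot>\<^sub>v w"
    proof (rule eq_vecI)
      fix j assume "j < dim_vec (k \<cdot>\<^sub>v w)"
      hence j: "j < n" by (simp add: w_def)
      have "vec_index (A *\<^sub>v w) j = (\<Sum>l<n. M (Suc j) (Suc l) * v (Suc l))"
        using j by (simp add: A_def w_def scalar_prod_def atLeast0LessThan)
      also have "\<dots> = mvec n M v (Suc j)"
        by (simp add: mvec_def sum.atLeast1_atMost_eq)
      finally show "vec_index (A *\<^sub>v w) j = vec_index (k \<cdot>\<^sub>v w) j" using j v[of "Suc j"] by (simp add: w_def)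
    qed (simp add: A_def w_def)
    ultimately have "eigenvector A w k" by (simp add: eigenvector_def A_def w_def)
    thus ?thesis by (auto simp: eigenvalue_def)
  qed
  hence "{k. eigenvalue_of n M k} \<subseteq> {k. poly (char_poly A) k = 0}"
    using eigenvalue_root_char_poly[OF A] by auto
  moreover have "char_poly A \<noteq> 0" using degree_monic_char_poly[OF A] by auto
  ultimately show ?thesis using poly_roots_finite finite_subset by blast
qed

lemma dotp_commute: "dotp n v w = dotp n w v"
  by (simp add: dotp_def mult.commute)

lemma dotp_add_right: "dotp n v (\<lambda>i. w i + u i) = dotp n v w + dotp n v u"
  by (simp add: dotp_def algebra_simps sum.distrib)

lemma dotp_add_left: "dotp n (\<lambda>i. w i + u i) v = dotp n w v + dotp n u v"
  by (simp add: dotp_def algebra_simps sum.distrib)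

lemma dotp_diff_right: "dotp n v (\<lambda>i. w i - u i) = dotp n v w - dotp n v u"
  by (simp add: dotp_def algebra_simps sum_subtractf)

lemma dotp_scale_right: "dotp n v (\<lambda>i. a * w i) = a * dotp n v w"
  by (simp add: dotp_def sum_distrib_left mult.left_commute)

lemma dotp_scale_left: "dotp n (\<lambda>i. a * w i) v = a * dotp n w v"
  by (simp add: dotp_def sum_distrib_left mult.assoc)

lemma dotp_cong:
  "(\<And>i. i \<in> {1..n} \<Longrightarrow> v i = v' i) \<Longrightarrow> (\<And>i. i \<in> {1..n} \<Longrightarrow> w i = w' i) \<Longrightarrow> dotp n v w = dotp n v' w'"
  by (simp add: dotp_def)

lemma mvec_cong: "(\<And>i. i \<in> {1..n} \<Longrightarrow> v i = v' i) \<Longrightarrow> mvec n M v = mvec n M v'"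
  by (simp add: mvec_def)

lemma mvec_add: "mvec n M (\<lambda>i. v i + w i) = (\<lambda>i. mvec n M v i + mvec n M w i)"
  by (simp add: mvec_def algebra_simps sum.distrib)

lemma mvec_scale: "mvec n M (\<lambda>i. a * v i) = (\<lambda>i. a * mvec n M v i)"
  by (simp add: mvec_def sum_distrib_left mult.left_commute)

lemma dotp_mvec_transpose: "dotp n v (mvec n (mtr M) w) = dotp n (mvec n M v) w"
  unfolding dotp_def mvec_def mtr_def sum_distrib_left sum_distrib_right
  by (subst sum.swap) (simp add: mult_ac)

lemma dotp_mvec_sym:
  assumes "\<And>i j. M i j = M j i"
  shows "dotp n v (mvec n M w) = dotp n (mvec n M v) w"
proof -
  have "mtr M = M" using assms by (auto simp: mtr_def)
  thus ?thesis using dotp_mvec_transpose[of n v M w] by simp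
qed

lemma mvec_mmul: "mvec n (mmul n M N) v = mvec n M (mvec n N v)"
  unfolding mvec_def mmul_def sum_distrib_left sum_distrib_right
  by (subst sum.swap) (simp add: mult_ac)

lemma mvec_madd: "mvec n (madd M N) v = (\<lambda>i. mvec n M v i + mvec n N v i)"
  by (simp add: mvec_def madd_def algebra_simps sum.distrib)

lemma dotp_self_nonneg: "0 \<le> dotp n v v"
  by (simp add: dotp_def sum_nonneg)

lemma dotp_self_pos: "i \<in> {1..n} \<Longrightarrow> v i \<noteq> 0 \<Longrightarrow> 0 < dotp n v v"
  unfolding dotp_def by (rule sum_pos2[of _ i]) (auto simp: zero_less_mult_iff)

lemma vnorm_dotp: "vnorm n v = sqrt (dotp n v v)"
  by (simp add: vnorm_def dotp_def power2_eq_square)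

section \<open>Maximisers of generalised Rayleigh quotients\<close>

lemma linear_coeff_zero_of_nonneg:
  fixes a b :: real
  assumes "\<And>t. 0 \<le> a * t + b * t\<^sup>2"
  shows "a = 0"
proof (rule ccontr)
  assume a: "a \<noteq> 0"
  \<comment> \<open>Any positive \<open>B\<close> above \<open>b\<close> makes the value at
    \<open>- a / B\<close> negative.\<close>
  define B where "B = \<bar>b\<bar> + 1"
  have B: "B > 0" "b < B" by (auto simp: B_def)
  have "0 \<le> a * (- a / B) + b * (- a / B)\<^sup>2" by (rule assms)
  also have "\<dots> = (a\<^sup>2 / B\<^sup>2) * (b - B)" using B by (simp add: field_simps power2_eq_square)
  also have "\<dots> < 0" using a B by (intro mult_pos_neg) auto
  finally show False by simp
qed

lemma dotp_unit: "i \<in> {1..n} \<Longrightarrow> dotp n (\<lambda>j. if j = i then 1 else 0) v = v i"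
  by (simp add: dotp_def if_distrib[of "\<lambda>x. x * _"] cong: if_cong)

text \<open>The vector \<open>v\<close> minimises the form, so the first variation at
  \<open>v\<close> vanishes in every coordinate direction.\<close>

lemma psd_null_vector:
  assumes sym: "\<And>i j. M i j = M j i"
    and psd: "\<And>w. 0 \<le> dotp n w (mvec n M w)"
    and null: "dotp n v (mvec n M v) = 0"
    and i: "i \<in> {1..n}"
  shows "mvec n M v i = 0"
proof -
  define e :: rvec where "e = (\<lambda>j. if j = i then 1 else 0)"
  have "0 \<le> (2 * dotp n e (mvec n M v)) * t + dotp n e (mvec n M e) * t\<^sup>2" for t
  proof -
    have "0 \<le> dotp n (\<lambda>i. v i + t * e i) (mvec n M (\<lambda>i. v i + t * e i))" by (rule psd)
    also have "\<dots> = dotp n v (mvec n M v) + t * (dotp n v (mvec n M e) + dotp n e (mvec n M v))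
        + dotp n e (mvec n M e) * t\<^sup>2"
      by (simp add: mvec_add mvec_scale dotp_add_left dotp_add_right dotp_scale_left dotp_scale_right
          algebra_simps power2_eq_square)
    also have "dotp n v (mvec n M e) = dotp n e (mvec n M v)"
      by (subst dotp_mvec_sym[of M, OF sym]) (rule dotp_commute)
    finally show ?thesis using null by (simp add: algebra_simps)
  qed
  from linear_coeff_zero_of_nonneg[OF this] have "dotp n e (mvec n M v) = 0" by simp
  thus ?thesis using dotp_unit[OF i] by (simp add: e_def)
qed

text \<open>Vectors live on all of \<open>nat\<close>, so the entries outside \<open>1..n\<close>
  have to be pinned to 0. The sphere is then a closed subset of a product of compact sets
  (Tychonoff).\<close>

lemma compact_unit_vectors:
  "compact {v :: rvec. (\<forall>i. i \<notin> {1..n} \<longrightarrow> v i = 0) \<and> dotp n v v = 1}"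
proof -
  let ?I = "PiE UNIV (\<lambda>i. if i \<in> {1..n} then {-1..1::real} else {0})"
  have "compact ?I"
    using compactin_PiE[of "\<lambda>i::nat. euclidean :: real topology" UNIV "\<lambda>i. if i \<in> {1..n} then {-1..1} else {0}"]
    by (auto simp: euclidean_product_topology)
  moreover have "closed {v :: rvec. dotp n v v = 1}"
    unfolding dotp_def by (intro closed_Collect_eq continuous_intros) auto
  moreover have "{v :: rvec. (\<forall>i. i \<notin> {1..n} \<longrightarrow> v i = 0) \<and> dotp n v v = 1}
      = ?I \<inter> {v. dotp n v v = 1}"
  proof -
    have "\<bar>v i\<bar> \<le> 1" if "dotp n v v = 1" "i \<in> {1..n}" for v :: rvec and i
    proof -
      have "v i * v i \<le> dotp n v v" unfolding dotp_def using that(2)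
        by (intro member_le_sum) auto
      thus ?thesis using that(1) by (simp add: abs_le_square_iff[of _ 1, simplified] power2_eq_square)
    qed
    thus ?thesis by (fastforce simp: PiE_iff split: if_splits)
  qed
  ultimately show ?thesis by (simp add: compact_Int_closed)
qed

lemma rayleigh_max:
  assumes n: "n \<ge> 1" and symS: "\<And>i j. S i j = S j i" and symB: "\<And>i j. B i j = B j i"
    and pos: "\<And>v. \<exists>k\<in>{1..n}. v k \<noteq> 0 \<Longrightarrow> dotp n v (mvec n B v) > 0"
  obtains k v where "\<exists>i\<in>{1..n}. v i \<noteq> 0"
    and "\<And>i. i \<in> {1..n} \<Longrightarrow> mvec n S v i = k * mvec n B v i"
    and "\<And>w. dotp n w (mvec n S w) \<le> k * dotp n w (mvec n B w)"
proof -
  define K where "K = {v :: rvec. (\<forall>i. i \<notin> {1..n} \<longrightarrow> v i = 0) \<and> dotp n v v = 1}"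
  let ?f = "\<lambda>v. dotp n v (mvec n S v) / dotp n v (mvec n B v)"
  have nz: "\<exists>k\<in>{1..n}. v k \<noteq> 0" if "v \<in> K" for v
  proof (rule ccontr)
    assume "\<not> ?thesis"
    hence "dotp n v v = 0" by (simp add: dotp_def)
    thus False using that by (simp add: K_def)
  qed
  have coord: "continuous_on K (\<lambda>v. v i)" for i
    by (rule continuous_on_subset[OF continuous_on_product_coordinates]) simp
  have cont: "continuous_on K (\<lambda>v. dotp n v (mvec n M v))" for M
    unfolding dotp_def mvec_def
    by (intro continuous_on_sum continuous_on_mult continuous_on_const coord)
  have "continuous_on K ?f"
  proof (intro continuous_on_divide cont ballI)
    show "dotp n v (mvec n B v) \<noteq> 0" if "v \<in> K" for v
      using pos[OF nz[OF that]] by simp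
  qed
  moreover have "K \<noteq> {}"
  proof -
    define e :: rvec where "e = (\<lambda>j. if j = 1 then 1 else 0)"
    have "dotp n e e = e 1" unfolding e_def by (rule dotp_unit) (use n in simp)
    hence "e \<in> K" using n by (simp add: K_def) (simp add: e_def)
    thus ?thesis by blast
  qed
  ultimately obtain v where v: "v \<in> K" and sup: "\<And>w. w \<in> K \<Longrightarrow> ?f w \<le> ?f v"
    using continuous_attains_sup[OF compact_unit_vectors[of n, folded K_def]] by blast
  define k where "k = ?f v"
  have le: "dotp n w (mvec n S w) \<le> k * dotp n w (mvec n B w)" for w
  proof (cases "\<exists>k\<in>{1..n}. w k \<noteq> 0")
    case False
    hence "mvec n S w = (\<lambda>_. 0)" "mvec n B w = (\<lambda>_. 0)" by (auto simp: mvec_def)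
    thus ?thesis by (simp add: dotp_def)
  next
    case True
    hence d: "dotp n w w > 0" using dotp_self_pos by blast
    define r where "r = 1 / sqrt (dotp n w w)"
    have r: "r\<^sup>2 * dotp n w w = 1" "r > 0" using d by (auto simp: r_def power_divide)
    \<comment> \<open>Normalisation and truncation put \<open>w\<close> into the compact set; both
      sides of the claim are homogeneous of degree two and see only the entries in
      \<open>1..n\<close>.\<close>
    define w' where "w' = (\<lambda>i. if i \<in> {1..n} then r * w i else 0)"
    have sc: "dotp n w' (mvec n M w') = r\<^sup>2 * dotp n w (mvec n M w)" for M
    proof -
      have "dotp n w' (mvec n M w') = dotp n (\<lambda>i. r * w i) (mvec n M (\<lambda>i. r * w i))"
        by (intro dotp_cong) (auto simp: w'_def intro!: fun_cong[OF mvec_cong])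
      thus ?thesis by (simp add: mvec_scale dotp_scale_left dotp_scale_right power2_eq_square)
    qed
    have "dotp n w' w' = dotp n (\<lambda>i. r * w i) (\<lambda>i. r * w i)"
      by (intro dotp_cong) (auto simp: w'_def)
    also have "\<dots> = 1" using r by (simp add: dotp_scale_left dotp_scale_right power2_eq_square mult.assoc)
    finally have "w' \<in> K" by (simp add: K_def) (simp add: w'_def)
    from sup[OF this] have "?f w \<le> k" using r(2) by (simp add: sc k_def)
    thus ?thesis using pos[OF True] by (simp add: field_simps)
  qed
  \<comment> \<open>\<open>k B - S\<close> is positive semidefinite by \<open>le\<close> and has
    \<open>v\<close> as a null vector, so \<open>psd_null_vector\<close> turns maximality into the
    eigenvalue equation.\<close>
  define M where "M = (\<lambda>i j. k * B i j - S i j)"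
  have M: "mvec n M w = (\<lambda>i. k * mvec n B w i - mvec n S w i)" for w
    by (simp add: M_def mvec_def algebra_simps sum_subtractf sum_distrib_left)
  have "dotp n v (mvec n B v) > 0" using pos[OF nz[OF v]] .
  hence null: "dotp n v (mvec n M v) = 0"
    unfolding M dotp_diff_right dotp_scale_right by (simp add: k_def)
  have "mvec n M v i = 0" if "i \<in> {1..n}" for i
  proof (rule psd_null_vector[OF _ _ null that])
    show "M i j = M j i" for i j by (simp add: M_def symS[of i j] symB[of i j])
    show "0 \<le> dotp n w (mvec n M w)" for w
      using le[of w] by (simp add: M dotp_diff_right dotp_scale_right)
  qed
  hence "mvec n S v i = k * mvec n B v i" if "i \<in> {1..n}" for i using that by (simp add: M)
  thus ?thesis using that[of v k] nz[OF v] le by blast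
qed

section \<open>The Riccati equations and their explicit solutions\<close>

lemma mmul_transpose_Amat_left:
  assumes "is_mat n M"
  shows "mmul n (mtr (Amat n)) M i j = (if i \<in> {1..n} then M (i - 1) j else 0)"
proof -
  have "mmul n (mtr (Amat n)) M i j = (\<Sum>k=1..n. if i \<in> {1..n} \<and> k = i - 1 then M k j else 0)"
    unfolding mmul_def mtr_def Amat_def by (intro sum.cong) auto
  also have "\<dots> = (if i \<in> {1..n} then M (i - 1) j else 0)"
    using assms by (auto simp: is_mat_def sum.delta not_le)
  finally show ?thesis .
qed

lemma mmul_Amat_left:
  assumes "is_mat n M"
  shows "mmul n (Amat n) M i j = (if i \<in> {1..n} then M (i + 1) j else 0)"
proof -
  have "mmul n (Amat n) M i j = (\<Sum>k=1..n. if i \<in> {1..n} \<and> k = i + 1 then M k j else 0)"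
    unfolding mmul_def Amat_def by (intro sum.cong) auto
  also have "\<dots> = (if i \<in> {1..n} then M (i + 1) j else 0)"
    using assms by (auto simp: is_mat_def sum.delta not_le)
  finally show ?thesis .
qed

lemma mmul_transpose: "mmul n M N i j = mmul n (mtr N) (mtr M) j i"
  by (simp add: mmul_def mtr_def mult.commute)

lemma is_mat_mtr: "is_mat n (mtr M) \<longleftrightarrow> is_mat n M"
  by (auto simp: is_mat_def mtr_def)

lemma mtr_mtr: "mtr (mtr M) = M"
  by (simp add: mtr_def)

lemma mmul_Amat_right:
  assumes "is_mat n M"
  shows "mmul n M (Amat n) i j = (if j \<in> {1..n} then M i (j - 1) else 0)"
  unfolding mmul_transpose[of n M] using assms
  by (subst mmul_transpose_Amat_left) (simp_all add: is_mat_mtr, simp add: mtr_def)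

lemma mmul_transpose_Amat_right:
  assumes "is_mat n M"
  shows "mmul n M (mtr (Amat n)) i j = (if j \<in> {1..n} then M i (j + 1) else 0)"
  unfolding mmul_transpose[of n M] mtr_mtr using assms
  by (subst mmul_Amat_left) (simp_all add: is_mat_mtr, simp add: mtr_def)

lemma mmul_outer_unit:
  assumes "m \<in> {1..n}"
  shows "mmul n (mmul n M (outer n (\<lambda>i. if i = m then 1 else 0) (\<lambda>i. if i = m then 1 else 0))) M i j
    = M i m * M m j"
proof -
  have "mmul n M (outer n (\<lambda>i. if i = m then 1 else 0) (\<lambda>i. if i = m then 1 else 0)) i k
      = (if k = m then M i m else 0)" if "k \<in> {1..n}" for k
  proof -
    have "mmul n M (outer n (\<lambda>i. if i = m then 1 else 0) (\<lambda>i. if i = m then 1 else 0)) i k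
      = (\<Sum>l=1..n. if l = m then (if k = m then M i m else 0) else 0)"
      unfolding mmul_def outer_def using that by (intro sum.cong) auto
    thus ?thesis using assms by (simp add: sum.delta)
  qed
  hence "mmul n (mmul n M (outer n (\<lambda>i. if i = m then 1 else 0) (\<lambda>i. if i = m then 1 else 0))) M i j
    = (\<Sum>k=1..n. if k = m then M i m * M m j else 0)"
    unfolding mmul_def[of n "mmul n M _"] by (intro sum.cong) auto
  thus ?thesis using assms by (simp add: sum.delta)
qed

text \<open>Left multiplication by A^T shifts the rows, right multiplication by A the columns. For
  \<open>i = 1\<close> or \<open>j = 1\<close> the shifted entry has index 0 and is zero by
  \<open>is_mat\<close>, so the boundary takes no separate case.\<close>

definition riccati_P :: "nat \<Rightarrow> real \<Rightarrow> rmat \<Rightarrow> bool" where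
  "riccati_P n \<gamma> P \<longleftrightarrow> pos_def n P \<and>
    (\<forall>i\<in>{1..n}. \<forall>j\<in>{1..n}. P (i - 1) j + P i (j - 1) - P i n * P n j = - \<gamma> * P i j)"

lemma riccati_P_iff:
  assumes "n \<ge> 1"
  shows "pos_def n P \<and>
     madd (madd (mmul n (mtr (Amat n)) P) (mmul n P (Amat n)))
          (\<lambda>i j. - mmul n (mmul n P (outer n (bvec n) (bvec n))) P i j)
     = (\<lambda>i j. - \<gamma> * P i j) \<longleftrightarrow> riccati_P n \<gamma> P"
proof (cases "pos_def n P")
  case True
  hence P: "is_mat n P" by (simp add: pos_def_def)
  hence out: "P i j = 0" if "i \<notin> {1..n} \<or> j \<notin> {1..n}" for i j using that by (auto simp: is_mat_def)
  have "(madd (madd (mmul n (mtr (Amat n)) P) (mmul n P (Amat n)))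
          (\<lambda>i j. - mmul n (mmul n P (outer n (bvec n) (bvec n))) P i j) = (\<lambda>i j. - \<gamma> * P i j))
     \<longleftrightarrow> (\<forall>i j. (if i \<in> {1..n} then P (i - 1) j else 0) + (if j \<in> {1..n} then P i (j - 1) else 0)
           - P i n * P n j = - \<gamma> * P i j)"
    using assms
    by (simp add: fun_eq_iff madd_def bvec_def mmul_outer_unit mmul_transpose_Amat_left[OF P] mmul_Amat_right[OF P])
  also have "\<dots> \<longleftrightarrow> (\<forall>i\<in>{1..n}. \<forall>j\<in>{1..n}. P (i - 1) j + P i (j - 1) - P i n * P n j = - \<gamma> * P i j)"
    (is "?L \<longleftrightarrow> ?R")
  proof
    assume L: ?L
    show ?R
    proof (intro ballI)
      fix i j assume "i \<in> {1..n}" "j \<in> {1..n}"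
      thus "P (i - 1) j + P i (j - 1) - P i n * P n j = - \<gamma> * P i j" using L[rule_format, of i j] by simp
    qed
  next
    show "?L" if R: ?R
    proof (intro allI)
      fix i j
      show "(if i \<in> {1..n} then P (i - 1) j else 0) + (if j \<in> {1..n} then P i (j - 1) else 0)
           - P i n * P n j = - \<gamma> * P i j"
      proof (cases "i \<in> {1..n} \<and> j \<in> {1..n}")
        case True thus ?thesis using R by auto
      next
        case False thus ?thesis
          using out[of i j] out[of "i - 1" j] out[of i "j - 1"] out[of i n] out[of n j] by auto
      qed
    qed
  qed
  finally show ?thesis using True by (simp add: riccati_P_def)
qed (simp add: riccati_P_def)

section \<open>Index reversal between the two Riccati equations\<close>

definition flip :: "nat \<Rightarrow> rmat \<Rightarrow> rmat" where
  "flip n M = (\<lambda>i j. M (n + 1 - i) (n + 1 - j))"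

lemma sum_reverse: "(\<Sum>k=1..n. f (n + 1 - k)) = (\<Sum>k=1..n. f k)" for f :: "nat \<Rightarrow> 'a::comm_monoid_add"
  by (rule sum.reindex_bij_witness[of _ "\<lambda>k. n + 1 - k" "\<lambda>k. n + 1 - k"]) auto

text \<open>Truncated subtraction is harmless: 0 goes to \<open>n + 1\<close> and everything above
  \<open>n\<close> goes to 0, so indices outside \<open>1..n\<close> stay outside.\<close>

lemma is_mat_flip: "is_mat n M \<Longrightarrow> is_mat n (flip n M)"
  unfolding is_mat_def flip_def
proof (intro allI impI)
  fix i j
  assume M: "\<forall>i j. i \<notin> {1..n} \<or> j \<notin> {1..n} \<longrightarrow> M i j = 0" and "i \<notin> {1..n} \<or> j \<notin> {1..n}"
  hence "n + 1 - i \<notin> {1..n} \<or> n + 1 - j \<notin> {1..n}" by auto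
  thus "M (n + 1 - i) (n + 1 - j) = 0" using M by blast
qed

lemma flip_flip:
  assumes "is_mat n M"
  shows "flip n (flip n M) = M"
proof (intro ext)
  fix i j
  show "flip n (flip n M) i j = M i j"
  proof (cases "i \<in> {1..n} \<and> j \<in> {1..n}")
    case False
    thus ?thesis using assms is_mat_flip[OF is_mat_flip[OF assms]] by (auto simp: is_mat_def)
  qed (simp add: flip_def)
qed

lemma quadratic_flip:
  "dotp n v (mvec n (flip n M) v) = dotp n (\<lambda>i. v (n + 1 - i)) (mvec n M (\<lambda>i. v (n + 1 - i)))"
proof -
  define g where "g = (\<lambda>i j. v (n + 1 - i) * (M i j * v (n + 1 - j)))"
  have "dotp n v (mvec n (flip n M) v) = (\<Sum>i=1..n. \<Sum>j=1..n. v i * (M (n + 1 - i) (n + 1 - j) * v j))"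
    by (simp add: dotp_def mvec_def flip_def sum_distrib_left)
  also have "\<dots> = (\<Sum>i=1..n. \<Sum>j=1..n. g (n + 1 - i) (n + 1 - j))"
    by (intro sum.cong refl) (auto simp: g_def)
  also have "\<dots> = (\<Sum>i=1..n. \<Sum>j=1..n. g i j)"
    unfolding sum_reverse[of "\<lambda>j. g i j" for i] by (rule sum_reverse)
  finally show ?thesis by (simp add: dotp_def mvec_def sum_distrib_left g_def)
qed

lemma pos_def_flip: "pos_def n M \<Longrightarrow> pos_def n (flip n M)"
proof -
  assume M: "pos_def n M"
  have "dotp n v (mvec n (flip n M) v) > 0" if k: "k \<in> {1..n}" "v k \<noteq> 0" for v k
  proof -
    have "\<exists>k\<in>{1..n}. v (n + 1 - k) \<noteq> 0"
      by (rule bexI[of _ "n + 1 - k"]) (use k in auto)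
    thus ?thesis using M by (simp add: quadratic_flip pos_def_def)
  qed
  moreover have "\<forall>i j. flip n M i j = flip n M j i" using M by (auto simp: pos_def_def flip_def)
  ultimately show ?thesis using M is_mat_flip by (auto simp: pos_def_def)
qed

text \<open>Reversing the indices exchanges A with its transpose and b with c^T, so one closed form
  and one uniqueness proof serve for both equations. \<open>is_mat n Q\<close> stands beside the
  reversed equation because \<open>flip\<close> reads no entry of \<open>Q\<close> with an index
  above \<open>n + 1\<close>.\<close>

lemma riccati_Q_iff:
  assumes "n \<ge> 1"
  shows "pos_def n Q \<and>
     madd (madd (mmul n (Amat n) Q) (mmul n Q (mtr (Amat n))))
          (\<lambda>i j. - mmul n (mmul n Q (outer n (cvec n) (cvec n))) Q i j)
     = (\<lambda>i j. - \<gamma> * Q i j) \<longleftrightarrow> is_mat n Q \<and> riccati_P n \<gamma> (flip n Q)"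
proof (cases "pos_def n Q")
  case True
  hence Q: "is_mat n Q" by (simp add: pos_def_def)
  hence out: "Q i j = 0" if "i \<notin> {1..n} \<or> j \<notin> {1..n}" for i j using that by (auto simp: is_mat_def)
  have "(madd (madd (mmul n (Amat n) Q) (mmul n Q (mtr (Amat n))))
          (\<lambda>i j. - mmul n (mmul n Q (outer n (cvec n) (cvec n))) Q i j) = (\<lambda>i j. - \<gamma> * Q i j))
     \<longleftrightarrow> (\<forall>i j. (if i \<in> {1..n} then Q (i + 1) j else 0) + (if j \<in> {1..n} then Q i (j + 1) else 0)
           - Q i 1 * Q 1 j = - \<gamma> * Q i j)"
    using assms
    by (simp add: fun_eq_iff madd_def cvec_def mmul_outer_unit mmul_Amat_left[OF Q] mmul_transpose_Amat_right[OF Q])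
  also have "\<dots> \<longleftrightarrow> (\<forall>i\<in>{1..n}. \<forall>j\<in>{1..n}. Q (i + 1) j + Q i (j + 1) - Q i 1 * Q 1 j = - \<gamma> * Q i j)"
    (is "?L \<longleftrightarrow> ?R")
  proof
    assume L: ?L
    show ?R
    proof (intro ballI)
      fix i j assume "i \<in> {1..n}" "j \<in> {1..n}"
      thus "Q (i + 1) j + Q i (j + 1) - Q i 1 * Q 1 j = - \<gamma> * Q i j" using L[rule_format, of i j] by simp
    qed
  next
    show "?L" if R: ?R
    proof (intro allI)
      fix i j
      show "(if i \<in> {1..n} then Q (i + 1) j else 0) + (if j \<in> {1..n} then Q i (j + 1) else 0)
           - Q i 1 * Q 1 j = - \<gamma> * Q i j"
      proof (cases "i \<in> {1..n} \<and> j \<in> {1..n}")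
        case True thus ?thesis using R by auto
      next
        case False thus ?thesis
          using out[of i j] out[of "i + 1" j] out[of i "j + 1"] out[of i 1] out[of 1 j] by auto
      qed
    qed
  qed
  also have "\<dots> \<longleftrightarrow> (\<forall>i\<in>{1..n}. \<forall>j\<in>{1..n}. flip n Q (i - 1) j + flip n Q i (j - 1)
       - flip n Q i n * flip n Q n j = - \<gamma> * flip n Q i j)" (is "?L \<longleftrightarrow> ?R")
  proof
    assume L: ?L
    show ?R
    proof (intro ballI)
      fix i j assume ij: "i \<in> {1..n}" "j \<in> {1..n}"
      have e: "n + 1 - (i - 1) = (n + 1 - i) + 1" "n + 1 - (j - 1) = (n + 1 - j) + 1" "n + 1 - n = 1"
        using ij by auto
      have "n + 1 - i \<in> {1..n}" "n + 1 - j \<in> {1..n}" using ij by auto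
      from L[rule_format, OF this]
      show "flip n Q (i - 1) j + flip n Q i (j - 1)
       - flip n Q i n * flip n Q n j = - \<gamma> * flip n Q i j"
        unfolding flip_def e .
    qed
  next
    assume R: ?R
    show ?L
    proof (intro ballI)
      fix i j assume ij: "i \<in> {1..n}" "j \<in> {1..n}"
      have e: "n + 1 - (n + 1 - i - 1) = i + 1" "n + 1 - (n + 1 - j - 1) = j + 1" "n + 1 - n = 1"
        "n + 1 - (n + 1 - i) = i" "n + 1 - (n + 1 - j) = j"
        using ij by auto
      have "n + 1 - i \<in> {1..n}" "n + 1 - j \<in> {1..n}" using ij by auto
      from R[rule_format, OF this] show "Q (i + 1) j + Q i (j + 1) - Q i 1 * Q 1 j = - \<gamma> * Q i j"
        unfolding flip_def e .
    qed
  qed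
  finally show ?thesis using True Q pos_def_flip[OF True] by (simp add: riccati_P_def)
next
  case False
  have "\<not> (is_mat n Q \<and> pos_def n (flip n Q))" using False pos_def_flip[of n "flip n Q"] flip_flip[of n Q] by auto
  thus ?thesis using False by (auto simp: riccati_P_def)
qed

section \<open>The Pascal matrix, its inverse and its Gram matrix\<close>

definition pasc :: "nat \<Rightarrow> (nat \<Rightarrow> real) \<Rightarrow> nat \<Rightarrow> real" where
  "pasc n u k = (\<Sum>a<n. real (k choose a) * u a)"

definition pasc_tr :: "nat \<Rightarrow> (nat \<Rightarrow> real) \<Rightarrow> nat \<Rightarrow> real" where
  "pasc_tr n u k = (\<Sum>a<n. real (a choose k) * u a)"

definition alt :: "(nat \<Rightarrow> real) \<Rightarrow> nat \<Rightarrow> real" where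
  "alt u a = (-1) ^ a * u a"

text \<open>Let C be the matrix of the \<open>k choose l\<close> and D the diagonal of alternating
  signs, so that \<open>pasc\<close>, \<open>pasc_tr\<close> and \<open>alt\<close> apply C, its
  transpose and D. The claim is C D C D = I: trinomial revision turns each product of binomials into
  \<open>k choose a\<close> times an entry of row \<open>k - a\<close>, whose alternating sum is
  zero unless \<open>k = a\<close>.\<close>

lemma binomial_orthogonality:
  assumes "k < n"
  shows "(\<Sum>l<n. real (k choose l) * ((-1) ^ l * (real (l choose a) * (-1) ^ a))) = (if k = a then 1 else 0)"
proof -
  have "(\<Sum>l<n. real (k choose l) * ((-1) ^ l * (real (l choose a) * (-1) ^ a)))
      = (\<Sum>l\<in>{a..k}. real (k choose l) * ((-1) ^ l * (real (l choose a) * (-1) ^ a)))"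
    using assms by (intro sum.mono_neutral_right) (auto simp: not_le)
  also have "\<dots> = (if k = a then 1 else 0)"
  proof (cases "a \<le> k")
    case True
    have "(\<Sum>l\<in>{a..k}. real (k choose l) * ((-1) ^ l * (real (l choose a) * (-1) ^ a)))
      = (\<Sum>l\<in>{a..k}. real (k choose a) * ((-1) ^ (l - a) * real ((k - a) choose (l - a))))"
    proof (intro sum.cong refl)
      fix l assume l: "l \<in> {a..k}"
      have "real (k choose l) * real (l choose a) = real (k choose a) * real ((k - a) choose (l - a))"
        using l by (simp flip: of_nat_mult add: choose_mult)
      moreover have "(-1::real) ^ l * (-1) ^ a = (-1) ^ (l - a)"
      proof -
        have "l = (l - a) + a" using l by simp
        hence "(-1::real) ^ l * (-1) ^ a = (-1) ^ (l - a) * ((-1) ^ a * (-1) ^ a)"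
          by (metis mult.assoc power_add)
        thus ?thesis by (simp flip: power_add)
      qed
      ultimately show "real (k choose l) * ((-1) ^ l * (real (l choose a) * (-1) ^ a))
        = real (k choose a) * ((-1) ^ (l - a) * real ((k - a) choose (l - a)))"
        by (metis (no_types, opaque_lifting) mult.assoc mult.commute)
    qed
    also have "\<dots> = real (k choose a) * (\<Sum>l\<in>{a..k}. (-1) ^ (l - a) * real ((k - a) choose (l - a)))"
      by (simp add: sum_distrib_left)
    also have "(\<Sum>l\<in>{a..k}. (-1::real) ^ (l - a) * real ((k - a) choose (l - a)))
        = (\<Sum>l\<le>k - a. (-1) ^ l * real ((k - a) choose l))"
      by (rule sum.reindex_bij_witness[of _ "\<lambda>l. l + a" "\<lambda>l. l - a"]) (use True in auto)
    also have "\<dots> = (if k = a then 1 else 0)"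
      using choose_alternating_sum[of "k - a", where 'a = real] True by (cases "k = a") auto
    finally show ?thesis by auto
  qed auto
  finally show ?thesis .
qed

lemma pasc_inverse:
  assumes "k < n"
  shows "pasc n (alt (pasc n (alt u))) k = u k"
proof -
  have "pasc n (alt (pasc n (alt u))) k
      = (\<Sum>l<n. \<Sum>a<n. (real (k choose l) * ((-1) ^ l * (real (l choose a) * (-1) ^ a))) * u a)"
    by (simp add: pasc_def alt_def sum_distrib_left mult.assoc)
  also have "\<dots> = (\<Sum>a<n. (\<Sum>l<n. real (k choose l) * ((-1) ^ l * (real (l choose a) * (-1) ^ a))) * u a)"
    by (subst sum.swap) (simp add: sum_distrib_right)
  also have "\<dots> = (\<Sum>a<n. (if k = a then 1 else 0) * u a)"
    using binomial_orthogonality[OF assms] by simp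
  also have "\<dots> = u k" using assms by (simp add: if_distrib[of "\<lambda>x. x * _"] cong: if_cong)
  finally show ?thesis .
qed

lemma pasc_tr_inverse:
  assumes "k < n"
  shows "pasc_tr n (alt (pasc_tr n (alt u))) k = u k"
proof -
  have "pasc_tr n (alt (pasc_tr n (alt u))) k
      = (\<Sum>l<n. \<Sum>a<n. (real (l choose k) * ((-1) ^ l * (real (a choose l) * (-1) ^ a))) * u a)"
    by (simp add: pasc_tr_def alt_def sum_distrib_left mult.assoc)
  also have "\<dots> = (\<Sum>a<n. (\<Sum>l<n. real (l choose k) * ((-1) ^ l * (real (a choose l) * (-1) ^ a))) * u a)"
    by (subst sum.swap) (simp add: sum_distrib_right)
  also have "\<dots> = (\<Sum>a<n. (if a = k then 1 else 0) * u a)"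
  proof (intro sum.cong refl arg_cong2[of _ _ _ _ "(*)"])
    fix a assume "a \<in> {..<n}"
    hence "a < n" by simp
    \<comment> \<open>In the transposed product the outer sign sits at \<open>a\<close>, while the
      orthogonality relation has it at \<open>k\<close>. The factor
      \<open>(-1) ^ k * (-1) ^ a\<close> corrects this and is 1 on the diagonal.\<close>
    have "(\<Sum>l<n. real (l choose k) * ((-1) ^ l * (real (a choose l) * (-1) ^ a)))
       = (\<Sum>l<n. real (a choose l) * ((-1) ^ l * (real (l choose k) * (-1) ^ k))) * ((-1) ^ k * (-1) ^ a)"
      unfolding sum_distrib_right
    proof (intro sum.cong refl)
      fix l
      have kk: "(-1::real) ^ k * (-1) ^ k = 1" by (simp flip: power_add)
      have "real (a choose l) * ((-1) ^ l * (real (l choose k) * (-1) ^ k)) * ((-1) ^ k * (-1) ^ a)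
        = real (l choose k) * ((-1) ^ l * (real (a choose l) * (-1) ^ a)) * ((-1) ^ k * (-1) ^ k)"
        by (simp only: mult_ac)
      thus "real (l choose k) * ((-1) ^ l * (real (a choose l) * (-1) ^ a))
        = real (a choose l) * ((-1) ^ l * (real (l choose k) * (-1) ^ k)) * ((-1) ^ k * (-1) ^ a)"
        unfolding kk by simp
    qed
    also have "\<dots> = (if a = k then 1 else 0)"
      unfolding binomial_orthogonality[OF \<open>a < n\<close>] by (simp flip: power_add)
    finally show "(\<Sum>l<n. real (l choose k) * ((-1) ^ l * (real (a choose l) * (-1) ^ a))) = (if a = k then 1 else 0)" .
  qed
  also have "\<dots> = u k" using assms by (simp add: if_distrib[of "\<lambda>x. x * _"] cong: if_cong)
  finally show ?thesis .
qed

definition pasc_gram :: "nat \<Rightarrow> nat \<Rightarrow> nat \<Rightarrow> real" where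
  "pasc_gram n a b = (\<Sum>k<n. real (k choose a) * real (k choose b))"

text \<open>By Pascal's rule, adding one row to the Gram sums changes both sides equally. This is
  the Riccati equation of \<open>P_expl\<close> stripped of the powers of \<gamma>: two shifts, the
  matrix itself and the rank-one term.\<close>

lemma pasc_gram_rec:
  "pasc_gram n (Suc a) b + pasc_gram n a (Suc b) + pasc_gram n a b
    = real (n choose Suc a) * real (n choose Suc b)"
proof (induction n)
  case (Suc n)
  have "pasc_gram (Suc n) (Suc a) b + pasc_gram (Suc n) a (Suc b) + pasc_gram (Suc n) a b
     = (pasc_gram n (Suc a) b + pasc_gram n a (Suc b) + pasc_gram n a b)
       + real (n choose Suc a) * real (n choose b) + real (n choose a) * real (n choose Suc b)
       + real (n choose a) * real (n choose b)"
    by (simp add: pasc_gram_def)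
  also have "\<dots> = real (Suc n choose Suc a) * real (Suc n choose Suc b)"
    unfolding Suc.IH by (simp add: algebra_simps)
  finally show ?case .
qed (simp add: pasc_gram_def)

text \<open>Hockey-stick summation; these are the entries of the last row and column of P, hence of
  the feedback gain.\<close>

lemma pasc_gram_0: "pasc_gram n a 0 = real (n choose Suc a)"
  by (induction n) (simp_all add: pasc_gram_def)

lemma pasc_gram_commute: "pasc_gram n a b = pasc_gram n b a"
  by (simp add: pasc_gram_def mult.commute)

lemma pasc_gram_ge: "a \<ge> n \<Longrightarrow> pasc_gram n a b = 0"
  by (auto simp: pasc_gram_def intro!: sum.neutral)

section \<open>Closed forms of the Riccati solution and of its inverse\<close>

definition P_expl :: "nat \<Rightarrow> real \<Rightarrow> rmat" where
  "P_expl n \<gamma> = (\<lambda>i j. if i \<in> {1..n} \<and> j \<in> {1..n}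
     then \<gamma> ^ ((n - i) + (n - j) + 1) * pasc_gram n (n - i) (n - j) else 0)"

text \<open>For \<gamma> = 1 and reversed indices P is C^T C, so its inverse is D C C^T D, and C C^T
  has the entries \<open>(a + b) choose a\<close> by Vandermonde. The powers of \<gamma> are a
  diagonal scaling and a scalar factor, which P and its inverse carry with opposite
  exponents.\<close>

definition X_expl :: "nat \<Rightarrow> real \<Rightarrow> rmat" where
  "X_expl n \<gamma> = (\<lambda>i j. if i \<in> {1..n} \<and> j \<in> {1..n}
     then (-1) ^ ((n - i) + (n - j)) * real (((n - i) + (n - j)) choose (n - i)) / \<gamma> ^ ((n - i) + (n - j) + 1) else 0)"

lemma sum_1_to_n_reverse: "(\<Sum>i=1..n. f i) = (\<Sum>a<n. f (n - a))" for f :: "nat \<Rightarrow> real"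
  by (rule sum.reindex_bij_witness[of _ "\<lambda>a. n - a" "\<lambda>a. n - a"]) auto

lemma sum_1_to_n_shift: "(\<Sum>i=1..n. f i) = (\<Sum>a<n. f (Suc a))" for f :: "nat \<Rightarrow> real"
  by (simp add: sum.atLeast1_atMost_eq)

lemma quadratic_P_expl:
  "dotp n v (mvec n (P_expl n \<gamma>) v) = \<gamma> * (\<Sum>k<n. (pasc n (\<lambda>a. \<gamma> ^ a * v (n - a)) k)\<^sup>2)"
proof -
  have "dotp n v (mvec n (P_expl n \<gamma>) v)
     = (\<Sum>a<n. \<Sum>b<n. v (n - a) * (P_expl n \<gamma> (n - a) (n - b) * v (n - b)))"
    unfolding dotp_def mvec_def sum_distrib_left sum_1_to_n_reverse ..
  also have "\<dots> = (\<Sum>a<n. \<Sum>b<n. \<Sum>k<n. \<gamma> * ((real (k choose a) * (\<gamma> ^ a * v (n - a))) * (real (k choose b) * (\<gamma> ^ b * v (n - b)))))"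
    by (intro sum.cong refl)
       (auto simp: P_expl_def pasc_gram_def sum_distrib_left sum_distrib_right power_add algebra_simps)
  also have "\<dots> = (\<Sum>k<n. \<Sum>a<n. \<Sum>b<n. \<gamma> * ((real (k choose a) * (\<gamma> ^ a * v (n - a))) * (real (k choose b) * (\<gamma> ^ b * v (n - b)))))"
    by (subst sum.swap[of _ "{..<n}" "{..<n}"], subst (2) sum.swap) (rule refl)
  also have "\<dots> = \<gamma> * (\<Sum>k<n. (pasc n (\<lambda>a. \<gamma> ^ a * v (n - a)) k)\<^sup>2)"
    by (simp only: pasc_def power2_eq_square sum_product) (simp only: sum_distrib_left)
  finally show ?thesis .
qed

lemma pos_def_P_expl:
  assumes "\<gamma> > 0"
  shows "pos_def n (P_expl n \<gamma>)"
proof -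
  have "0 < dotp n v (mvec n (P_expl n \<gamma>) v)" if i: "i \<in> {1..n}" "v i \<noteq> 0" for v i
  proof -
    define u where "u = (\<lambda>a. \<gamma> ^ a * v (n - a))"
    have "\<exists>k<n. pasc n u k \<noteq> 0"
    proof (rule ccontr)
      assume "\<not> ?thesis"
      hence z: "\<And>k. k < n \<Longrightarrow> pasc n u k = 0" by auto
      have "u (n - i) = pasc n (alt (pasc n (alt (alt u)))) (n - i) * (-1) ^ (n - i)"
        using i by (subst pasc_inverse) (auto simp: alt_def simp flip: power_add)
      also have "alt (alt u) = u" by (auto simp: alt_def fun_eq_iff simp flip: power_add mult.assoc)
      also have "pasc n (alt (pasc n u)) (n - i) = 0"
        using z by (simp add: pasc_def[of n "alt _"] alt_def)
      finally have "u (n - i) = 0" by simp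
      thus False using i assms by (simp add: u_def)
    qed
    hence "0 < (\<Sum>k<n. (pasc n u k)\<^sup>2)" by (auto intro: sum_pos2)
    thus ?thesis using assms by (simp add: quadratic_P_expl u_def)
  qed
  thus ?thesis by (auto simp: pos_def_def is_mat_def P_expl_def pasc_gram_commute[of n] add.commute)
qed

lemma P_expl_prev:
  assumes "i \<in> {1..n}" "j \<in> {1..n}"
  shows "P_expl n \<gamma> (i - 1) j = \<gamma> ^ ((n - i) + (n - j) + 2) * pasc_gram n (Suc (n - i)) (n - j)"
\<comment> \<open>At \<open>i = 1\<close> the left entry has index 0, and the Gram entry on the
  right involves \<open>k choose n\<close> with \<open>k < n\<close>; both are zero.\<close>
proof (cases "i = 1")
  case False
  hence "n - (i - 1) = Suc (n - i)" using assms by auto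
  thus ?thesis using assms False by (auto simp: P_expl_def)
qed (use assms in \<open>auto simp: P_expl_def pasc_gram_ge\<close>)

lemma P_expl_sym: "P_expl n \<gamma> i j = P_expl n \<gamma> j i"
  by (simp add: P_expl_def pasc_gram_commute[of n "n - i"] add.commute)

lemma riccati_P_expl:
  assumes "\<gamma> > 0"
  shows "riccati_P n \<gamma> (P_expl n \<gamma>)"
  unfolding riccati_P_def
proof (intro conjI ballI)
  fix i j assume ij: "i \<in> {1..n}" "j \<in> {1..n}"
  define a b where "a = n - i" and "b = n - j"
  have ab: "P_expl n \<gamma> i j = \<gamma> ^ (a + b + 1) * pasc_gram n a b" using ij by (simp add: P_expl_def a_def b_def)
  have 1: "P_expl n \<gamma> (i - 1) j = \<gamma> ^ (a + b + 2) * pasc_gram n (Suc a) b"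
    using P_expl_prev[OF ij] by (simp add: a_def b_def)
  have 2: "P_expl n \<gamma> i (j - 1) = \<gamma> ^ (a + b + 2) * pasc_gram n a (Suc b)"
    using P_expl_prev[OF ij(2,1)] by (simp add: P_expl_sym[of n \<gamma> i] a_def b_def pasc_gram_commute add.commute)
  have 3: "P_expl n \<gamma> i n = \<gamma> ^ (a + 1) * real (n choose Suc a)"
    using ij by (simp add: P_expl_def a_def pasc_gram_0)
  have 4: "P_expl n \<gamma> n j = \<gamma> ^ (b + 1) * real (n choose Suc b)"
    using ij by (subst P_expl_sym) (simp add: P_expl_def b_def pasc_gram_0)
  have "P_expl n \<gamma> (i - 1) j + P_expl n \<gamma> i (j - 1) - P_expl n \<gamma> i n * P_expl n \<gamma> n j
    = \<gamma> ^ (a + b + 2) * (pasc_gram n (Suc a) b + pasc_gram n a (Suc b) - real (n choose Suc a) * real (n choose Suc b))"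
    unfolding 1 2 3 4 by (simp add: power_add algebra_simps power2_eq_square)
  also have "pasc_gram n (Suc a) b + pasc_gram n a (Suc b) - real (n choose Suc a) * real (n choose Suc b)
    = - pasc_gram n a b"
    using pasc_gram_rec[of n a b] by simp
  finally show "P_expl n \<gamma> (i - 1) j + P_expl n \<gamma> i (j - 1) - P_expl n \<gamma> i n * P_expl n \<gamma> n j = - \<gamma> * P_expl n \<gamma> i j"
    unfolding ab by simp
qed (rule pos_def_P_expl[OF assms])

lemma X_expl_sym: "X_expl n \<gamma> i j = X_expl n \<gamma> j i"
proof -
  have "(a + b choose a) = (b + a choose b)" for a b :: nat
    using binomial_symmetric[of a "a + b"] by (simp add: add.commute)
  from this[of "n - i" "n - j"] show ?thesis unfolding X_expl_def by (auto simp only: add.commute conj_commute)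
qed

text \<open>Multiplying the Riccati equation by the inverse of P from both sides leaves the linear
  equation A X + X A^T + \<gamma> X = b b^T. Here it is Pascal's rule with signs; the right side
  comes from the corner, where both shifted entries are zero.\<close>

lemma X_expl_rec:
  assumes "\<gamma> > 0" and ij: "i \<in> {1..n}" "j \<in> {1..n}"
  shows "X_expl n \<gamma> (i + 1) j + X_expl n \<gamma> i (j + 1) + \<gamma> * X_expl n \<gamma> i j = (if i = n \<and> j = n then 1 else 0)"
proof -
  define a b where "a = n - i" and "b = n - j"
  have 0: "\<gamma> * X_expl n \<gamma> i j = (-1) ^ (a + b) * real ((a + b) choose a) / \<gamma> ^ (a + b)"
    using ij assms by (simp add: X_expl_def a_def b_def)
  have 1: "X_expl n \<gamma> (i + 1) j = (if a = 0 then 0 else - ((-1) ^ (a + b) * real ((a + b - 1) choose (a - 1)) / \<gamma> ^ (a + b)))"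
  proof (cases "a = 0")
    case False
    then obtain a' where a': "a = Suc a'" by (cases a) auto
    hence "n - (i + 1) = a'" by (simp add: a_def)
    thus ?thesis using ij a' by (auto simp: X_expl_def a_def b_def)
  qed (use ij in \<open>auto simp: X_expl_def a_def\<close>)
  have 2: "X_expl n \<gamma> i (j + 1) = (if b = 0 then 0 else - ((-1) ^ (a + b) * real ((a + b - 1) choose a) / \<gamma> ^ (a + b)))"
  proof (cases "b = 0")
    case False
    then obtain b' where b': "b = Suc b'" by (cases b) auto
    hence "n - (j + 1) = b'" by (simp add: b_def)
    thus ?thesis using ij b' by (auto simp: X_expl_def a_def b_def)
  qed (use ij in \<open>auto simp: X_expl_def b_def\<close>)
  have e: "(i = n \<and> j = n) = (a = 0 \<and> b = 0)" using ij by (auto simp: a_def b_def)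
  have c: "((a + b) choose a) = ((a + b - 1) choose (a - 1)) + ((a + b - 1) choose a)" if "a > 0" "b > 0"
    using that by (cases a) auto
  show ?thesis unfolding 0 1 2 e by (auto simp: c distrib_left add_divide_distrib)
qed

text \<open>Carries a shift from one factor of a matrix product to the other with vanishing boundary
  terms, as in X (A^T P) = (X A^T) P.\<close>

lemma sum_shift_vanishing:
  fixes f g :: "nat \<Rightarrow> real"
  assumes "f (n + 1) = 0" "g 0 = 0"
  shows "(\<Sum>k=1..n. f k * g (k - 1)) = (\<Sum>k=1..n. f (k + 1) * g k)"
proof -
  have "(\<Sum>k=1..n. f k * g (k - 1)) = (\<Sum>k<n. f (Suc k) * g k)"
    by (simp add: sum.atLeast1_atMost_eq)
  also have "\<dots> = (\<Sum>k\<le>n. f (Suc k) * g k)" using assms by (simp add: lessThan_Suc_atMost[symmetric])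
  also have "\<dots> = (\<Sum>k=1..n. f (Suc k) * g k)"
    using assms by (intro sum.mono_neutral_right) (auto simp: not_le Suc_le_eq)
  finally show ?thesis by simp
qed

text \<open>With \<open>N = X P - I\<close>, the Riccati equation of \<open>P\<close> and the Lyapunov equation of \<open>X\<close> give
  \<open>N (A - b b\<^sup>T P) = A N\<close>, so the rows of \<open>N\<close> vanish successively from the last one upwards.\<close>
lemma X_expl_left_inverse:
  assumes \<gamma>: "\<gamma> > 0" and P: "riccati_P n \<gamma> P"
    and i: "i \<in> {1..n}" and j: "j \<in> {1..n}"
  shows "mmul n (X_expl n \<gamma>) P i j = idm n i j"
proof -
  let ?X = "X_expl n \<gamma>"
  define N where "N = (\<lambda>i j. mmul n ?X P i j - idm n i j)"
  have n: "n \<ge> 1" using i by auto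
  have pd: "pos_def n P" and are: "\<And>i j. i \<in> {1..n} \<Longrightarrow> j \<in> {1..n} \<Longrightarrow>
      P (i - 1) j + P i (j - 1) - P i n * P n j = - \<gamma> * P i j" using P by (auto simp: riccati_P_def)
  hence out: "P i j = 0" if "i \<notin> {1..n} \<or> j \<notin> {1..n}" for i j using that by (auto simp: pos_def_def is_mat_def)
  have sym: "P i j = P j i" for i j using pd by (auto simp: pos_def_def)
  have Xout: "?X i j = 0" if "i \<notin> {1..n} \<or> j \<notin> {1..n}" for i j using that by (auto simp: X_expl_def)
  define e :: rvec where "e = (\<lambda>i. if i = 1 then 1 else 0)"
  have "dotp n e (mvec n P e) > 0" using pd n by (auto simp: pos_def_def e_def intro!: bexI[of _ 1])
  moreover have "dotp n e (mvec n P e) = mvec n P e 1" unfolding e_def by (rule dotp_unit) (use n in simp)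
  moreover have "mvec n P e 1 = dotp n e (P 1)" by (simp add: mvec_def dotp_def mult.commute)
  moreover have "dotp n e (P 1) = P 1 1" unfolding e_def by (rule dotp_unit) (use n in simp)
  ultimately have "P 1 1 > 0" by simp
  \<comment> \<open>Both shifted entries of the (1,1) equation have index 0, so it reads
    \<open>(P n 1)^2 = \<gamma> * P 1 1\<close>, and \<open>P 1 1\<close> is positive.\<close>
  hence Pn1: "P n 1 \<noteq> 0" using are[of 1 1] n out[of 0 1] out[of 1 0] \<gamma> by (auto simp: sym[of n 1])
  have rec: "N i (j - 1) - N i n * P n j = N (i + 1) j" if i: "i \<in> {1..n}" and j: "j \<in> {1..n}" for i j
  proof -
    have "(\<Sum>k=1..n. ?X i k * (P (k - 1) j + P k (j - 1) - P k n * P n j + \<gamma> * P k j)) = 0"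
      using are j by (intro sum.neutral) auto
    hence a: "(\<Sum>k=1..n. ?X i k * P (k - 1) j) + mmul n ?X P i (j - 1) - mmul n ?X P i n * P n j
        + \<gamma> * mmul n ?X P i j = 0"
      by (simp add: mmul_def algebra_simps sum.distrib sum_subtractf sum_distrib_left)
    have "(\<Sum>k=1..n. (?X (i + 1) k + ?X i (k + 1) + \<gamma> * ?X i k) * P k j)
       = (\<Sum>k=1..n. if k = n then (if i = n then P n j else 0) else 0)"
      by (intro sum.cong refl, subst X_expl_rec) (use \<gamma> i in auto)
    also have "\<dots> = (if i = n then P n j else 0)" using n by (simp add: sum.delta)
    finally have b: "mmul n ?X P (i + 1) j + (\<Sum>k=1..n. ?X i (k + 1) * P k j) + \<gamma> * mmul n ?X P i j
        = (if i = n then P n j else 0)"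
      by (simp add: mmul_def algebra_simps sum.distrib sum_distrib_left)
    have c: "(\<Sum>k=1..n. ?X i k * P (k - 1) j) = (\<Sum>k=1..n. ?X i (k + 1) * P k j)"
      by (rule sum_shift_vanishing) (use Xout out in auto)
    have "idm n i (j - 1) = idm n (i + 1) j" using i j by (auto simp: idm_def)
    moreover have "idm n i n = (if i = n then 1 else 0)" using i by (auto simp: idm_def)
    ultimately show ?thesis using a b c by (simp add: N_def algebra_simps split: if_splits)
  qed
  have N0: "N i 0 = 0" for i by (auto simp: N_def mmul_def idm_def out)
  have "\<forall>j\<in>{1..n}. N i j = 0" if "i \<le> n + 1" "i \<ge> 1" for i
    using that
  proof (induction i rule: inc_induct)
    case base
    show ?case using Xout by (auto simp: N_def mmul_def idm_def)
  next
    case (step i)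
    have i: "i \<in> {1..n}" using step by auto
    have r: "N i (j - 1) = N i n * P n j" if "j \<in> {1..n}" for j
      using rec[OF i that] step.IH that by auto
    \<comment> \<open>In column 1 the shift reads index 0, so \<open>N i n * P n 1\<close> vanishes
      and with it \<open>N i n\<close>; after that the recursion clears the other columns of the
      row.\<close>
    have Nn: "N i n = 0" using r[of 1] n N0 Pn1 by auto
    show ?case
    proof
      fix j assume j: "j \<in> {1..n}"
      show "N i j = 0"
      proof (cases "j = n")
        case False
        thus ?thesis using r[of "j + 1"] j Nn by auto
      qed (use Nn in simp)
    qed
  qed
  thus ?thesis using i j by (auto simp: N_def)
qed

section \<open>Uniqueness of the Riccati solutions\<close>

lemma mmul_assoc: "mmul n (mmul n A B) C = mmul n A (mmul n B C)"
  unfolding mmul_def sum_distrib_left sum_distrib_right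
  by (intro ext, subst sum.swap) (simp add: mult_ac)

lemma mmul_cong:
  "(\<And>k. k \<in> {1..n} \<Longrightarrow> A i k = A' i k) \<Longrightarrow> (\<And>k. k \<in> {1..n} \<Longrightarrow> B k j = B' k j) \<Longrightarrow>
    mmul n A B i j = mmul n A' B' i j"
  by (simp add: mmul_def)

lemma mmul_idm_left: "i \<in> {1..n} \<Longrightarrow> mmul n (idm n) A i j = A i j"
  by (simp add: mmul_def idm_def if_distrib[of "\<lambda>x. x * _"] cong: if_cong)

lemma mmul_idm_right: "j \<in> {1..n} \<Longrightarrow> mmul n A (idm n) i j = A i j"
  by (simp add: mmul_def idm_def if_distrib[of "\<lambda>x. _ * x"] cong: if_cong)

text \<open>Every solution has the same explicit X as inverse, and by symmetry on either side,
  whence P = P (X P') = (P X) P' = P'.\<close>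

lemma riccati_P_unique:
  assumes \<gamma>: "\<gamma> > 0" and P: "riccati_P n \<gamma> P" and P': "riccati_P n \<gamma> P'"
  shows "P = P'"
proof (intro ext)
  fix i j
  have sym: "P i j = P j i" for i j using P by (auto simp: riccati_P_def pos_def_def)
  show "P i j = P' i j"
  proof (cases "i \<in> {1..n} \<and> j \<in> {1..n}")
    case False
    thus ?thesis using P P' by (auto simp: riccati_P_def pos_def_def is_mat_def)
  next
    case True
    hence ij: "i \<in> {1..n}" "j \<in> {1..n}" by auto
    have PX: "mmul n P (X_expl n \<gamma>) i k = idm n i k" if "k \<in> {1..n}" for k
    proof -
      have "mmul n P (X_expl n \<gamma>) i k = mmul n (mtr (X_expl n \<gamma>)) (mtr P) k i" by (rule mmul_transpose)
      also have "\<dots> = mmul n (X_expl n \<gamma>) P k i"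
        by (intro mmul_cong) (simp_all add: mtr_def X_expl_sym[of n \<gamma> _ k] sym[of _ i])
      finally show ?thesis using X_expl_left_inverse[OF \<gamma> P that ij(1)] by (auto simp: idm_def)
    qed
    have "P i j = mmul n P (idm n) i j" using ij by (simp add: mmul_idm_right)
    also have "\<dots> = mmul n P (mmul n (X_expl n \<gamma>) P') i j"
      by (rule mmul_cong) (use X_expl_left_inverse[OF \<gamma> P' _ ij(2)] in auto)
    also have "\<dots> = mmul n (idm n) P' i j"
      unfolding mmul_assoc[symmetric] by (rule mmul_cong) (use PX in auto)
    also have "\<dots> = P' i j" using ij by (simp add: mmul_idm_left)
    finally show ?thesis .
  qed
qed

lemma Pm_expl:
  assumes "n \<ge> 1" "\<gamma> > 0"
  shows "Pm n \<gamma> = P_expl n \<gamma>"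
  unfolding Pm_def riccati_P_iff[OF assms(1)]
  using riccati_P_expl[OF assms(2)] riccati_P_unique[OF assms(2)] by blast

lemma Qm_expl:
  assumes "n \<ge> 1" "\<gamma> > 0"
  shows "Qm n \<gamma> = flip n (P_expl n \<gamma>)"
  unfolding Qm_def riccati_Q_iff[OF assms(1)]
proof (rule the_equality)
  have P: "is_mat n (P_expl n \<gamma>)" by (auto simp: is_mat_def P_expl_def)
  show "is_mat n (flip n (P_expl n \<gamma>)) \<and> riccati_P n \<gamma> (flip n (flip n (P_expl n \<gamma>)))"
    using is_mat_flip[OF P] flip_flip[OF P] riccati_P_expl[OF assms(2)] by simp
  fix Q assume Q: "is_mat n Q \<and> riccati_P n \<gamma> (flip n Q)"
  hence "flip n Q = P_expl n \<gamma>" using riccati_P_unique[OF assms(2) _ riccati_P_expl[OF assms(2)]] by blast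
  thus "Q = flip n (P_expl n \<gamma>)" using flip_flip[of n Q] Q by metis
qed

section \<open>Quadratic form estimates\<close>

lemma eigenvalue_le_lam_max: "eigenvalue_of n M k \<Longrightarrow> k \<le> lam_max n M"
  unfolding lam_max_def by (rule Max_ge[OF finite_eigenvalues]) simp

lemma psd_cauchy_schwarz:
  assumes sym: "\<And>i j. M i j = M j i" and psd: "\<And>w. 0 \<le> dotp n w (mvec n M w)"
  shows "(dotp n v (mvec n M w))\<^sup>2 \<le> dotp n v (mvec n M v) * dotp n w (mvec n M w)"
proof -
  define a b c where "a = dotp n v (mvec n M v)" and "b = dotp n v (mvec n M w)" and "c = dotp n w (mvec n M w)"
  have q: "0 \<le> a + 2 * b * t + c * t\<^sup>2" for t
  proof -
    have "dotp n w (mvec n M v) = b"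
      unfolding b_def by (subst dotp_mvec_sym[of M, OF sym]) (rule dotp_commute)
    hence "dotp n (\<lambda>i. v i + t * w i) (mvec n M (\<lambda>i. v i + t * w i)) = a + 2 * b * t + c * t\<^sup>2"
      by (simp add: mvec_add mvec_scale dotp_add_left dotp_add_right dotp_scale_left dotp_scale_right
          a_def[symmetric] b_def[symmetric] c_def[symmetric] algebra_simps power2_eq_square)
    thus ?thesis using psd[of "\<lambda>i. v i + t * w i"] by simp
  qed
  have "a \<ge> 0" "c \<ge> 0" using psd by (auto simp: a_def c_def)
  have "b\<^sup>2 \<le> a * c"
  proof (cases "c = 0")
    case True
    have "b = 0"
    proof (rule ccontr)
      assume "b \<noteq> 0"
      hence "2 * b * (- (a + 1) / (2 * b)) = - (a + 1)" by simp
      thus False using q[of "- (a + 1) / (2 * b)"] True by simp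
    qed
    thus ?thesis using True by simp
  next
    case False
    hence c: "c > 0" using \<open>c \<ge> 0\<close> by simp
    have "0 \<le> c * (a + 2 * b * (- b / c) + c * (- b / c)\<^sup>2)" by (intro mult_nonneg_nonneg q) (use c in simp)
    also have "\<dots> = a * c - b\<^sup>2" using c by (simp add: field_simps power2_eq_square)
    finally show ?thesis by simp
  qed
  thus ?thesis by (simp add: a_def b_def c_def)
qed

section \<open>Quadratic identities for the shift matrix\<close>

lemma mvec_idm: "i \<in> {1..n} \<Longrightarrow> mvec n (idm n) v i = v i"
  by (simp add: mvec_def idm_def if_distrib[of "\<lambda>x. x * _"] cong: if_cong)

lemma mvec_Em: "i \<in> {1..n} \<Longrightarrow> mvec n (Em n) v i = real (n - i) * v i"
  by (simp add: mvec_def Em_def if_distrib[of "\<lambda>x. x * _"] cong: if_cong)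

lemma mvec_Amat: "i \<in> {1..n} \<Longrightarrow> mvec n (Amat n) v i = (if i < n then v (i + 1) else 0)"
proof -
  assume i: "i \<in> {1..n}"
  have "mvec n (Amat n) v i = (\<Sum>k=1..n. if k = i + 1 then v k else 0)"
    unfolding mvec_def Amat_def by (intro sum.cong) (use i in auto)
  thus ?thesis by (auto simp: sum.delta)
qed

text \<open>P and the inverse of Q both satisfy A^T M + M A = - M + w w^T, with \<open>w\<close> the
  last column of P in one case and the first unit vector in the other.\<close>

lemma quadratic_Amat:
  assumes M: "is_mat n M" "\<And>i j. M i j = M j i"
    and rec: "\<And>i j. i \<in> {1..n} \<Longrightarrow> j \<in> {1..n} \<Longrightarrow> M (i - 1) j + M i (j - 1) = - M i j + w i * w j"
  shows "2 * dotp n (mvec n M v) (mvec n (Amat n) v) = - dotp n v (mvec n M v) + (dotp n w v)\<^sup>2"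
proof -
  have "mvec n (mmul n (mtr (Amat n)) M) v i + mvec n (mmul n M (Amat n)) v i
      = - mvec n M v i + dotp n w v * w i" if i: "i \<in> {1..n}" for i
  proof -
    have "mvec n (mmul n (mtr (Amat n)) M) v i + mvec n (mmul n M (Amat n)) v i
       = (\<Sum>k=1..n. (M (i - 1) k + M i (k - 1)) * v k)"
      unfolding mvec_def sum.distrib[symmetric]
      by (intro sum.cong refl) (use i in \<open>simp add: mmul_transpose_Amat_left[OF M(1)] mmul_Amat_right[OF M(1)] algebra_simps\<close>)
    also have "\<dots> = (\<Sum>k=1..n. (- M i k + w i * w k) * v k)" using rec[OF i] by simp
    also have "\<dots> = - mvec n M v i + dotp n w v * w i"
      by (simp add: mvec_def dotp_def sum_distrib_left sum_distrib_right algebra_simps sum_subtractf)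
    finally show ?thesis .
  qed
  hence "dotp n v (\<lambda>i. mvec n (mmul n (mtr (Amat n)) M) v i + mvec n (mmul n M (Amat n)) v i)
     = dotp n v (\<lambda>i. - 1 * mvec n M v i + dotp n w v * w i)" by (intro dotp_cong) auto
  moreover have "dotp n v (mvec n (mmul n (mtr (Amat n)) M) v) = dotp n (mvec n M v) (mvec n (Amat n) v)"
    unfolding mvec_mmul dotp_mvec_transpose by (rule dotp_commute)
  moreover have "dotp n v (mvec n (mmul n M (Amat n)) v) = dotp n (mvec n M v) (mvec n (Amat n) v)"
    unfolding mvec_mmul by (rule dotp_mvec_sym[of M, OF M(2)])
  ultimately show ?thesis
    by (simp only: dotp_add_right dotp_scale_right dotp_commute[of n v w]) (simp add: power2_eq_square)
qed

text \<open>The inverse of \<open>Q_n\<close>: Q is P reversed, so its inverse is the reversed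
  inverse of P.\<close>

definition R_expl :: "nat \<Rightarrow> rmat" where
  "R_expl n = flip n (X_expl n 1)"

lemma is_mat_P_expl: "is_mat n (P_expl n \<gamma>)"
  by (auto simp: is_mat_def P_expl_def)

lemma is_mat_X_expl: "is_mat n (X_expl n \<gamma>)"
  by (auto simp: is_mat_def X_expl_def)

lemma R_expl_sym: "R_expl n i j = R_expl n j i"
  unfolding R_expl_def flip_def by (rule X_expl_sym)

lemma quadratic_P_Amat:
  assumes "n \<ge> 1"
  shows "2 * dotp n (mvec n (P_expl n 1) v) (mvec n (Amat n) v)
    = - dotp n v (mvec n (P_expl n 1) v) + (mvec n (P_expl n 1) v n)\<^sup>2"
proof -
  have "2 * dotp n (mvec n (P_expl n 1) v) (mvec n (Amat n) v)
    = - dotp n v (mvec n (P_expl n 1) v) + (dotp n (\<lambda>i. P_expl n 1 i n) v)\<^sup>2"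
  proof (rule quadratic_Amat[OF is_mat_P_expl P_expl_sym])
    fix i j assume "i \<in> {1..n}" "j \<in> {1..n}"
    thus "P_expl n 1 (i - 1) j + P_expl n 1 i (j - 1) = - P_expl n 1 i j + P_expl n 1 i n * P_expl n 1 j n"
      using riccati_P_expl[of 1 n] P_expl_sym[of n 1 n j] by (force simp: riccati_P_def)
  qed
  also have "dotp n (\<lambda>i. P_expl n 1 i n) v = mvec n (P_expl n 1) v n"
    unfolding dotp_def mvec_def by (intro sum.cong refl arg_cong2[of _ _ _ _ "(*)"] P_expl_sym)
  finally show ?thesis .
qed

text \<open>The Riccati equation of Q becomes linear for its inverse, namely A^T R + R A = - R + c^T
  c; this is \<open>X_expl_rec\<close> with reversed indices.\<close>

lemma quadratic_R_Amat:
  assumes "n \<ge> 1"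
  shows "2 * dotp n (mvec n (R_expl n) v) (mvec n (Amat n) v) = - dotp n v (mvec n (R_expl n) v) + (v 1)\<^sup>2"
proof -
  have "2 * dotp n (mvec n (R_expl n) v) (mvec n (Amat n) v)
    = - dotp n v (mvec n (R_expl n) v) + (dotp n (\<lambda>i. if i = 1 then 1 else 0) v)\<^sup>2"
  proof (rule quadratic_Amat[OF _ R_expl_sym])
    show "is_mat n (R_expl n)" unfolding R_expl_def by (intro is_mat_flip is_mat_X_expl)
    fix i j assume ij: "i \<in> {1..n}" "j \<in> {1..n}"
    have e: "n + 1 - (i - 1) = (n + 1 - i) + 1" "n + 1 - (j - 1) = (n + 1 - j) + 1" using ij by auto
    have "n + 1 - i \<in> {1..n}" "n + 1 - j \<in> {1..n}" "(n + 1 - i = n) = (i = 1)" "(n + 1 - j = n) = (j = 1)"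
      using ij by auto
    hence "X_expl n 1 (n + 1 - i + 1) (n + 1 - j) + X_expl n 1 (n + 1 - i) (n + 1 - j + 1)
        + X_expl n 1 (n + 1 - i) (n + 1 - j) = (if i = 1 \<and> j = 1 then 1 else 0)"
      using X_expl_rec[of 1 "n + 1 - i" n "n + 1 - j"] by simp
    moreover have "(if i = 1 \<and> j = 1 then 1 else 0) = (if i = 1 then 1 else 0) * (if j = 1 then 1 else (0::real))"
      by simp
    ultimately show "R_expl n (i - 1) j + R_expl n i (j - 1)
        = - R_expl n i j + (if i = 1 then 1 else 0) * (if j = 1 then 1 else 0)"
      unfolding R_expl_def flip_def e by linarith
  qed
  also have "dotp n (\<lambda>i. if i = 1 then 1 else 0) v = v 1" by (rule dotp_unit) (use assms in simp)
  finally show ?thesis .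
qed

lemma X_P_expl:
  assumes "\<gamma> > 0"
  shows "mmul n (X_expl n \<gamma>) (P_expl n \<gamma>) = idm n"
proof (intro ext)
  fix i j
  show "mmul n (X_expl n \<gamma>) (P_expl n \<gamma>) i j = idm n i j"
  proof (cases "i \<in> {1..n} \<and> j \<in> {1..n}")
    case True
    thus ?thesis using X_expl_left_inverse[OF assms riccati_P_expl[OF assms]] by blast
  next
    case False
    thus ?thesis by (auto simp: mmul_def idm_def X_expl_def P_expl_def)
  qed
qed

lemma P_X_expl:
  assumes "\<gamma> > 0"
  shows "mmul n (P_expl n \<gamma>) (X_expl n \<gamma>) = idm n"
proof (intro ext)
  fix i j
  have "mmul n (P_expl n \<gamma>) (X_expl n \<gamma>) i j = mmul n (X_expl n \<gamma>) (P_expl n \<gamma>) j i"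
    unfolding mmul_def by (intro sum.cong refl) (simp add: P_expl_sym[of n \<gamma> i] X_expl_sym[of n \<gamma> _ j] mult.commute)
  thus "mmul n (P_expl n \<gamma>) (X_expl n \<gamma>) i j = idm n i j"
    unfolding X_P_expl[OF assms] by (auto simp: idm_def)
qed

lemma minv_P_expl:
  assumes "\<gamma> > 0"
  shows "minv n (P_expl n \<gamma>) = X_expl n \<gamma>"
  unfolding minv_def
proof (rule the_equality)
  show "is_mat n (X_expl n \<gamma>) \<and> mmul n (X_expl n \<gamma>) (P_expl n \<gamma>) = idm n"
    using is_mat_X_expl X_P_expl[OF assms] by blast
  fix N assume N: "is_mat n N \<and> mmul n N (P_expl n \<gamma>) = idm n"
  show "N = X_expl n \<gamma>"
  proof (intro ext)
    fix i j
    show "N i j = X_expl n \<gamma> i j"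
    proof (cases "i \<in> {1..n} \<and> j \<in> {1..n}")
      case False
      thus ?thesis using N is_mat_X_expl[of n \<gamma>] by (auto simp: is_mat_def)
    next
      case True
      have "N i j = mmul n N (mmul n (P_expl n \<gamma>) (X_expl n \<gamma>)) i j"
        using True by (simp add: P_X_expl[OF assms] mmul_idm_right)
      also have "\<dots> = X_expl n \<gamma> i j"
        using N True by (simp flip: mmul_assoc add: mmul_idm_left)
      finally show ?thesis .
    qed
  qed
qed

lemma mmul_flip: "mmul n (flip n M) (flip n N) = flip n (mmul n M N)"
  by (intro ext) (simp only: mmul_def flip_def sum_reverse[of "\<lambda>k. M _ k * N k _"])

lemma R_expl_Q:
  assumes "i \<in> {1..n}"
  shows "mvec n (R_expl n) (mvec n (flip n (P_expl n 1)) v) i = v i"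
proof -
  have "mmul n (R_expl n) (flip n (P_expl n 1)) = flip n (idm n)"
    unfolding R_expl_def mmul_flip by (simp add: X_P_expl)
  also have "flip n (idm n) = idm n" by (auto simp: flip_def idm_def fun_eq_iff)
  finally show ?thesis using assms by (simp flip: mvec_mmul add: mvec_idm)
qed

section \<open>Spectral bounds by \<open>delta_c\<close> and \<open>Lam\<close>\<close>

lemma delta_c_bound:
  assumes n: "n \<ge> 1"
  shows "dotp n v (mvec n (P_expl n 1) v) + 2 * dotp n (mvec n (P_expl n 1) v) (mvec n (Em n) v)
    \<le> delta_c n / real n * dotp n v (mvec n (P_expl n 1) v)"
proof -
  let ?P = "P_expl n 1"
  define S where "S = madd (mmul n (Em n) ?P) (mmul n ?P (Em n))"
  have S: "S i j = real (n - i) * ?P i j + ?P i j * real (n - j)" for i j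
  proof -
    have "mmul n (Em n) ?P i j = real (n - i) * ?P i j"
    proof (cases "i \<in> {1..n}")
      case True
      thus ?thesis by (simp add: mmul_def Em_def if_distrib[of "\<lambda>x. x * _"] cong: if_cong)
    qed (auto simp: mmul_def Em_def P_expl_def)
    moreover have "mmul n ?P (Em n) i j = ?P i j * real (n - j)"
    proof (cases "j \<in> {1..n}")
      case True
      have "mmul n ?P (Em n) i j = (\<Sum>k=1..n. if k = j then ?P i j * real (n - j) else 0)"
        unfolding mmul_def Em_def by (intro sum.cong) (use True in auto)
      thus ?thesis using True by (simp add: sum.delta)
    qed (auto simp: mmul_def Em_def P_expl_def)
    ultimately show ?thesis by (simp add: S_def madd_def)
  qed
  have pos: "dotp n v (mvec n ?P v) > 0" if "\<exists>k\<in>{1..n}. v k \<noteq> 0" for v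
    using pos_def_P_expl[of 1 n] that by (auto simp: pos_def_def)
  have Ssym: "S i j = S j i" for i j unfolding S P_expl_sym[of n 1 j i] by (simp only: mult.commute add.commute)
  obtain k w where w: "\<exists>i\<in>{1..n}. w i \<noteq> 0" and ev: "\<And>i. i \<in> {1..n} \<Longrightarrow> mvec n S w i = k * mvec n ?P w i"
    and le: "\<And>w. dotp n w (mvec n S w) \<le> k * dotp n w (mvec n ?P w)"
    by (rule rayleigh_max[of n S ?P, OF n Ssym P_expl_sym pos], assumption) (rule that)
  let ?M = "madd (Em n) (mmul n (mmul n ?P (Em n)) (minv n ?P))"
  \<comment> \<open>If (E P + P E) w = k P w, then P w is an eigenvector of E + P E P^{-1}. So the
    maximum \<open>k\<close> of the quotient is one of the eigenvalues below \<open>lam_max\<close>,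
    and \<open>delta_c n / n\<close> exceeds \<open>lam_max\<close> by 1, which pays for the extra
    copy of P.\<close>
  have "eigenvalue_of n ?M k"
    unfolding eigenvalue_of_def
  proof (intro exI[of _ "mvec n ?P w"] conjI ballI)
    show "\<exists>i\<in>{1..n}. mvec n ?P w i \<noteq> 0"
    proof (rule ccontr)
      assume "\<not> ?thesis"
      hence "dotp n w (mvec n ?P w) = 0" by (simp add: dotp_def)
      thus False using pos[OF w] by simp
    qed
    fix i assume i: "i \<in> {1..n}"
    have "mvec n (X_expl n 1) (mvec n ?P w) j = w j" if "j \<in> {1..n}" for j
      using that by (simp flip: mvec_mmul add: X_P_expl mvec_idm)
    hence "mvec n (mmul n ?P (Em n)) (mvec n (X_expl n 1) (mvec n ?P w)) = mvec n (mmul n ?P (Em n)) w"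
      by (intro mvec_cong) auto
    hence "mvec n ?M (mvec n ?P w) i = mvec n S w i"
      by (simp add: minv_P_expl S_def mvec_madd mvec_mmul)
    thus "mvec n ?M (mvec n ?P w) i = k * mvec n ?P w i" using ev[OF i] by simp
  qed
  hence "k \<le> delta_c n / real n - 1"
    using eigenvalue_le_lam_max n by (simp add: delta_c_def Pm_expl)
  hence "k * dotp n v (mvec n ?P v) \<le> (delta_c n / real n - 1) * dotp n v (mvec n ?P v)"
    using pos[of v] by (cases "\<exists>k\<in>{1..n}. v k \<noteq> 0") (auto intro!: mult_right_mono simp: dotp_def)
  moreover have "dotp n v (mvec n S v) = 2 * dotp n (mvec n ?P v) (mvec n (Em n) v)"
  proof -
    have "mtr (Em n) = Em n" by (auto simp: mtr_def Em_def fun_eq_iff)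
    hence "dotp n v (mvec n (mmul n (Em n) ?P) v) = dotp n (mvec n (Em n) v) (mvec n ?P v)"
      unfolding mvec_mmul using dotp_mvec_transpose[of n v "Em n"] by simp
    moreover have "dotp n v (mvec n (mmul n ?P (Em n)) v) = dotp n (mvec n ?P v) (mvec n (Em n) v)"
      unfolding mvec_mmul by (rule dotp_mvec_sym[OF P_expl_sym])
    ultimately show ?thesis by (simp add: S_def mvec_madd dotp_add_right dotp_commute)
  qed
  ultimately show ?thesis using le[of v] by (simp add: algebra_simps)
qed

lemma Lam_bound:
  assumes n: "n \<ge> 1"
  shows "dotp n v (mvec n (P_expl n 1) v) \<le> Lam n * dotp n v v"
proof -
  have id: "dotp n v (mvec n (idm n) v) = dotp n v v" for v
    by (intro dotp_cong) (auto simp: mvec_idm)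
  have idsym: "idm n i j = idm n j i" for i j by (auto simp: idm_def)
  have pos: "dotp n v (mvec n (idm n) v) > 0" if "\<exists>k\<in>{1..n}. v k \<noteq> 0" for v
    unfolding id using that dotp_self_pos by blast
  obtain k w where w: "\<exists>i\<in>{1..n}. w i \<noteq> 0"
    and ev: "\<And>i. i \<in> {1..n} \<Longrightarrow> mvec n (P_expl n 1) w i = k * mvec n (idm n) w i"
    and le: "\<And>w. dotp n w (mvec n (P_expl n 1) w) \<le> k * dotp n w (mvec n (idm n) w)"
    by (rule rayleigh_max[of n "P_expl n 1" "idm n", OF n P_expl_sym idsym pos], assumption) (rule that)
  have "eigenvalue_of n (P_expl n 1) k" using w ev by (auto simp: eigenvalue_of_def mvec_idm)
  hence "k \<le> Lam n" using eigenvalue_le_lam_max n by (simp add: Lam_def Pm_expl)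
  hence "k * dotp n v v \<le> Lam n * dotp n v v" by (rule mult_right_mono[OF _ dotp_self_nonneg])
  thus ?thesis using le[of v] unfolding id by (rule order_trans[rotated])
qed

lemma sum_sq_alt: "(\<Sum>k<n. (alt u k)\<^sup>2) = (\<Sum>k<n. (u k)\<^sup>2)"
  by (simp add: alt_def power_mult_distrib flip: power_mult)

lemma Lam_pos:
  assumes n: "n \<ge> 1"
  shows "Lam n > 0"
proof -
  define e :: rvec where "e = (\<lambda>i. if i = 1 then 1 else 0)"
  have "dotp n e e = e 1" unfolding e_def by (rule dotp_unit) (use n in simp)
  moreover have "dotp n e (mvec n (P_expl n 1) e) > 0"
    using pos_def_P_expl[of 1 n] n by (auto simp: pos_def_def e_def intro!: bexI[of _ 1])
  ultimately show ?thesis using Lam_bound[OF n, of e] by (simp add: e_def)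
qed

lemma pasc_bound:
  assumes n: "n \<ge> 1"
  shows "(\<Sum>k<n. (pasc n u k)\<^sup>2) \<le> Lam n * (\<Sum>k<n. (u k)\<^sup>2)"
proof -
  define v where "v = (\<lambda>i. u (n - i))"
  have "pasc n (\<lambda>a. v (n - a)) = pasc n u" by (auto simp: pasc_def v_def fun_eq_iff)
  hence "dotp n v (mvec n (P_expl n 1) v) = (\<Sum>k<n. (pasc n u k)\<^sup>2)" by (simp add: quadratic_P_expl)
  moreover have "dotp n v v = (\<Sum>k<n. (u k)\<^sup>2)"
    by (simp only: dotp_def sum_1_to_n_reverse) (simp add: v_def power2_eq_square)
  ultimately show ?thesis using Lam_bound[OF n, of v] by simp
qed

text \<open>A matrix and its transpose have equal norm: if N is the squared norm of C^T u, then N is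
  the inner product of u with C C^T u, so Cauchy-Schwarz and the bound for C give N^2 \<le> |u|^2
  Lam N, and N cancels.\<close>

lemma pasc_tr_bound:
  assumes n: "n \<ge> 1"
  shows "(\<Sum>k<n. (pasc_tr n u k)\<^sup>2) \<le> Lam n * (\<Sum>k<n. (u k)\<^sup>2)"
proof -
  define N where "N = (\<Sum>k<n. (pasc_tr n u k)\<^sup>2)"
  have N0: "N \<ge> 0" by (simp add: N_def sum_nonneg)
  have "N = (\<Sum>k<n. \<Sum>a<n. pasc_tr n u k * (real (a choose k) * u a))"
    by (simp add: N_def power2_eq_square pasc_tr_def[of n u] flip: sum_distrib_left)
  also have "\<dots> = (\<Sum>a<n. u a * pasc n (pasc_tr n u) a)"
    by (subst sum.swap) (simp add: pasc_def sum_distrib_left mult_ac)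
  finally have "N\<^sup>2 \<le> (\<Sum>a<n. (u a)\<^sup>2) * (\<Sum>a<n. (pasc n (pasc_tr n u) a)\<^sup>2)"
    using Cauchy_Schwarz_ineq_sum by metis
  also have "\<dots> \<le> (\<Sum>a<n. (u a)\<^sup>2) * (Lam n * N)"
    unfolding N_def by (intro mult_left_mono pasc_bound[OF n] sum_nonneg) auto
  finally have "N * N \<le> (Lam n * (\<Sum>a<n. (u a)\<^sup>2)) * N" by (simp add: power2_eq_square mult_ac)
  hence "N \<le> Lam n * (\<Sum>a<n. (u a)\<^sup>2)"
    using N0 Lam_pos[OF n] by (cases "N = 0") (auto intro!: mult_nonneg_nonneg sum_nonneg)
  thus ?thesis by (simp add: N_def)
qed

text \<open>The inverse of C is D C D, which has the norm of C because D is an isometry. So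
  \<open>Lam n\<close> bounds the inverse as well.\<close>

lemma pasc_lower_bound:
  assumes n: "n \<ge> 1"
  shows "(\<Sum>k<n. (u k)\<^sup>2) \<le> Lam n * (\<Sum>k<n. (pasc n u k)\<^sup>2)"
proof -
  have "alt (alt u) = u" by (auto simp: alt_def fun_eq_iff simp flip: power_add mult.assoc)
  hence "(\<Sum>k<n. (alt u k)\<^sup>2) = (\<Sum>k<n. (pasc n (alt (pasc n u)) k)\<^sup>2)"
    using pasc_inverse[of _ n "alt u"] by (intro sum.cong) auto
  also have "\<dots> \<le> Lam n * (\<Sum>k<n. (alt (pasc n u) k)\<^sup>2)" by (rule pasc_bound[OF n])
  finally show ?thesis by (simp only: sum_sq_alt)
qed

lemma pasc_tr_lower_bound:
  assumes n: "n \<ge> 1"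
  shows "(\<Sum>k<n. (u k)\<^sup>2) \<le> Lam n * (\<Sum>k<n. (pasc_tr n u k)\<^sup>2)"
proof -
  have "alt (alt u) = u" by (auto simp: alt_def fun_eq_iff simp flip: power_add mult.assoc)
  hence "(\<Sum>k<n. (alt u k)\<^sup>2) = (\<Sum>k<n. (pasc_tr n (alt (pasc_tr n u)) k)\<^sup>2)"
    using pasc_tr_inverse[of _ n "alt u"] by (intro sum.cong) auto
  also have "\<dots> \<le> Lam n * (\<Sum>k<n. (alt (pasc_tr n u) k)\<^sup>2)" by (rule pasc_tr_bound[OF n])
  finally show ?thesis by (simp only: sum_sq_alt)
qed

lemma P_lower_bound:
  assumes n: "n \<ge> 1"
  shows "dotp n v v \<le> Lam n * dotp n v (mvec n (P_expl n 1) v)"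
proof -
  have "dotp n v v = (\<Sum>a<n. (v (n - a))\<^sup>2)"
    by (simp only: dotp_def sum_1_to_n_reverse) (simp add: power2_eq_square)
  thus ?thesis using pasc_lower_bound[OF n, of "\<lambda>a. v (n - a)"] by (simp add: quadratic_P_expl)
qed

text \<open>Vandermonde's identity for the entries of C C^T; it exhibits R as a sum of squares in
  \<open>quadratic_R_expl\<close>.\<close>

lemma choose_diagonal_sum:
  assumes "b < n"
  shows "(\<Sum>k<n. real (a choose k) * real (b choose k)) = real ((a + b) choose a)"
proof -
  have "(\<Sum>k<n. real (a choose k) * real (b choose k)) = (\<Sum>k\<le>b. real (a choose k) * real (b choose (b - k)))"
  proof (intro sum.mono_neutral_cong_right)
    fix k assume "k \<in> {..b}"
    thus "real (a choose k) * real (b choose k) = real (a choose k) * real (b choose (b - k))"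
      using binomial_symmetric[of k b] by simp
  qed (use assms in auto)
  also have "\<dots> = real ((a + b) choose b)" by (simp add: vandermonde[of a b b, symmetric])
  also have "(a + b) choose b = (a + b) choose a" using binomial_symmetric[of a "a + b"] by simp
  finally show ?thesis .
qed

text \<open>Absorption, then Vandermonde, then absorption backwards. The weights
  \<open>Suc k\<close> are positive, so the matrix with entries (a + b + 1) times
  \<open>(a + b) choose a\<close> is positive semidefinite, which is the core of
  \<open>R_Em_bound\<close>.\<close>

lemma choose_weighted_diagonal_sum:
  assumes "b < n"
  shows "(\<Sum>k<n. real (Suc k) * (real (Suc a choose Suc k) * real (Suc b choose Suc k)))
    = real (a + b + 1) * real ((a + b) choose a)"
proof -
  have "(\<Sum>k<n. real (Suc k) * (real (Suc a choose Suc k) * real (Suc b choose Suc k)))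
     = real (Suc a) * (\<Sum>k<n. real (a choose k) * real (Suc b choose Suc k))"
  proof -
    have "real (Suc k) * real (Suc a choose Suc k) = real (Suc a) * real (a choose k)" for k
      unfolding of_nat_mult[symmetric] Suc_times_binomial ..
    hence "real (Suc k) * (real (Suc a choose Suc k) * real (Suc b choose Suc k))
      = real (Suc a) * (real (a choose k) * real (Suc b choose Suc k))" for k
      by (simp only: mult.assoc[symmetric])
    thus ?thesis by (simp only: sum_distrib_left)
  qed
  also have "(\<Sum>k<n. real (a choose k) * real (Suc b choose Suc k)) = (\<Sum>k\<le>b. real (a choose k) * real (Suc b choose (b - k)))"
  proof (intro sum.mono_neutral_cong_right)
    fix k assume "k \<in> {..b}"
    thus "real (a choose k) * real (Suc b choose Suc k) = real (a choose k) * real (Suc b choose (b - k))"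
      using binomial_symmetric[of "Suc k" "Suc b"] by simp
  qed (use assms in \<open>auto simp: binomial_eq_0 simp del: binomial_Suc_Suc\<close>)
  also have "\<dots> = real ((a + Suc b) choose b)" by (simp add: vandermonde[of a "Suc b" b, symmetric] del: binomial_Suc_Suc add_Suc_right)
  also have "(a + Suc b) choose b = Suc (a + b) choose Suc a"
    using binomial_symmetric[of b "a + Suc b"] by simp
  also have "real (Suc a) * real (Suc (a + b) choose Suc a) = real (a + b + 1) * real ((a + b) choose a)"
    unfolding of_nat_mult[symmetric] Suc_times_binomial by simp
  finally show ?thesis .
qed

lemma R_expl_entry:
  assumes "a < n" "b < n"
  shows "R_expl n (Suc a) (Suc b) = (-1) ^ (a + b) * real ((a + b) choose a)"
proof -
  have "n - (n - a) = a" "n - (n - b) = b" using assms by auto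
  thus ?thesis using assms by (simp add: R_expl_def flip_def X_expl_def Suc_le_eq)
qed

lemma quadratic_R_expl:
  "dotp n v (mvec n (R_expl n) v) = (\<Sum>k<n. (pasc_tr n (alt (\<lambda>a. v (Suc a))) k)\<^sup>2)"
proof -
  have "dotp n v (mvec n (R_expl n) v) = (\<Sum>a<n. \<Sum>b<n. v (Suc a) * (R_expl n (Suc a) (Suc b) * v (Suc b)))"
    unfolding dotp_def mvec_def sum_distrib_left sum_1_to_n_shift ..
  also have "\<dots> = (\<Sum>a<n. \<Sum>b<n. \<Sum>k<n. (real (a choose k) * alt (\<lambda>a. v (Suc a)) a) * (real (b choose k) * alt (\<lambda>a. v (Suc a)) b))"
  proof (intro sum.cong refl)
    fix a b assume "a \<in> {..<n}" "b \<in> {..<n}"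
    thus "v (Suc a) * (R_expl n (Suc a) (Suc b) * v (Suc b))
       = (\<Sum>k<n. (real (a choose k) * alt (\<lambda>a. v (Suc a)) a) * (real (b choose k) * alt (\<lambda>a. v (Suc a)) b))"
      by (simp add: R_expl_entry choose_diagonal_sum[of b n a, symmetric] alt_def sum_distrib_left
          sum_distrib_right power_add algebra_simps)
  qed
  also have "\<dots> = (\<Sum>k<n. \<Sum>a<n. \<Sum>b<n. (real (a choose k) * alt (\<lambda>a. v (Suc a)) a) * (real (b choose k) * alt (\<lambda>a. v (Suc a)) b))"
    by (subst sum.swap[of _ "{..<n}" "{..<n}"], subst (2) sum.swap) (rule refl)
  also have "\<dots> = (\<Sum>k<n. (pasc_tr n (alt (\<lambda>a. v (Suc a))) k)\<^sup>2)"
    by (simp only: pasc_tr_def power2_eq_square sum_product)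
  finally show ?thesis .
qed

lemma R_nonneg: "0 \<le> dotp n v (mvec n (R_expl n) v)"
  by (simp add: quadratic_R_expl sum_nonneg)

lemma dotp_shift: "dotp n v v = (\<Sum>a<n. (v (Suc a))\<^sup>2)"
  by (simp only: dotp_def sum_1_to_n_shift power2_eq_square)

lemma R_upper_bound: "n \<ge> 1 \<Longrightarrow> dotp n v (mvec n (R_expl n) v) \<le> Lam n * dotp n v v"
  using pasc_tr_bound[of n "alt (\<lambda>a. v (Suc a))"] by (simp add: quadratic_R_expl sum_sq_alt dotp_shift)

lemma R_lower_bound: "n \<ge> 1 \<Longrightarrow> dotp n v v \<le> Lam n * dotp n v (mvec n (R_expl n) v)"
  using pasc_tr_lower_bound[of n "alt (\<lambda>a. v (Suc a))"] by (simp add: quadratic_R_expl sum_sq_alt dotp_shift)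

text \<open>In the difference of the two sides, each entry of R is multiplied by 2n - 1 - (n - 1 -
  a) - (n - 1 - b) = a + b + 1, so \<open>choose_weighted_diagonal_sum\<close> makes it a sum of
  squares. On the observer side the explicit 2n has the part that \<open>delta_c n / n\<close> has
  for P.\<close>

lemma R_Em_bound:
  "dotp n v (mvec n (R_expl n) v) + 2 * dotp n (mvec n (R_expl n) v) (mvec n (Em n) v)
    \<le> 2 * real n * dotp n v (mvec n (R_expl n) v)"
proof -
  let ?R = "R_expl n"
  define u where "u = alt (\<lambda>a. v (Suc a))"
  have E: "dotp n (mvec n ?R v) (mvec n (Em n) v) = (\<Sum>a<n. \<Sum>b<n. real (n - Suc a) * (v (Suc a) * (?R (Suc a) (Suc b) * v (Suc b))))"
  proof -
    have "dotp n (mvec n ?R v) (mvec n (Em n) v) = dotp n (mvec n ?R v) (\<lambda>i. real (n - i) * v i)"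
      by (intro dotp_cong) (auto simp: mvec_Em)
    thus ?thesis
      by (simp only: dotp_def mvec_def sum_1_to_n_shift sum_distrib_left sum_distrib_right mult_ac)
  qed
  \<comment> \<open>The same number with E on the other index; using each version once makes the
    coefficients symmetric.\<close>
  have E': "dotp n (mvec n ?R v) (mvec n (Em n) v) = (\<Sum>a<n. \<Sum>b<n. real (n - Suc b) * (v (Suc a) * (?R (Suc a) (Suc b) * v (Suc b))))"
    unfolding E by (subst sum.swap) (intro sum.cong refl, simp add: R_expl_sym[of n "Suc _" "Suc _"] mult_ac)
  have V: "dotp n v (mvec n ?R v) = (\<Sum>a<n. \<Sum>b<n. v (Suc a) * (?R (Suc a) (Suc b) * v (Suc b)))"
    unfolding dotp_def mvec_def sum_distrib_left sum_1_to_n_shift ..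
  have "2 * real n * dotp n v (mvec n ?R v) - dotp n v (mvec n ?R v) - 2 * dotp n (mvec n ?R v) (mvec n (Em n) v)
     = 2 * real n * dotp n v (mvec n ?R v) - dotp n v (mvec n ?R v) - dotp n (mvec n ?R v) (mvec n (Em n) v)
       - dotp n (mvec n ?R v) (mvec n (Em n) v)" by simp
  also have "\<dots> = (\<Sum>a<n. \<Sum>b<n. (2 * real n - 1 - real (n - Suc a) - real (n - Suc b)) * (v (Suc a) * (?R (Suc a) (Suc b) * v (Suc b))))"
    unfolding V
    by (subst (1) E, subst (1) E') (simp add: sum_distrib_left sum_subtractf sum.distrib left_diff_distrib algebra_simps)
  also have "\<dots> = (\<Sum>a<n. \<Sum>b<n. \<Sum>k<n. real (Suc k) * ((real (Suc a choose Suc k) * u a) * (real (Suc b choose Suc k) * u b)))"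
  proof (intro sum.cong refl)
    fix a b assume ab: "a \<in> {..<n}" "b \<in> {..<n}"
    have "(2 * real n - 1 - real (n - Suc a) - real (n - Suc b)) * (v (Suc a) * (?R (Suc a) (Suc b) * v (Suc b)))
      = (real (a + b + 1) * real ((a + b) choose a)) * (u a * u b)"
      using ab by (simp add: R_expl_entry u_def alt_def of_nat_diff power_add algebra_simps)
    also have "\<dots> = (\<Sum>k<n. real (Suc k) * ((real (Suc a choose Suc k) * u a) * (real (Suc b choose Suc k) * u b)))"
      using ab by (subst choose_weighted_diagonal_sum[of b n, symmetric]) (simp_all only: sum_distrib_right sum_distrib_left mult_ac lessThan_iff)
    finally show "(2 * real n - 1 - real (n - Suc a) - real (n - Suc b)) * (v (Suc a) * (?R (Suc a) (Suc b) * v (Suc b)))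
      = (\<Sum>k<n. real (Suc k) * ((real (Suc a choose Suc k) * u a) * (real (Suc b choose Suc k) * u b)))" .
  qed
  also have "\<dots> = (\<Sum>k<n. \<Sum>a<n. \<Sum>b<n. real (Suc k) * ((real (Suc a choose Suc k) * u a) * (real (Suc b choose Suc k) * u b)))"
    by (subst sum.swap[of _ "{..<n}" "{..<n}"], subst (2) sum.swap) (rule refl)
  also have "\<dots> = (\<Sum>k<n. real (Suc k) * (\<Sum>a<n. real (Suc a choose Suc k) * u a)\<^sup>2)"
    by (simp only: power2_eq_square sum_product) (simp only: sum_distrib_left)
  also have "\<dots> \<ge> 0" by (intro sum_nonneg mult_nonneg_nonneg) auto
  finally show ?thesis by simp
qed

section \<open>The Lyapunov inequality\<close>

lemma cQPQc_eq:
  assumes "n \<ge> 1"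
  shows "cQPQc n = dotp n (mvec n (Qm n 1) (cvec n)) (mvec n (Pm n 1) (mvec n (Qm n 1) (cvec n)))"
proof -
  have "Qm n 1 i j = Qm n 1 j i" for i j
    using assms by (simp add: Qm_expl flip_def P_expl_sym)
  thus ?thesis unfolding cQPQc_def by (rule dotp_mvec_sym)
qed

lemma Pm_nonneg: "n \<ge> 1 \<Longrightarrow> 0 \<le> dotp n v (mvec n (Pm n 1) v)"
  by (simp add: Pm_expl quadratic_P_expl sum_nonneg)

lemma cQPQc_pos:
  assumes n: "n \<ge> 1"
  shows "cQPQc n > 0"
proof -
  let ?g = "mvec n (Qm n 1) (cvec n)"
  have "\<exists>k\<in>{1..n}. ?g k \<noteq> 0"
  proof (rule ccontr)
    assume "\<not> ?thesis"
    hence "mvec n (R_expl n) ?g 1 = 0" by (simp add: mvec_def)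
    moreover have "mvec n (R_expl n) ?g 1 = cvec n 1" using n by (simp add: Qm_expl R_expl_Q)
    ultimately show False by (simp add: cvec_def)
  qed
  thus ?thesis unfolding cQPQc_eq[OF n] using pos_def_P_expl[of 1 n] n by (simp add: Pm_expl pos_def_def)
qed

text \<open>R inverts Q, so R Q c^T = c^T. Measured in R, the injection along Q c^T acts through the
  first error component alone and contributes a pure square.\<close>

lemma dotp_R_Qc:
  assumes n: "n \<ge> 1"
  shows "dotp n (mvec n (R_expl n) v) (mvec n (Qm n 1) (cvec n)) = v 1"
proof -
  have "dotp n (mvec n (R_expl n) v) (mvec n (Qm n 1) (cvec n)) = dotp n v (mvec n (R_expl n) (mvec n (Qm n 1) (cvec n)))"
    by (rule dotp_mvec_sym[OF R_expl_sym, symmetric])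
  also have "\<dots> = dotp n v (\<lambda>i. if i = 1 then 1 else 0)"
    using n by (intro dotp_cong) (simp_all add: Qm_expl R_expl_Q cvec_def)
  also have "\<dots> = dotp n (\<lambda>i. if i = 1 then 1 else 0) v" by (rule dotp_commute)
  also have "\<dots> = v 1" by (rule dotp_unit) (use n in simp)
  finally show ?thesis .
qed

lemma dotp_add_sq_le:
  "dotp n (\<lambda>i. v i + w i) (\<lambda>i. v i + w i) \<le> 2 * (dotp n v v + dotp n w w)"
proof -
  have "(\<Sum>i=1..n. (v i + w i) * (v i + w i)) \<le> (\<Sum>i=1..n. 2 * (v i * v i + w i * w i))"
    by (intro sum_mono) (use sum_squares_bound in \<open>fastforce simp: algebra_simps power2_eq_square\<close>)
  thus ?thesis by (simp add: dotp_def sum.distrib sum_distrib_left)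
qed

text \<open>With v and w the forms of \<eta> and \<epsilon>, Cauchy-Schwarz in R, R \<le> Lam, the
  assumption on \<open>x\<close> and the lower bounds of both forms give 2 (Lam d)^2 w (v + w), and
  w (v + w) \<le> (w + v/2)^2. The nonlinearity uses it with \<open>d\<close>, the perturbation A
  \<zeta> with 1.\<close>

lemma R_cross_bound:
  assumes n: "n \<ge> 1" and d: "d \<ge> 0"
    and x: "dotp n x x \<le> d\<^sup>2 * dotp n (\<lambda>i. \<eta> i + \<epsilon> i) (\<lambda>i. \<eta> i + \<epsilon> i)"
  shows "\<bar>dotp n (mvec n (R_expl n) \<epsilon>) x\<bar> \<le> sqrt 2 * Lam n * d *
    (dotp n \<epsilon> (mvec n (R_expl n) \<epsilon>) + dotp n \<eta> (mvec n (Pm n 1) \<eta>) / 2)"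
proof -
  define v w where "v = dotp n \<eta> (mvec n (Pm n 1) \<eta>)" and "w = dotp n \<epsilon> (mvec n (R_expl n) \<epsilon>)"
  have v: "v \<ge> 0" and w: "w \<ge> 0" using Pm_nonneg[OF n] R_nonneg by (auto simp: v_def w_def)
  note L = Lam_pos[OF n]
  have "dotp n \<eta> \<eta> \<le> Lam n * v" "dotp n \<epsilon> \<epsilon> \<le> Lam n * w"
    using P_lower_bound[OF n, of \<eta>] R_lower_bound[OF n, of \<epsilon>] n by (auto simp: v_def w_def Pm_expl)
  hence z: "dotp n (\<lambda>i. \<eta> i + \<epsilon> i) (\<lambda>i. \<eta> i + \<epsilon> i) \<le> 2 * (Lam n * v + Lam n * w)"
    by (intro order_trans[OF dotp_add_sq_le] mult_left_mono add_mono) auto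
  have "(dotp n (mvec n (R_expl n) \<epsilon>) x)\<^sup>2 = (dotp n \<epsilon> (mvec n (R_expl n) x))\<^sup>2"
    by (simp add: dotp_mvec_sym[of "R_expl n" n \<epsilon> x, OF R_expl_sym])
  also have "\<dots> \<le> w * dotp n x (mvec n (R_expl n) x)"
    unfolding w_def by (rule psd_cauchy_schwarz[OF R_expl_sym R_nonneg])
  also have "\<dots> \<le> w * (Lam n * (d\<^sup>2 * (2 * (Lam n * v + Lam n * w))))"
    using R_upper_bound[OF n, of x] x z L w
    by (intro mult_left_mono order_trans[OF R_upper_bound[OF n, of x]] order_trans[OF x] z) auto
  also have "\<dots> = 2 * (Lam n * d)\<^sup>2 * (w * (v + w))" by (simp add: algebra_simps power2_eq_square)
  also have "\<dots> \<le> 2 * (Lam n * d)\<^sup>2 * (w + v / 2)\<^sup>2"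
  proof (rule mult_left_mono)
    show "w * (v + w) \<le> (w + v / 2)\<^sup>2" by (simp add: algebra_simps power2_eq_square)
  qed simp
  also have "\<dots> = (sqrt 2 * Lam n * d * (w + v / 2))\<^sup>2" by (simp add: power_mult_distrib)
  finally have "\<bar>dotp n (mvec n (R_expl n) \<epsilon>) x\<bar> \<le> \<bar>sqrt 2 * Lam n * d * (w + v / 2)\<bar>"
    by (simp only: abs_le_square_iff)
  moreover have "sqrt 2 * Lam n * d * (w + v / 2) \<ge> 0" using v w L d by simp
  ultimately show ?thesis by (simp add: v_def w_def)
qed

lemma dotp_Amat_le: "dotp n (mvec n (Amat n) v) (mvec n (Amat n) v) \<le> dotp n v v"
proof -
  have "dotp n (mvec n (Amat n) v) (mvec n (Amat n) v) = dotp n (\<lambda>i. if i < n then v (i + 1) else 0) (\<lambda>i. if i < n then v (i + 1) else 0)"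
    by (intro dotp_cong mvec_Amat)
  also have "\<dots> = (\<Sum>i\<in>{1..<n}. v (i + 1) * v (i + 1))"
    unfolding dotp_def by (intro sum.mono_neutral_cong_right) auto
  also have "\<dots> = (\<Sum>i\<in>{2..n}. v i * v i)"
    by (rule sum.reindex_bij_witness[of _ "\<lambda>i. i - 1" "\<lambda>i. i + 1"]) auto
  also have "\<dots> \<le> dotp n v v" unfolding dotp_def by (intro sum_mono2) auto
  finally show ?thesis .
qed

text \<open>The \<open>Z\<close> in front of the derivative terms is the copy of the forms that
  \<open>delta_c_bound\<close> and \<open>R_Em_bound\<close> have on their left sides.
  \<open>\<beta>1\<close> controls the coefficient of the P-form, \<open>\<beta>2\<close> that of
  the R-form, and \<open>\<delta>\<close> remains as a perturbation.\<close>

lemma lyapunov_decay: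
  fixes n :: nat and \<eta> \<epsilon> \<Psi> \<eta>' \<epsilon>' :: rvec and \<beta> \<delta> d :: real
  defines "P \<equiv> Pm n 1" and "R \<equiv> R_expl n" and "g \<equiv> mvec n (Qm n 1) (cvec n)"
    and "\<zeta> \<equiv> (\<lambda>i. \<eta> i + \<epsilon> i)"
  defines "Z \<equiv> dotp n \<eta> (mvec n P \<eta>) + 2 * cQPQc n * dotp n \<epsilon> (mvec n R \<epsilon>)"
  assumes n: "n \<ge> 1" and d: "d \<ge> 0" and \<Psi>: "dotp n \<Psi> \<Psi> \<le> d\<^sup>2 * dotp n \<zeta> \<zeta>"
    and \<beta>1: "\<beta> \<ge> 8 * sqrt 2 * real n * d * Lam n * cQPQc n + 2 * (2 + delta_c n / real n)"
    and \<beta>2: "\<beta> \<ge> 4 * sqrt 2 * d * Lam n + 2 * (2 * real n + 2 - 1 / real n)"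
    and \<eta>': "\<And>i. i \<in> {1..n} \<Longrightarrow> \<eta>' i = mvec n (Em n) \<eta> i + \<beta> * mvec n (Amat n) \<eta> i
        - \<beta> * mvec n P \<eta> n * bvec n i + \<beta> * \<epsilon> 1 * g i"
    and \<epsilon>': "\<And>i. i \<in> {1..n} \<Longrightarrow> \<epsilon>' i = mvec n (Em n) \<epsilon> i + \<beta> * mvec n (Amat n) \<epsilon> i
        - \<beta> * \<epsilon> 1 * g i + \<Psi> i + \<delta> * mvec n (Amat n) \<zeta> i"
  shows "Z + 2 * dotp n (mvec n P \<eta>) \<eta>' + 2 * cQPQc n * (2 * dotp n (mvec n R \<epsilon>) \<epsilon>')
    \<le> (- 2 + 2 * sqrt 2 * Lam n * (1 + cQPQc n) * \<bar>\<delta>\<bar>) * Z"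
proof -
  define v w q L where "v = dotp n \<eta> (mvec n P \<eta>)" and "w = dotp n \<epsilon> (mvec n R \<epsilon>)"
    and "q = cQPQc n" and "L = Lam n"
  define h p where "h = dotp n (mvec n P \<eta>) g" and "p = mvec n P \<eta> n"
  have q: "q > 0" and L: "L > 0" unfolding q_def L_def using cQPQc_pos[OF n] Lam_pos[OF n] by auto
  have v: "v \<ge> 0" and w: "w \<ge> 0" using Pm_nonneg[OF n] R_nonneg by (auto simp: v_def w_def P_def R_def)
  have n1: "1 / real n \<le> 1" using n by simp
  have s0: "sqrt 2 * L * d \<ge> 0" using L d by simp
  have \<beta>2': "\<beta> \<ge> 4 * (sqrt 2 * L * d) + 4 * real n + 4 - 2 * (1 / real n)"
    using \<beta>2 by (simp add: L_def mult_ac)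
  hence \<beta>0: "\<beta> \<ge> 0" using s0 n1 by linarith
  have Psym: "P i j = P j i" for i j using n by (simp add: P_def Pm_expl P_expl_sym)
  have Pb: "dotp n (mvec n P \<eta>) (bvec n) = p"
  proof -
    have "dotp n (\<lambda>i. if i = n then 1 else 0) (mvec n P \<eta>) = p"
      unfolding p_def by (rule dotp_unit) (use n in simp)
    thus ?thesis unfolding bvec_def by (subst dotp_commute)
  qed
  have "dotp n (mvec n P \<eta>) \<eta>' = dotp n (mvec n P \<eta>) (\<lambda>i. mvec n (Em n) \<eta> i + \<beta> * mvec n (Amat n) \<eta> i
        + (- \<beta> * p) * bvec n i + (\<beta> * \<epsilon> 1) * g i)"
    by (intro dotp_cong refl) (simp add: \<eta>' p_def)
  also have "\<dots> = dotp n (mvec n P \<eta>) (mvec n (Em n) \<eta>) + \<beta> * dotp n (mvec n P \<eta>) (mvec n (Amat n) \<eta>)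
     - \<beta> * p\<^sup>2 + \<beta> * \<epsilon> 1 * h"
    unfolding dotp_add_right dotp_scale_right Pb h_def by (simp add: power2_eq_square)
  finally have 1: "2 * dotp n (mvec n P \<eta>) \<eta>' = 2 * dotp n (mvec n P \<eta>) (mvec n (Em n) \<eta>)
     + \<beta> * (2 * dotp n (mvec n P \<eta>) (mvec n (Amat n) \<eta>)) - 2 * (\<beta> * p\<^sup>2) + \<beta> * (2 * \<epsilon> 1 * h)"
    by (simp add: algebra_simps)
  have 2: "2 * dotp n (mvec n P \<eta>) (mvec n (Amat n) \<eta>) = - v + p\<^sup>2"
    using quadratic_P_Amat[OF n, of \<eta>] n by (simp add: P_def Pm_expl v_def p_def)
  have 3: "v + 2 * dotp n (mvec n P \<eta>) (mvec n (Em n) \<eta>) \<le> delta_c n / real n * v"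
    using delta_c_bound[OF n, of \<eta>] n by (simp add: P_def Pm_expl v_def)
  have h2: "h\<^sup>2 \<le> v * q"
  proof -
    have "h = dotp n \<eta> (mvec n P g)" unfolding h_def by (rule dotp_mvec_sym[OF Psym, symmetric])
    moreover have "(dotp n \<eta> (mvec n P g))\<^sup>2 \<le> v * q"
      unfolding v_def q_def cQPQc_eq[OF n] g_def[symmetric] P_def[symmetric]
      by (rule psd_cauchy_schwarz[OF Psym]) (use Pm_nonneg[OF n] in \<open>simp add: P_def\<close>)
    ultimately show ?thesis by simp
  qed
  \<comment> \<open>Young's inequality with parameter \<open>2 * q\<close>: by \<open>h2\<close> the
    first part costs only half of the decay of \<open>v\<close>, and the second is cancelled by
    \<open>2 * q\<close> times the injection term in \<open>B\<close>.\<close>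
  have "2 * \<epsilon> 1 * h \<le> h\<^sup>2 / (2 * q) + 2 * q * (\<epsilon> 1)\<^sup>2"
  proof -
    have "0 \<le> (h - 2 * q * \<epsilon> 1)\<^sup>2 / (2 * q)" using q by simp
    also have "\<dots> = h\<^sup>2 / (2 * q) + 2 * q * (\<epsilon> 1)\<^sup>2 - 2 * \<epsilon> 1 * h"
      using q by (simp add: field_simps power2_eq_square)
    finally show ?thesis by simp
  qed
  also have "h\<^sup>2 / (2 * q) \<le> v / 2" using h2 q by (simp add: field_simps)
  finally have "\<beta> * (2 * \<epsilon> 1 * h) \<le> \<beta> * (v / 2 + 2 * q * (\<epsilon> 1)\<^sup>2)"
    by (intro mult_left_mono) (use \<beta>0 in auto)
  moreover have "\<beta> * p\<^sup>2 \<ge> 0" using \<beta>0 by simp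
  ultimately have A: "v + 2 * dotp n (mvec n P \<eta>) \<eta>' \<le> (delta_c n / real n - \<beta> / 2) * v + 2 * q * (\<beta> * (\<epsilon> 1)\<^sup>2)"
    using 3 unfolding 1 2 by (simp add: algebra_simps)
  define X1 X2 where "X1 = dotp n (mvec n R \<epsilon>) \<Psi>" and "X2 = dotp n (mvec n R \<epsilon>) (mvec n (Amat n) \<zeta>)"
  have "dotp n (mvec n R \<epsilon>) \<epsilon>' = dotp n (mvec n R \<epsilon>) (\<lambda>i. mvec n (Em n) \<epsilon> i + \<beta> * mvec n (Amat n) \<epsilon> i
        + (- \<beta> * \<epsilon> 1) * g i + \<Psi> i + \<delta> * mvec n (Amat n) \<zeta> i)"
    by (intro dotp_cong refl) (simp add: \<epsilon>')
  also have "\<dots> = dotp n (mvec n R \<epsilon>) (mvec n (Em n) \<epsilon>) + \<beta> * dotp n (mvec n R \<epsilon>) (mvec n (Amat n) \<epsilon>)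
     - \<beta> * (\<epsilon> 1)\<^sup>2 + X1 + \<delta> * X2"
    unfolding dotp_add_right dotp_scale_right X1_def X2_def
    using dotp_R_Qc[OF n, of \<epsilon>] by (simp add: power2_eq_square R_def g_def)
  finally have 4: "2 * dotp n (mvec n R \<epsilon>) \<epsilon>' = 2 * dotp n (mvec n R \<epsilon>) (mvec n (Em n) \<epsilon>)
     + \<beta> * (2 * dotp n (mvec n R \<epsilon>) (mvec n (Amat n) \<epsilon>)) - 2 * (\<beta> * (\<epsilon> 1)\<^sup>2) + 2 * X1 + 2 * (\<delta> * X2)"
    by (simp add: algebra_simps)
  have 5: "2 * dotp n (mvec n R \<epsilon>) (mvec n (Amat n) \<epsilon>) = - w + (\<epsilon> 1)\<^sup>2"
    using quadratic_R_Amat[OF n, of \<epsilon>] by (simp add: R_def w_def)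
  have 6: "w + 2 * dotp n (mvec n R \<epsilon>) (mvec n (Em n) \<epsilon>) \<le> 2 * real n * w"
    using R_Em_bound[of n \<epsilon>] by (simp add: R_def w_def)
  define m where "m = w + v / 2"
  have m: "m \<ge> 0" using v w by (simp add: m_def)
  have X1: "X1 \<le> sqrt 2 * L * d * m"
    using R_cross_bound[OF n d \<Psi>[unfolded \<zeta>_def]]
    unfolding X1_def R_def L_def m_def w_def v_def P_def by linarith
  have "\<bar>X2\<bar> \<le> sqrt 2 * L * 1 * m"
    unfolding X2_def R_def L_def m_def w_def v_def P_def \<zeta>_def
    by (rule R_cross_bound[OF n]) (use dotp_Amat_le[of n "\<lambda>i. \<eta> i + \<epsilon> i"] in auto)
  hence "\<bar>\<delta>\<bar> * \<bar>X2\<bar> \<le> \<bar>\<delta>\<bar> * (sqrt 2 * L * m)" by (intro mult_left_mono) auto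
  hence X2: "\<delta> * X2 \<le> \<bar>\<delta>\<bar> * (sqrt 2 * L * m)"
    using abs_ge_self[of "\<delta> * X2"] by (simp add: abs_mult)
  have B: "w + 2 * dotp n (mvec n R \<epsilon>) \<epsilon>'
      \<le> (2 * real n - \<beta>) * w - \<beta> * (\<epsilon> 1)\<^sup>2 + 2 * (sqrt 2 * L * d * m) + 2 * (\<bar>\<delta>\<bar> * (sqrt 2 * L * m))"
    using 6 X1 X2 unfolding 4 5 by (simp add: algebra_simps)
  define s where "s = sqrt 2 * L * d"
  have s: "s \<ge> 0" using s0 by (simp add: s_def)
  \<comment> \<open>Half of the bound \<open>\<beta>1\<close> contains \<open>delta_c n / n\<close>,
    which cancels, the margin 2, and \<open>4 n q s\<close> against the \<open>2 q s\<close> that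
    the nonlinearity adds to the coefficient of \<open>v\<close>.\<close>
  have cv: "delta_c n / real n - \<beta> / 2 + 2 * q * s \<le> - 2"
  proof -
    have "q * s \<le> real n * (q * s)" using mult_right_mono[of 1 "real n" "q * s"] n q s by simp
    moreover have "\<beta> / 2 \<ge> 4 * (real n * (q * s)) + 2 + delta_c n / real n"
      using \<beta>1 by (simp add: s_def L_def q_def mult_ac)
    moreover have "0 \<le> q * s" using q s by simp
    ultimately show ?thesis by linarith
  qed
  have cw: "2 * real n - \<beta> + 2 * s \<le> - 2"
  proof -
    have "\<beta> \<ge> 4 * s + 4 * real n + 4 - 2 * (1 / real n)" using \<beta>2' by (simp add: s_def)
    thus ?thesis using s n1 by linarith
  qed
  define Y where "Y = v + 2 * q * w"
  have "2 * q * (w + 2 * dotp n (mvec n R \<epsilon>) \<epsilon>')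
     \<le> 2 * q * ((2 * real n - \<beta>) * w - \<beta> * (\<epsilon> 1)\<^sup>2 + 2 * (sqrt 2 * L * d * m) + 2 * (\<bar>\<delta>\<bar> * (sqrt 2 * L * m)))"
    by (intro mult_left_mono[OF B]) (use q in auto)
  hence "Y + 2 * dotp n (mvec n P \<eta>) \<eta>' + 2 * q * (2 * dotp n (mvec n R \<epsilon>) \<epsilon>')
     \<le> (delta_c n / real n - \<beta> / 2) * v + 2 * q * (\<beta> * (\<epsilon> 1)\<^sup>2)
      + 2 * q * ((2 * real n - \<beta>) * w - \<beta> * (\<epsilon> 1)\<^sup>2 + 2 * (sqrt 2 * L * d * m) + 2 * (\<bar>\<delta>\<bar> * (sqrt 2 * L * m)))"
    using A by (simp add: Y_def algebra_simps)
  also have "\<dots> = (delta_c n / real n - \<beta> / 2 + 2 * q * s) * v + (2 * real n - \<beta> + 2 * s) * (2 * q * w)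
      + sqrt 2 * L * \<bar>\<delta>\<bar> * (2 * q * v + 2 * (2 * q * w))"
    by (simp add: s_def m_def algebra_simps)
  \<comment> \<open>The factor \<open>1 + q\<close> majorises both weights at once: \<open>q\<close>
    on \<open>v\<close> and 1 on \<open>2 * q * w\<close>.\<close>
  also have "\<dots> \<le> - 2 * v + - 2 * (2 * q * w) + sqrt 2 * L * \<bar>\<delta>\<bar> * (2 * (1 + q) * Y)"
  proof (intro add_mono mult_right_mono cv cw v mult_left_mono)
    have "q * v \<le> (1 + q) * v" "2 * q * w \<le> (1 + q) * (2 * q * w)"
      using q v w by (simp_all add: algebra_simps)
    thus "2 * q * v + 2 * (2 * q * w) \<le> 2 * (1 + q) * Y" by (simp add: Y_def algebra_simps)
  qed (use q w L in auto)
  also have "\<dots> = (- 2 + 2 * sqrt 2 * L * (1 + q) * \<bar>\<delta>\<bar>) * Y" by (simp add: Y_def algebra_simps)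
  finally show ?thesis unfolding Y_def Z_def v_def w_def q_def L_def .
qed

section \<open>Size of the scaled nonlinearity\<close>

lemma sum_triangle_swap:
  "(\<Sum>i=1..n. \<Sum>j=1..i. f i j) = (\<Sum>j=1..n. \<Sum>i=j..n. f i j)" for f :: "nat \<Rightarrow> nat \<Rightarrow> real"
proof -
  have "(\<Sum>i=1..n. \<Sum>j=1..i. f i j) = (\<Sum>i=1..n. \<Sum>j=1..n. if j \<le> i then f i j else 0)"
    by (intro sum.cong refl sum.mono_neutral_cong_left) auto
  also have "\<dots> = (\<Sum>j=1..n. \<Sum>i=1..n. if j \<le> i then f i j else 0)" by (rule sum.swap)
  also have "\<dots> = (\<Sum>j=1..n. \<Sum>i=j..n. f i j)"
    by (intro sum.cong refl sum.mono_neutral_cong_right) auto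
  finally show ?thesis .
qed

text \<open>Cauchy-Schwarz on row \<open>i\<close> has \<open>i\<close> summands, whence the factor
  \<open>real i\<close> in \<open>dcoef\<close>. Exchanging the sums collects each column into one
  coefficient, and the maximum over the columns comes out. The squares of \<open>T ^ (i - j)\<close>
  are the negative powers of \<gamma>_0.\<close>

lemma dcoef_bound:
  assumes n: "n \<ge> 1" and T: "T > 0"
    and c: "\<And>i j. i \<in> {1..n} \<Longrightarrow> j \<in> {1..i} \<Longrightarrow> c i j \<ge> 0"
    and \<Psi>: "\<And>i. i \<in> {1..n} \<Longrightarrow> \<bar>\<Psi> i\<bar> \<le> (\<Sum>j=1..i. gcoef n c T i j * T ^ (i - j) * \<bar>\<zeta> j\<bar>)"
  shows "dotp n \<Psi> \<Psi> \<le> (dcoef n c T)\<^sup>2 * dotp n \<zeta> \<zeta>" and "dcoef n c T \<ge> 0"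
proof -
  define S where "S = (\<lambda>j. \<Sum>i=j..n. (gcoef n c T i j)\<^sup>2 * real i * inverse ((1/T) ^ (2 * (i - j))))"
  have S0: "S j \<ge> 0" for j using T by (auto simp: S_def intro!: sum_nonneg mult_nonneg_nonneg)
  have SM: "S j \<le> Max (S ` {1..n})" if "j \<in> {1..n}" for j using that by (intro Max_ge) auto
  have "1 \<in> {1..n}" using n by simp
  from order_trans[OF S0 SM[OF this]] have M0: "Max (S ` {1..n}) \<ge> 0" .
  have d: "dcoef n c T = sqrt (Max (S ` {1..n}))" by (simp add: dcoef_def S_def)
  show "dcoef n c T \<ge> 0" unfolding d using M0 by simp
  have pt: "(\<Psi> i)\<^sup>2 \<le> (\<Sum>j=1..i. (gcoef n c T i j)\<^sup>2 * real i * inverse ((1/T) ^ (2 * (i - j))) * (\<zeta> j)\<^sup>2)"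
    if i: "i \<in> {1..n}" for i
  proof -
    have "(\<Psi> i)\<^sup>2 \<le> (\<Sum>j=1..i. 1 * (gcoef n c T i j * T ^ (i - j) * \<bar>\<zeta> j\<bar>))\<^sup>2"
      using power_mono[OF \<Psi>[OF i], of 2] by simp
    also have "\<dots> \<le> (\<Sum>j=1..i. 1\<^sup>2) * (\<Sum>j=1..i. (gcoef n c T i j * T ^ (i - j) * \<bar>\<zeta> j\<bar>)\<^sup>2)"
      by (rule Cauchy_Schwarz_ineq_sum)
    also have "\<dots> = (\<Sum>j=1..i. (gcoef n c T i j)\<^sup>2 * real i * inverse ((1/T) ^ (2 * (i - j))) * (\<zeta> j)\<^sup>2)"
      by (simp add: sum_distrib_left power_mult_distrib power_one_over power_mult[symmetric] mult_ac)
    finally show ?thesis .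
  qed
  have "dotp n \<Psi> \<Psi> = (\<Sum>i=1..n. (\<Psi> i)\<^sup>2)" by (simp add: dotp_def power2_eq_square)
  also have "\<dots> \<le> (\<Sum>i=1..n. \<Sum>j=1..i. (gcoef n c T i j)\<^sup>2 * real i * inverse ((1/T) ^ (2 * (i - j))) * (\<zeta> j)\<^sup>2)"
    by (intro sum_mono pt)
  also have "\<dots> = (\<Sum>j=1..n. \<Sum>i=j..n. (gcoef n c T i j)\<^sup>2 * real i * inverse ((1/T) ^ (2 * (i - j))) * (\<zeta> j)\<^sup>2)"
    by (rule sum_triangle_swap)
  also have "\<dots> = (\<Sum>j=1..n. S j * (\<zeta> j)\<^sup>2)" by (simp add: S_def sum_distrib_right)
  also have "\<dots> \<le> (\<Sum>j=1..n. Max (S ` {1..n}) * (\<zeta> j)\<^sup>2)"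
    by (intro sum_mono mult_right_mono SM) auto
  also have "\<dots> = (dcoef n c T)\<^sup>2 * dotp n \<zeta> \<zeta>"
    using M0 by (simp add: d dotp_def power2_eq_square sum_distrib_left)
  finally show "dotp n \<Psi> \<Psi> \<le> (dcoef n c T)\<^sup>2 * dotp n \<zeta> \<zeta>" .
qed

text \<open>Scaling leaves \<open>s ^ (i + 1 - j) * s ^ (i - j)\<close> at \<open>c i j\<close>, and
  s \<le> T. The first power enters \<open>gcoef\<close>, the second becomes the power of \<gamma>_0
  in \<open>dcoef\<close>. The summand \<open>n - i\<close> on the diagonal of \<open>gcoef\<close>
  accounts for the extra copy of E that the doubled exponent of \<open>x\<close> produces.\<close>

lemma scaled_nonlinearity_bound:
  assumes T: "T > 0" and s: "0 < s" "s \<le> T" and i: "i \<in> {1..n}"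
    and c: "\<And>j. j \<in> {1..i} \<Longrightarrow> c i j \<ge> 0"
    and f: "\<bar>f\<bar> \<le> (\<Sum>j=1..i. c i j * \<bar>x j\<bar>)"
    and \<zeta>: "\<And>j. j \<in> {1..n} \<Longrightarrow> \<zeta> j = x j / s ^ (2 * (n - j))"
  shows "\<bar>real (n - i) * \<zeta> i + s * f / s ^ (2 * (n - i))\<bar>
    \<le> (\<Sum>j=1..i. gcoef n c T i j * T ^ (i - j) * \<bar>\<zeta> j\<bar>)"
proof -
  have "\<bar>s * f / s ^ (2 * (n - i))\<bar> = s / s ^ (2 * (n - i)) * \<bar>f\<bar>" using s by (simp add: abs_mult)
  also have "\<dots> \<le> s / s ^ (2 * (n - i)) * (\<Sum>j=1..i. c i j * \<bar>x j\<bar>)"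
    using s by (intro mult_left_mono f) auto
  also have "\<dots> \<le> (\<Sum>j=1..i. c i j * T ^ (i + 1 - j) * T ^ (i - j) * \<bar>\<zeta> j\<bar>)"
    unfolding sum_distrib_left
  proof (intro sum_mono)
    fix j assume j: "j \<in> {1..i}"
    have "s * s ^ (2 * (n - j)) = s ^ (i + 1 - j) * s ^ (i - j) * s ^ (2 * (n - i))"
    proof -
      have "Suc (2 * (n - j)) = (i + 1 - j) + (i - j) + 2 * (n - i)" using i j by auto
      thus ?thesis by (metis power_Suc power_add)
    qed
    hence "s / s ^ (2 * (n - i)) * s ^ (2 * (n - j)) = s ^ (i + 1 - j) * s ^ (i - j)"
      using s by (simp add: field_simps)
    hence "c i j * (s ^ (i + 1 - j) * s ^ (i - j)) * \<bar>\<zeta> j\<bar> = c i j * (s / s ^ (2 * (n - i)) * s ^ (2 * (n - j))) * \<bar>\<zeta> j\<bar>"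
      by (simp only:)
    also have "\<dots> = s / s ^ (2 * (n - i)) * (c i j * (s ^ (2 * (n - j)) * \<bar>\<zeta> j\<bar>))" by (simp only: mult_ac)
    finally have "s / s ^ (2 * (n - i)) * (c i j * (s ^ (2 * (n - j)) * \<bar>\<zeta> j\<bar>))
        = c i j * (s ^ (i + 1 - j) * s ^ (i - j)) * \<bar>\<zeta> j\<bar>" ..
    moreover have "\<bar>x j\<bar> = s ^ (2 * (n - j)) * \<bar>\<zeta> j\<bar>" using \<zeta>[of j] i j s by (simp add: abs_divide)
    ultimately have "s / s ^ (2 * (n - i)) * (c i j * \<bar>x j\<bar>) = c i j * (s ^ (i + 1 - j) * s ^ (i - j)) * \<bar>\<zeta> j\<bar>"
      by simp
    also have "\<dots> \<le> c i j * (T ^ (i + 1 - j) * T ^ (i - j)) * \<bar>\<zeta> j\<bar>"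
      using s T c[OF j] by (intro mult_right_mono mult_left_mono mult_mono power_mono) auto
    finally show "s / s ^ (2 * (n - i)) * (c i j * \<bar>x j\<bar>) \<le> c i j * T ^ (i + 1 - j) * T ^ (i - j) * \<bar>\<zeta> j\<bar>"
      by (simp add: mult.assoc)
  qed
  finally have 1: "\<bar>s * f / s ^ (2 * (n - i))\<bar> \<le> (\<Sum>j=1..i. c i j * T ^ (i + 1 - j) * T ^ (i - j) * \<bar>\<zeta> j\<bar>)" .
  have "(\<Sum>j=1..i. gcoef n c T i j * T ^ (i - j) * \<bar>\<zeta> j\<bar>)
    = (\<Sum>j=1..i. c i j * T ^ (i + 1 - j) * T ^ (i - j) * \<bar>\<zeta> j\<bar> + (if j = i then real (n - i) * \<bar>\<zeta> i\<bar> else 0))"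
    by (intro sum.cong refl) (auto simp: gcoef_def algebra_simps)
  also have "\<dots> = (\<Sum>j=1..i. c i j * T ^ (i + 1 - j) * T ^ (i - j) * \<bar>\<zeta> j\<bar>) + real (n - i) * \<bar>\<zeta> i\<bar>"
    using i by (simp add: sum.distrib)
  finally show ?thesis using 1 abs_triangle_ineq[of "real (n - i) * \<zeta> i" "s * f / s ^ (2 * (n - i))"]
    by (simp add: abs_mult)
qed

section \<open>The closed loop in scaled variables\<close>

text \<open>Integrating factor. At 0 only a one-sided derivative is available, so monotonicity is
  taken from the open interval together with continuity on the closed one.\<close>

lemma gronwall_half_open:
  fixes f f' :: "real \<Rightarrow> real"
  assumes der: "\<And>t. t \<in> {0..<T} \<Longrightarrow> (f has_real_derivative f' t) (at t within {0..<T})"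
    and le: "\<And>t. t \<in> {0..<T} \<Longrightarrow> f' t \<le> C * f t"
    and t: "t \<in> {0..<T}"
  shows "f t \<le> exp (C * t) * f 0"
proof -
  define h where "h = (\<lambda>t. exp (- C * t) * f t)"
  have dh: "(h has_real_derivative exp (- C * t) * (f' t - C * f t)) (at t within {0..<T})"
    if "t \<in> {0..<T}" for t
    unfolding h_def
    by (rule derivative_eq_intros der[OF that] refl | simp add: algebra_simps)+
  have "h t \<le> h 0"
  proof (rule DERIV_nonpos_imp_decreasing_open[of 0 t h])
    show "0 \<le> t" using t by simp
    show "\<exists>y. DERIV h r :> y \<and> y \<le> 0" if "0 < r" "r < t" for r
    proof (intro exI conjI)
      have r: "r \<in> {0..<T}" using that t by simp
      have "at r within {0..<T} = at r"
        by (rule at_within_interior) (use that t in \<open>simp add: interior_atLeastLessThan\<close>)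
      thus "DERIV h r :> exp (- C * r) * (f' r - C * f r)" using dh[OF r] by simp
      show "exp (- C * r) * (f' r - C * f r) \<le> 0" using le[OF r] by (simp add: mult_le_0_iff)
    qed
    show "continuous_on {0..t} h"
    proof (rule DERIV_continuous_on)
      show "(h has_real_derivative exp (- C * r) * (f' r - C * f r)) (at r within {0..t})" if "r \<in> {0..t}" for r
        by (rule DERIV_subset[OF dh]) (use that t in auto)
    qed
  qed
  thus ?thesis by (simp add: h_def exp_minus field_simps)
qed

text \<open>The factor 1/(T - t) is pulled out because what remains of the scaled system has no
  singular coefficient. The same rule serves the states, the equation of x_0 and Z / s^3.\<close>

lemma has_derivative_scaled:
  fixes f :: "real \<Rightarrow> real"
  assumes "(f has_real_derivative f') (at t within S)" and "t < T"
  shows "((\<lambda>r. f r / (T - r) ^ k) has_real_derivative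
    (real k * (f t / (T - t) ^ k) + (T - t) * f' / (T - t) ^ k) / (T - t)) (at t within S)"
proof (cases k)
  case 0
  thus ?thesis using assms by simp
next
  case (Suc m)
  have "((\<lambda>r. f r / (T - r) ^ k) has_real_derivative
     (f' * (T - t) ^ k - f t * (- (real k * (T - t) ^ m))) / ((T - t) ^ k * (T - t) ^ k)) (at t within S)"
    by (rule derivative_eq_intros assms refl | use assms(2) Suc in \<open>simp add: algebra_simps\<close>)+
  moreover have "(f' * (T - t) ^ k - f t * (- (real k * (T - t) ^ m))) / ((T - t) ^ k * (T - t) ^ k)
    = (real k * (f t / (T - t) ^ k) + (T - t) * f' / (T - t) ^ k) / (T - t)"
  proof -
    define s where "s = T - t"
    have s: "s > 0" using assms(2) by (simp add: s_def)
    have "f' * s ^ k / (s ^ k * s ^ k) = f' / s ^ k" using s by simp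
    moreover have "f t * (real k * s ^ m) / (s ^ k * s ^ k) = real k * (f t / s ^ k) / s"
      using s by (simp add: Suc field_simps)
    moreover have "(s * f' / s ^ k) / s = f' / s ^ k" using s by simp
    ultimately show ?thesis unfolding s_def[symmetric] by (simp add: add_divide_distrib)
  qed
  ultimately show ?thesis by simp
qed

lemma has_derivative_quadratic:
  fixes v :: "real \<Rightarrow> rvec"
  assumes sym: "\<And>i j. M i j = M j i"
    and der: "\<And>i. i \<in> {1..n} \<Longrightarrow> ((\<lambda>r. v r i) has_real_derivative v' i) (at t within S)"
  shows "((\<lambda>r. dotp n (v r) (mvec n M (v r))) has_real_derivative 2 * dotp n (mvec n M (v t)) v') (at t within S)"
proof -
  have m: "((\<lambda>r. mvec n M (v r) i) has_real_derivative mvec n M v' i) (at t within S)" for i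
    unfolding mvec_def by (intro DERIV_sum DERIV_cmult der)
  have "((\<lambda>r. dotp n (v r) (mvec n M (v r))) has_real_derivative
      (\<Sum>i=1..n. v' i * mvec n M (v t) i + mvec n M v' i * v t i)) (at t within S)"
    unfolding dotp_def by (intro DERIV_sum DERIV_mult der m)
  also have "(\<Sum>i=1..n. v' i * mvec n M (v t) i + mvec n M v' i * v t i)
     = dotp n v' (mvec n M (v t)) + dotp n (v t) (mvec n M v')"
    by (simp add: dotp_def sum.distrib mult.commute)
  also have "dotp n (v t) (mvec n M v') = dotp n (mvec n M (v t)) v'" by (rule dotp_mvec_sym[OF sym])
  also have "dotp n v' (mvec n M (v t)) = dotp n (mvec n M (v t)) v'" by (rule dotp_commute)
  finally show ?thesis by simp
qed

lemma gam_eq: "T > 0 \<Longrightarrow> gam T t = 1 / (T - t)"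
  by (simp add: gam_def)

text \<open>Entry \<open>j\<close> of the last row of P(\<gamma>) carries \<gamma> to the power n -
  j + 1. With \<gamma> = 1/s one factor 1/s splits off, and the rest is the scaling of
  \<xi>.\<close>

lemma Pm_gam_last_row:
  assumes n: "n \<ge> 1" and T: "T > 0" and t: "t < T"
  shows "(T - t) * dotp n (bvec n) (mvec n (Pm n (gam T t)) \<xi>) = mvec n (Pm n 1) (\<lambda>i. \<xi> i / (T - t) ^ (n - i)) n"
proof -
  have g: "gam T t > 0" using T t by (simp add: gam_eq)
  have "dotp n (bvec n) (mvec n (Pm n (gam T t)) \<xi>) = mvec n (Pm n (gam T t)) \<xi> n"
    unfolding bvec_def by (rule dotp_unit) (use n in simp)
  moreover have "(T - t) * mvec n (Pm n (gam T t)) \<xi> n = mvec n (Pm n 1) (\<lambda>i. \<xi> i / (T - t) ^ (n - i)) n"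
    unfolding mvec_def sum_distrib_left
    by (intro sum.cong refl) (use n t in \<open>simp add: Pm_expl g P_expl_def gam_eq[OF T] field_simps\<close>)
  ultimately show ?thesis by simp
qed

lemma Qm_gam_first_column:
  assumes n: "n \<ge> 1" and T: "T > 0" and t: "t < T" and i: "i \<in> {1..n}"
  shows "(T - t) ^ i * mvec n (Qm n (gam T t)) (cvec n) i = mvec n (Qm n 1) (cvec n) i"
proof -
  have g: "gam T t > 0" using T t by (simp add: gam_eq)
  have e: "n - (n + 1 - i) + (n - (n + 1 - 1)) + 1 = i" using i by auto
  have "mvec n M (cvec n) i = M i 1" for M
    using n by (simp add: mvec_def cvec_def if_distrib[of "\<lambda>x. _ * x"] cong: if_cong)
  moreover have "(T - t) ^ i * flip n (P_expl n (gam T t)) i 1 = flip n (P_expl n 1) i 1"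
    unfolding flip_def P_expl_def e using t by (simp add: gam_eq[OF T] power_one_over)
  ultimately show ?thesis using n g by (simp add: Qm_expl)
qed

definition sc_xi :: "nat \<Rightarrow> real \<Rightarrow> rvec \<Rightarrow> rvec" where
  "sc_xi n s \<xi> = (\<lambda>i. \<xi> i / s ^ (n - i))"

text \<open>Two powers of s per link of the chain: one offsets the factor 1/s of the scaled system,
  the other the order s of u_0. The links of \<xi> have the constant factor \<beta>, so one power
  suffices there. The innovation then is s^(n-1) times the first error component.\<close>

definition sc_x :: "nat \<Rightarrow> real \<Rightarrow> rvec \<Rightarrow> rvec" where
  "sc_x n s x = (\<lambda>i. x i / s ^ (2 * (n - i)))"

definition sc_err :: "nat \<Rightarrow> real \<Rightarrow> rvec \<Rightarrow> rvec \<Rightarrow> rvec" where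
  "sc_err n s x \<xi> = (\<lambda>i. sc_x n s x i - sc_xi n s \<xi> i)"

definition lyap :: "nat \<Rightarrow> real \<Rightarrow> rvec \<Rightarrow> rvec \<Rightarrow> real" where
  "lyap n s x \<xi> = dotp n (sc_xi n s \<xi>) (mvec n (Pm n 1) (sc_xi n s \<xi>))
    + 2 * cQPQc n * dotp n (sc_err n s x \<xi>) (mvec n (R_expl n) (sc_err n s x \<xi>))"

text \<open>x_0 / s^3 + \<beta> / (2 s) is a first integral: s^3 solves the homogeneous equation,
  and the second term compensates the forcing.\<close>

lemma x0_solution:
  assumes T: "T > 0"
    and der: "\<And>t. t \<in> {0..<T} \<Longrightarrow> (x0 has_real_derivative u0_fb n c T t (x0 t)) (at t within {0..<T})"
    and t: "t \<in> {0..<T}"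
  shows "x0 t = (T - t) ^ 3 * x0 0 / T ^ 3 - beta n c T * t * (T - t)\<^sup>2 / (2 * T)"
proof -
  define h where "h = (\<lambda>t. x0 t / (T - t) ^ 3 + beta n c T / 2 * (1 / (T - t) ^ 1))"
  have "(h has_real_derivative 0) (at t within {0..<T})" if t: "t \<in> {0..<T}" for t
  proof -
    define s where "s = T - t"
    have tT: "t < T" and s: "s > 0" using t by (auto simp: s_def)
    have "(h has_real_derivative
       (real 3 * (x0 t / (T - t) ^ 3) + (T - t) * u0_fb n c T t (x0 t) / (T - t) ^ 3) / (T - t)
       + beta n c T / 2 * ((real 1 * (1 / (T - t) ^ 1) + (T - t) * 0 / (T - t) ^ 1) / (T - t))) (at t within {0..<T})"
      unfolding h_def
      by (intro DERIV_add DERIV_cmult has_derivative_scaled der[OF t] tT) (rule DERIV_const)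
    moreover have "(real 3 * (x0 t / (T - t) ^ 3) + (T - t) * u0_fb n c T t (x0 t) / (T - t) ^ 3) / (T - t)
       + beta n c T / 2 * ((real 1 * (1 / (T - t) ^ 1) + (T - t) * 0 / (T - t) ^ 1) / (T - t)) = 0"
      unfolding u0_fb_def s_def[symmetric] using s by (simp add: field_simps power3_eq_cube)
    ultimately show ?thesis by simp
  qed
  hence "h t = h 0"
    using has_field_derivative_zero_constant[of "{0..<T}" h] t T by (metis atLeastLessThan_iff convex_real_interval(7) order_refl)
  hence "x0 t / (T - t) ^ 3 = x0 0 / T ^ 3 + beta n c T / 2 * (1 / T - 1 / (T - t))"
    by (simp add: h_def algebra_simps)
  also have "1 / T - 1 / (T - t) = - t / (T * (T - t))" using t T by (simp add: field_simps)
  finally have e: "x0 t / (T - t) ^ 3 = x0 0 / T ^ 3 + beta n c T / 2 * (- t / (T * (T - t)))" .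
  have "x0 t = (T - t) ^ 3 * (x0 t / (T - t) ^ 3)" using t by simp
  also have "\<dots> = (T - t) ^ 3 * x0 0 / T ^ 3 - beta n c T * t * (T - t)\<^sup>2 / (2 * T)"
  proof -
    define s where "s = T - t"
    have "s > 0" using t by (simp add: s_def)
    thus ?thesis unfolding e unfolding s_def[symmetric] using T by (simp add: field_simps power3_eq_cube power2_eq_square)
  qed
  finally show ?thesis .
qed

lemma beta_ge:
  assumes "n \<ge> 1"
  shows "beta n c T \<ge> 8 * sqrt 2 * real n * dcoef n c T * Lam n * cQPQc n + 2 * (2 + delta_c n / real n)"
    "beta n c T \<ge> 4 * sqrt 2 * dcoef n c T * Lam n + 2 * (2 * real n + 2 - 1 / real n)"
  by (simp_all add: beta_def)

lemma beta_pos: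
  assumes n: "n \<ge> 1" and d: "dcoef n c T \<ge> 0"
  shows "beta n c T > 0"
proof -
  have "sqrt 2 * dcoef n c T * Lam n \<ge> 0" using d Lam_pos[OF n] by simp
  moreover have "1 / real n \<le> 1" "real n \<ge> 1" using n by auto
  moreover have "beta n c T \<ge> 4 * (sqrt 2 * dcoef n c T * Lam n) + 4 * real n + 4 - 2 * (1 / real n)"
    using beta_ge(2)[OF n, of c T] by (simp add: mult_ac)
  ultimately show ?thesis by linarith
qed

text \<open>Along the solution u_0 / s differs from \<beta> by an exact multiple of s, which cancels
  the singular factor 1/s later on. The multiple is affine in x_0(0), and this is how the initial
  value enters the growth rates.\<close>

lemma u0_fb_solution:
  assumes T: "T > 0" and t: "t \<in> {0..<T}"
    and x0: "x0 t = (T - t) ^ 3 * x0 0 / T ^ 3 - beta n c T * t * (T - t)\<^sup>2 / (2 * T)"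
  shows "u0_fb n c T t (x0 t) = (T - t) * (beta n c T - 3 * (T - t) * (x0 0 / T ^ 3 + beta n c T / (2 * T)))"
proof -
  define s where "s = T - t"
  have s: "s > 0" "t = T - s" using t by (auto simp: s_def)
  have "u0_fb n c T t (x0 t) = - 3 / s * (s ^ 3 * x0 0 / T ^ 3 - beta n c T * t * s\<^sup>2 / (2 * T)) - beta n c T / 2 * s"
    by (simp add: u0_fb_def x0 s_def)
  also have "\<dots> = s * (- 3 * s * (x0 0 / T ^ 3) + 3 * beta n c T * t / (2 * T) - beta n c T / 2)"
    using s by (simp add: field_simps power3_eq_cube power2_eq_square)
  also have "3 * beta n c T * t / (2 * T) = 3 * beta n c T / 2 - 3 * s * (beta n c T / (2 * T))"
    using T unfolding s(2) by (simp add: field_simps)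
  also have "s * (- 3 * s * (x0 0 / T ^ 3) + (3 * beta n c T / 2 - 3 * s * (beta n c T / (2 * T))) - beta n c T / 2)
     = s * (beta n c T - 3 * s * (x0 0 / T ^ 3 + beta n c T / (2 * T)))" by (simp add: algebra_simps)
  finally show ?thesis by (simp add: s_def)
qed

lemma lyap_nonneg: "n \<ge> 1 \<Longrightarrow> 0 \<le> lyap n s x \<xi>"
  unfolding lyap_def using Pm_nonneg[of n] R_nonneg[of n] cQPQc_pos[of n]
  by (intro add_nonneg_nonneg mult_nonneg_nonneg) auto

lemma lyap_has_derivative:
  fixes c :: "nat \<Rightarrow> nat \<Rightarrow> real"
  assumes n: "n \<ge> 1" and T: "T > 0"
    and c_nonneg: "\<forall>i\<in>{1..n}. \<forall>j\<in>{1..i}. c i j \<ge> 0"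
    and phi_bound: "\<forall>i\<in>{1..n}. \<forall>t u0 u x. \<bar>\<phi> i t u0 u x\<bar> \<le> (\<Sum>j=1..i. c i j * \<bar>x j\<bar>)"
    and cl: "closed_loop n c T \<phi> x0 x \<xi>"
    and t: "t \<in> {0..<T}"
  obtains Z' where "((\<lambda>r. lyap n (T - r) (x r) (\<xi> r)) has_real_derivative Z') (at t within {0..<T})"
    and "(T - t) * Z' + 3 * lyap n (T - t) (x t) (\<xi> t) \<le>
      2 * sqrt 2 * Lam n * (1 + cQPQc n) * \<bar>u0_fb n c T t (x0 t) / (T - t) - beta n c T\<bar> * lyap n (T - t) (x t) (\<xi> t)"
proof -
  define s where "s = T - t"
  have s: "s > 0" "s \<le> T" and tT: "t < T" using t by (auto simp: s_def)
  define \<eta> where "\<eta> = sc_xi n s (\<xi> t)"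
  define \<zeta> where "\<zeta> = sc_x n s (x t)"
  define \<epsilon> where "\<epsilon> = sc_err n s (x t) (\<xi> t)"
  have \<epsilon>: "\<epsilon> i = \<zeta> i - \<eta> i" for i by (simp add: \<epsilon>_def \<zeta>_def \<eta>_def sc_err_def)
  define u0 u where "u0 = u0_fb n c T t (x0 t)" and "u = u_fb n c T t (\<xi> t)"
  define f where "f = (\<lambda>i. \<phi> i t u0 u (x t))"
  define B where "B = beta n c T"
  define \<delta> where "\<delta> = u0 / s - B"
  define p where "p = mvec n (Pm n 1) \<eta> n"
  define g where "g = mvec n (Qm n 1) (cvec n)"
  \<comment> \<open>Differentiating the doubled power gives 2 (n - i) \<zeta>_i. One half is the E
    \<zeta> that matches the equation of \<eta>; the other half is counted with the
    nonlinearity.\<close>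
  define \<Psi> where "\<Psi> = (\<lambda>i. real (n - i) * \<zeta> i + s * f i / s ^ (2 * (n - i)))"
  define x' where "x' = (\<lambda>i. (if i < n then u0 * x t (i + 1) else u) + f i)"
  define \<xi>' where "\<xi>' = (\<lambda>i. B * mvec n (Amat n) (\<xi> t) i + bvec n i * u
     + B * mvec n (Qm n (gam T t)) (cvec n) i * ((gam T t) ^ (n - 1) * x t 1 - dotp n (cvec n) (\<xi> t)))"
  \<comment> \<open>While \<open>x'\<close> and \<open>\<xi>'\<close> are plain derivatives,
    \<open>\<eta>'\<close>, \<open>\<zeta>'\<close> and \<open>\<epsilon>'\<close> are derivatives
    multiplied by \<open>s\<close>.\<close>
  define \<eta>' where "\<eta>' = (\<lambda>i. real (n - i) * \<eta> i + s * \<xi>' i / s ^ (n - i))"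
  define \<zeta>' where "\<zeta>' = (\<lambda>i. real (2 * (n - i)) * \<zeta> i + s * x' i / s ^ (2 * (n - i)))"
  define \<epsilon>' where "\<epsilon>' = (\<lambda>i. \<zeta>' i - \<eta>' i)"
  have dx: "((\<lambda>r. x r i) has_real_derivative x' i) (at t within {0..<T})" if "i \<in> {1..n}" for i
    using cl t that unfolding closed_loop_def x'_def f_def u0_def u_def
    by (cases "i = n") auto
  have d\<xi>: "((\<lambda>r. \<xi> r i) has_real_derivative \<xi>' i) (at t within {0..<T})" if "i \<in> {1..n}" for i
    using cl t that unfolding closed_loop_def \<xi>'_def B_def u_def by blast
  have d\<eta>: "((\<lambda>r. sc_xi n (T - r) (\<xi> r) i) has_real_derivative \<eta>' i / s) (at t within {0..<T})" if "i \<in> {1..n}" for i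
    unfolding sc_xi_def \<eta>'_def \<eta>_def s_def by (rule has_derivative_scaled[OF d\<xi>[OF that] tT])
  have d\<zeta>: "((\<lambda>r. sc_x n (T - r) (x r) i) has_real_derivative \<zeta>' i / s) (at t within {0..<T})" if "i \<in> {1..n}" for i
    unfolding sc_x_def \<zeta>'_def \<zeta>_def s_def by (rule has_derivative_scaled[OF dx[OF that] tT])
  have d\<epsilon>: "((\<lambda>r. sc_err n (T - r) (x r) (\<xi> r) i) has_real_derivative \<epsilon>' i / s) (at t within {0..<T})" if "i \<in> {1..n}" for i
    unfolding sc_err_def \<epsilon>'_def diff_divide_distrib by (intro DERIV_diff d\<zeta> d\<eta> that)
  define Z where "Z = lyap n s (x t) (\<xi> t)"
  define dP dR where "dP = 2 * dotp n (mvec n (Pm n 1) \<eta>) \<eta>'" and "dR = 2 * dotp n (mvec n (R_expl n) \<epsilon>) \<epsilon>'"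
  have Psym: "Pm n 1 i j = Pm n 1 j i" for i j using n by (simp add: Pm_expl P_expl_sym)
  have "((\<lambda>r. lyap n (T - r) (x r) (\<xi> r)) has_real_derivative
      2 * dotp n (mvec n (Pm n 1) (sc_xi n (T - t) (\<xi> t))) (\<lambda>i. \<eta>' i / s)
      + 2 * cQPQc n * (2 * dotp n (mvec n (R_expl n) (sc_err n (T - t) (x t) (\<xi> t))) (\<lambda>i. \<epsilon>' i / s))) (at t within {0..<T})"
    unfolding lyap_def
    by (intro DERIV_add DERIV_cmult has_derivative_quadratic[OF Psym] has_derivative_quadratic[OF R_expl_sym] d\<eta> d\<epsilon>)
  also have "2 * dotp n (mvec n (Pm n 1) (sc_xi n (T - t) (\<xi> t))) (\<lambda>i. \<eta>' i / s)
      + 2 * cQPQc n * (2 * dotp n (mvec n (R_expl n) (sc_err n (T - t) (x t) (\<xi> t))) (\<lambda>i. \<epsilon>' i / s))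
      = (dP + 2 * cQPQc n * dR) / s"
  proof -
    have "dotp n v (\<lambda>i. w i / s) = dotp n v w / s" for v w
      by (simp add: dotp_def sum_divide_distrib)
    thus ?thesis by (simp add: dP_def dR_def \<eta>_def \<epsilon>_def s_def add_divide_distrib)
  qed
  finally have der: "((\<lambda>r. lyap n (T - r) (x r) (\<xi> r)) has_real_derivative (dP + 2 * cQPQc n * dR) / s) (at t within {0..<T})" .
  have su: "s * u = - B * p"
    using Pm_gam_last_row[OF n T tT, of "\<xi> t"]
    by (simp add: u_fb_def u_def s_def B_def p_def \<eta>_def sc_xi_def)
  have \<zeta>i: "\<zeta> i = x t i / s ^ (2 * (n - i))" and \<eta>i: "\<eta> i = \<xi> t i / s ^ (n - i)" for i
    by (simp_all add: \<zeta>_def sc_x_def \<eta>_def sc_xi_def)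
  have \<eta>': "\<eta>' i = mvec n (Em n) \<eta> i + B * mvec n (Amat n) \<eta> i - B * mvec n (Pm n 1) \<eta> n * bvec n i + B * \<epsilon> 1 * g i"
    if i: "i \<in> {1..n}" for i
  proof -
    have "s * (B * mvec n (Amat n) (\<xi> t) i) / s ^ (n - i) = B * mvec n (Amat n) \<eta> i"
    proof (cases "i < n")
      case True
      hence "s ^ (n - i) = s * s ^ (n - (i + 1))" by (simp flip: power_Suc add: Suc_diff_Suc)
      thus ?thesis using True i s by (simp add: mvec_Amat \<eta>i)
    qed (use i in \<open>simp add: mvec_Amat\<close>)
    moreover have "s * (bvec n i * u) / s ^ (n - i) = - (B * mvec n (Pm n 1) \<eta> n * bvec n i)"
      using su by (simp add: bvec_def p_def)
    moreover have "s * (B * mvec n (Qm n (gam T t)) (cvec n) i * ((gam T t) ^ (n - 1) * x t 1 - dotp n (cvec n) (\<xi> t))) / s ^ (n - i)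
       = B * \<epsilon> 1 * g i"
    proof -
      have c1: "dotp n (cvec n) (\<xi> t) = \<xi> t 1" unfolding cvec_def by (rule dotp_unit) (use n in simp)
      have gm: "gam T t ^ (n - 1) = 1 / s ^ (n - 1)" using T by (simp add: gam_eq s_def power_one_over)
      have "g i = s ^ i * mvec n (Qm n (gam T t)) (cvec n) i"
        using Qm_gam_first_column[OF n T tT i] by (simp add: g_def s_def)
      hence q: "mvec n (Qm n (gam T t)) (cvec n) i = g i / s ^ i" using s by simp
      have pw: "s ^ (n - i) * s ^ i = s * s ^ (n - 1)" using i n by (simp flip: power_add power_Suc)
      have e1: "\<epsilon> 1 = (x t 1 / s ^ (n - 1) - \<xi> t 1) / s ^ (n - 1)"
        unfolding \<epsilon> \<zeta>i \<eta>i by (simp add: mult_2 power_add diff_divide_distrib)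
      have "s * (B * (g i / s ^ i) * (1 / s ^ (n - 1) * x t 1 - \<xi> t 1)) / s ^ (n - i)
         = B * g i * (x t 1 / s ^ (n - 1) - \<xi> t 1) * s / (s ^ (n - i) * s ^ i)"
        by (simp add: mult_ac)
      also have "\<dots> = B * g i * (x t 1 / s ^ (n - 1) - \<xi> t 1) / s ^ (n - 1)" unfolding pw using s by simp
      also have "\<dots> = B * \<epsilon> 1 * g i" unfolding e1 by simp
      finally show ?thesis unfolding c1 gm q .
    qed
    ultimately show ?thesis
      unfolding \<eta>'_def \<xi>'_def distrib_left add_divide_distrib using i by (simp add: mvec_Em)
  qed
  have \<zeta>': "\<zeta>' i = mvec n (Em n) \<zeta> i + (B + \<delta>) * mvec n (Amat n) \<zeta> i - B * mvec n (Pm n 1) \<eta> n * bvec n i + \<Psi> i"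
    if i: "i \<in> {1..n}" for i
  proof -
    \<comment> \<open>Of the two powers of \<open>s\<close> between the scalings at \<open>i\<close>
      and \<open>i + 1\<close>, one meets the factor \<open>s\<close>, and the other turns
      \<open>u0\<close> into \<open>u0 / s = B + \<delta>\<close>.\<close>
    have "s * (if i < n then u0 * x t (i + 1) else u) / s ^ (2 * (n - i))
       = (B + \<delta>) * mvec n (Amat n) \<zeta> i - B * mvec n (Pm n 1) \<eta> n * bvec n i"
    proof (cases "i < n")
      case True
      hence "2 * (n - i) = Suc (Suc (2 * (n - (i + 1))))" by simp
      hence "s ^ (2 * (n - i)) = s * (s * s ^ (2 * (n - (i + 1))))" by (metis power_Suc)
      thus ?thesis using True i s by (simp add: mvec_Amat \<zeta>i \<delta>_def bvec_def)
    next
      case False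
      hence "i = n" using i by simp
      thus ?thesis using su i by (simp add: mvec_Amat bvec_def p_def)
    qed
    thus ?thesis unfolding \<zeta>'_def x'_def \<Psi>_def distrib_left add_divide_distrib
      using i by (simp add: mvec_Em algebra_simps)
  qed
  have \<zeta>eq: "\<zeta> = (\<lambda>i. \<eta> i + \<epsilon> i)" by (simp add: \<epsilon> fun_eq_iff)
  \<comment> \<open>Both subsystems have the same E, A and control term, so the control cancels in
    the difference.\<close>
  have \<epsilon>': "\<epsilon>' i = mvec n (Em n) \<epsilon> i + B * mvec n (Amat n) \<epsilon> i - B * \<epsilon> 1 * g i + \<Psi> i
      + \<delta> * mvec n (Amat n) (\<lambda>i. \<eta> i + \<epsilon> i) i" if i: "i \<in> {1..n}" for i
    unfolding \<epsilon>'_def \<eta>'[OF i] \<zeta>'[OF i] unfolding \<zeta>eq mvec_add by (simp add: algebra_simps)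
  have c: "\<And>i j. i \<in> {1..n} \<Longrightarrow> j \<in> {1..i} \<Longrightarrow> c i j \<ge> 0" using c_nonneg by blast
  have \<Psi>le: "\<bar>\<Psi> i\<bar> \<le> (\<Sum>j=1..i. gcoef n c T i j * T ^ (i - j) * \<bar>\<zeta> j\<bar>)" if i: "i \<in> {1..n}" for i
    unfolding \<Psi>_def
    by (rule scaled_nonlinearity_bound[where x = "x t", OF T s i])
      (use c[OF i] phi_bound i \<zeta>i in \<open>simp_all add: f_def\<close>)
  note dc = dcoef_bound[OF n T c \<Psi>le]
  have decay: "Z + dP + 2 * cQPQc n * dR \<le> (- 2 + 2 * sqrt 2 * Lam n * (1 + cQPQc n) * \<bar>\<delta>\<bar>) * Z"
    unfolding Z_def lyap_def dP_def dR_def \<eta>_def[symmetric] \<epsilon>_def[symmetric]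
    by (rule lyapunov_decay[OF n dc(2) dc(1)[unfolded \<zeta>eq] beta_ge[OF n, of c T, folded B_def] \<eta>'[unfolded g_def] \<epsilon>'[unfolded g_def]])
  have "s * ((dP + 2 * cQPQc n * dR) / s) = dP + 2 * cQPQc n * dR" using s by simp
  hence "s * ((dP + 2 * cQPQc n * dR) / s) + 3 * Z \<le> 2 * sqrt 2 * Lam n * (1 + cQPQc n) * \<bar>\<delta>\<bar> * Z"
    using decay by (simp only:) (simp add: algebra_simps)
  thus ?thesis using that[OF der] by (simp add: Z_def s_def \<delta>_def u0_def B_def)
qed

lemma lyap_decay:
  fixes c :: "nat \<Rightarrow> nat \<Rightarrow> real"
  assumes n: "n \<ge> 1" and T: "T > 0"
    and c_nonneg: "\<forall>i\<in>{1..n}. \<forall>j\<in>{1..i}. c i j \<ge> 0"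
    and phi_bound: "\<forall>i\<in>{1..n}. \<forall>t u0 u x. \<bar>\<phi> i t u0 u x\<bar> \<le> (\<Sum>j=1..i. c i j * \<bar>x j\<bar>)"
    and cl: "closed_loop n c T \<phi> x0 x \<xi>"
    and t: "t \<in> {0..<T}"
  shows "lyap n (T - t) (x t) (\<xi> t) \<le> ((T - t) / T) ^ 3 * lyap n T (x 0) (\<xi> 0) *
    exp (2 * sqrt 2 * Lam n * (1 + cQPQc n) * (3 * (\<bar>x0 0\<bar> / T ^ 3 + \<bar>beta n c T\<bar> / (2 * T))) * t)"
proof -
  define K M where "K = 2 * sqrt 2 * Lam n * (1 + cQPQc n)" and "M = 3 * (\<bar>x0 0\<bar> / T ^ 3 + \<bar>beta n c T\<bar> / (2 * T))"
  have K: "K \<ge> 0" using Lam_pos[OF n] cQPQc_pos[OF n] by (simp add: K_def)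
  define Z where "Z = (\<lambda>r. lyap n (T - r) (x r) (\<xi> r))"
  have Z0: "Z r \<ge> 0" for r unfolding Z_def by (rule lyap_nonneg[OF n])
  have ex: "\<exists>Z'. (Z has_real_derivative Z') (at r within {0..<T}) \<and>
      (T - r) * Z' + 3 * Z r \<le> K * ((T - r) * M) * Z r" if r: "r \<in> {0..<T}" for r
  proof -
    obtain Z' where "((\<lambda>r. lyap n (T - r) (x r) (\<xi> r)) has_real_derivative Z') (at r within {0..<T})"
      and "(T - r) * Z' + 3 * lyap n (T - r) (x r) (\<xi> r) \<le> 2 * sqrt 2 * Lam n * (1 + cQPQc n) *
        \<bar>u0_fb n c T r (x0 r) / (T - r) - beta n c T\<bar> * lyap n (T - r) (x r) (\<xi> r)"
      by (rule lyap_has_derivative[OF n T c_nonneg phi_bound cl r])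
    hence Z': "(Z has_real_derivative Z') (at r within {0..<T})"
      and le: "(T - r) * Z' + 3 * Z r \<le> K * \<bar>u0_fb n c T r (x0 r) / (T - r) - beta n c T\<bar> * Z r"
      unfolding Z_def K_def by simp_all
    have "x0 r = (T - r) ^ 3 * x0 0 / T ^ 3 - beta n c T * r * (T - r)\<^sup>2 / (2 * T)"
      by (rule x0_solution[OF T _ r]) (use cl in \<open>auto simp: closed_loop_def\<close>)
    from u0_fb_solution[of T r x0 n c, OF T r this]
    have "u0_fb n c T r (x0 r) / (T - r) - beta n c T = - (3 * (T - r) * (x0 0 / T ^ 3 + beta n c T / (2 * T)))"
      using r by simp
    also have "\<bar>\<dots>\<bar> = 3 * (T - r) * \<bar>x0 0 / T ^ 3 + beta n c T / (2 * T)\<bar>" using r by (simp add: abs_mult)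
    also have "\<dots> \<le> 3 * (T - r) * (\<bar>x0 0\<bar> / T ^ 3 + \<bar>beta n c T\<bar> / (2 * T))"
      using T r by (intro mult_left_mono order_trans[OF abs_triangle_ineq]) (auto simp: abs_divide)
    finally have "\<bar>u0_fb n c T r (x0 r) / (T - r) - beta n c T\<bar> \<le> (T - r) * M" by (simp only: M_def mult_ac)
    hence "K * \<bar>u0_fb n c T r (x0 r) / (T - r) - beta n c T\<bar> * Z r \<le> K * ((T - r) * M) * Z r"
      by (intro mult_right_mono mult_left_mono K Z0)
    hence "(T - r) * Z' + 3 * Z r \<le> K * ((T - r) * M) * Z r" using le by (rule order_trans[rotated])
    thus ?thesis using Z' by blast
  qed
  \<comment> \<open>\<open>lyap_has_derivative\<close> yields a derivative at each time separately,
    while Gronwall's inequality takes a function, hence the choice.\<close>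
  define Z' where "Z' = (\<lambda>r. SOME Z'. (Z has_real_derivative Z') (at r within {0..<T}) \<and>
      (T - r) * Z' + 3 * Z r \<le> K * ((T - r) * M) * Z r)"
  have Z': "\<And>r. r \<in> {0..<T} \<Longrightarrow> (Z has_real_derivative Z' r) (at r within {0..<T})"
    and le: "\<And>r. r \<in> {0..<T} \<Longrightarrow> (T - r) * Z' r + 3 * Z r \<le> K * ((T - r) * M) * Z r"
    using someI_ex[OF ex] unfolding Z'_def by blast+
  have "Z t / (T - t) ^ 3 \<le> exp (K * M * t) * (Z 0 / (T - 0) ^ 3)"
  proof (rule gronwall_half_open[OF _ _ t])
    fix r assume r: "r \<in> {0..<T}"
    show "((\<lambda>r. Z r / (T - r) ^ 3) has_real_derivative
       (real 3 * (Z r / (T - r) ^ 3) + (T - r) * Z' r / (T - r) ^ 3) / (T - r)) (at r within {0..<T})"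
      by (rule has_derivative_scaled[OF Z'[OF r]]) (use r in simp)
    define s where "s = T - r"
    have s: "s > 0" using r by (simp add: s_def)
    have "(real 3 * (Z r / s ^ 3) + s * Z' r / s ^ 3) / s = (s * Z' r + 3 * Z r) / (s ^ 3 * s)"
      using s by (simp add: add_divide_distrib)
    also have "\<dots> \<le> (K * (s * M) * Z r) / (s ^ 3 * s)"
      using le[OF r] s unfolding s_def[symmetric] by (intro divide_right_mono) auto
    \<comment> \<open>The factor \<open>s\<close> in the bound on the deviation of u_0 / s from
      \<beta> cancels the singular 1/s, so the growth rate is constant in time.\<close>
    also have "\<dots> = K * M * (Z r / s ^ 3)" using s by simp
    finally show "(real 3 * (Z r / (T - r) ^ 3) + (T - r) * Z' r / (T - r) ^ 3) / (T - r) \<le> K * M * (Z r / (T - r) ^ 3)"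
      unfolding s_def .
  qed
  hence "Z t \<le> (T - t) ^ 3 * (exp (K * M * t) * (Z 0 / T ^ 3))" using t by (simp add: field_simps)
  also have "\<dots> = ((T - t) / T) ^ 3 * Z 0 * exp (K * M * t)" by (simp add: power_divide)
  finally show ?thesis by (simp only: Z_def K_def M_def diff_zero)
qed

section \<open>From the Lyapunov function back to the states\<close>

definition pow_bound :: "nat \<Rightarrow> real \<Rightarrow> real" where
  "pow_bound n T = (\<Sum>k\<le>2 * n. T ^ k + 1 / T ^ k)"

text \<open>One constant for all powers of T and 1/T that the scalings involve, whether T lies above
  or below 1.\<close>

lemma pow_bound_ge:
  assumes "T > 0" "k \<le> 2 * n"
  shows "T ^ k \<le> pow_bound n T" "1 / T ^ k \<le> pow_bound n T"
proof -
  have "T ^ k + 1 / T ^ k \<le> pow_bound n T"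
    unfolding pow_bound_def using assms by (intro member_le_sum[of k "{..2 * n}" "\<lambda>k. T ^ k + 1 / T ^ k"]) auto
  moreover have "T ^ k > 0" "1 / T ^ k > 0" using assms by auto
  ultimately show "T ^ k \<le> pow_bound n T" "1 / T ^ k \<le> pow_bound n T" by linarith+
qed

lemma dotp_le_scaled:
  assumes "\<And>i. i \<in> {1..n} \<Longrightarrow> \<bar>v i\<bar> \<le> b * \<bar>w i\<bar>"
  shows "dotp n v v \<le> b\<^sup>2 * dotp n w w"
proof -
  have "(v i)\<^sup>2 \<le> b\<^sup>2 * (w i)\<^sup>2" if "i \<in> {1..n}" for i
    using power_mono[OF assms[OF that], of 2] by (simp add: power_mult_distrib)
  hence "(\<Sum>i=1..n. (v i)\<^sup>2) \<le> (\<Sum>i=1..n. b\<^sup>2 * (w i)\<^sup>2)" by (intro sum_mono)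
  thus ?thesis unfolding dotp_def power2_eq_square[of "v _", symmetric] power2_eq_square[of "w _", symmetric] sum_distrib_left .
qed

lemma abs_div_pow_le:
  assumes "T > 0" "k \<le> 2 * n"
  shows "\<bar>y / T ^ k\<bar> \<le> pow_bound n T * \<bar>y\<bar>"
  using mult_right_mono[OF pow_bound_ge(2)[OF assms] abs_ge_zero[of y]] assms by (simp add: abs_divide)

lemma abs_le_pow_div:
  assumes "0 < s" "s \<le> T" "k \<le> 2 * n"
  shows "\<bar>y\<bar> \<le> pow_bound n T * \<bar>y / s ^ k\<bar>"
proof -
  have "\<bar>y\<bar> = s ^ k * \<bar>y / s ^ k\<bar>" using assms by (simp add: abs_divide)
  also have "\<dots> \<le> pow_bound n T * \<bar>y / s ^ k\<bar>"
    using power_mono[of s T k] pow_bound_ge(1)[of T k n] assms by (intro mult_right_mono) auto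
  finally show ?thesis .
qed

lemma dotp_diff_sq_le:
  "dotp n (\<lambda>i. v i - w i) (\<lambda>i. v i - w i) \<le> 2 * (dotp n v v + dotp n w w)"
  using dotp_add_sq_le[of n v "\<lambda>i. - w i"] by (simp add: dotp_def)

text \<open>At time 0 the scaling parameter is \<open>T\<close>. The 4 combines the weight 2q with
  the factor 2 from splitting the error into \<open>x\<close> and \<open>\<xi>\<close>.\<close>

lemma lyap_initial_bound:
  assumes n: "n \<ge> 1" and T: "T > 0"
  shows "lyap n T x \<xi> \<le> Lam n * (pow_bound n T)\<^sup>2 * (1 + 4 * cQPQc n) * (vnorm n x + vnorm n \<xi>)\<^sup>2"
proof -
  define L b q where "L = Lam n" and "b = (pow_bound n T)\<^sup>2" and "q = cQPQc n"
  define X Y where "X = dotp n x x" and "Y = dotp n \<xi> \<xi>"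
  have L: "L > 0" and q: "q > 0" using Lam_pos[OF n] cQPQc_pos[OF n] by (auto simp: L_def q_def)
  have X: "X \<ge> 0" and Y: "Y \<ge> 0" by (auto simp: X_def Y_def dotp_self_nonneg)
  have b: "b \<ge> 0" by (simp add: b_def)
  have \<eta>: "dotp n (sc_xi n T \<xi>) (sc_xi n T \<xi>) \<le> b * Y"
    unfolding b_def Y_def by (rule dotp_le_scaled) (unfold sc_xi_def, rule abs_div_pow_le[OF T], simp)
  have \<zeta>: "dotp n (sc_x n T x) (sc_x n T x) \<le> b * X"
    unfolding b_def X_def by (rule dotp_le_scaled) (unfold sc_x_def, rule abs_div_pow_le[OF T], simp)
  have \<epsilon>: "dotp n (sc_err n T x \<xi>) (sc_err n T x \<xi>) \<le> 2 * (b * X + b * Y)"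
    unfolding sc_err_def by (rule order_trans[OF dotp_diff_sq_le]) (use \<eta> \<zeta> in simp)
  have "lyap n T x \<xi> \<le> L * (b * Y) + 2 * q * (L * (2 * (b * X + b * Y)))"
    unfolding lyap_def q_def[symmetric]
  proof (intro add_mono mult_left_mono)
    show "dotp n (sc_xi n T \<xi>) (mvec n (Pm n 1) (sc_xi n T \<xi>)) \<le> L * (b * Y)"
      by (rule order_trans[OF _ mult_left_mono[OF \<eta>, of L]])
        (use Lam_bound[OF n] n L in \<open>simp_all add: Pm_expl L_def\<close>)
    show "dotp n (sc_err n T x \<xi>) (mvec n (R_expl n) (sc_err n T x \<xi>)) \<le> L * (2 * (b * X + b * Y))"
      by (rule order_trans[OF _ mult_left_mono[OF \<epsilon>, of L]])
        (use R_upper_bound[OF n] L in \<open>simp_all add: L_def\<close>)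
  qed (use q in auto)
  also have "\<dots> \<le> L * b * (1 + 4 * q) * (X + Y)"
  proof -
    have "L * b * (1 + 4 * q) * (X + Y) = L * (b * Y) + 2 * q * (L * (2 * (b * X + b * Y))) + L * b * X"
      by (simp add: algebra_simps)
    moreover have "0 \<le> L * b * X" using L b X by simp
    ultimately show ?thesis by linarith
  qed
  also have "\<dots> \<le> L * b * (1 + 4 * q) * (vnorm n x + vnorm n \<xi>)\<^sup>2"
  proof (intro mult_left_mono)
    have "0 \<le> sqrt X * sqrt Y" using X Y by simp
    thus "X + Y \<le> (vnorm n x + vnorm n \<xi>)\<^sup>2"
      using X Y by (simp add: vnorm_dotp X_def[symmetric] Y_def[symmetric] power2_sum)
  qed (use L b q in auto)
  finally show ?thesis by (simp add: L_def b_def q_def)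
qed

text \<open>Unscaling costs only powers s^k \<le> T^k, so the states inherit the decay of Z;
  \<open>x\<close> is recovered from \<zeta> = \<eta> + \<epsilon>. The third bound is for the
  control, which is -\<beta>/s times this entry; it is Cauchy-Schwarz in P with b^T P b \<le>
  Lam.\<close>

lemma state_le_lyap:
  assumes n: "n \<ge> 1" and s: "0 < s" "s \<le> T"
  shows "dotp n \<xi> \<xi> \<le> (pow_bound n T)\<^sup>2 * Lam n * lyap n s x \<xi>"
    and "dotp n x x \<le> (pow_bound n T)\<^sup>2 * Lam n * (2 + 1 / cQPQc n) * lyap n s x \<xi>"
    and "(mvec n (Pm n 1) (sc_xi n s \<xi>) n)\<^sup>2 \<le> Lam n * lyap n s x \<xi>"
proof -
  define L b q where "L = Lam n" and "b = (pow_bound n T)\<^sup>2" and "q = cQPQc n"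
  define v w where "v = dotp n (sc_xi n s \<xi>) (mvec n (Pm n 1) (sc_xi n s \<xi>))"
    and "w = dotp n (sc_err n s x \<xi>) (mvec n (R_expl n) (sc_err n s x \<xi>))"
  have L: "L > 0" and q: "q > 0" using Lam_pos[OF n] cQPQc_pos[OF n] by (auto simp: L_def q_def)
  have v: "v \<ge> 0" and w: "w \<ge> 0" using Pm_nonneg[OF n] R_nonneg by (auto simp: v_def w_def)
  have b: "b \<ge> 0" by (simp add: b_def)
  have Z: "lyap n s x \<xi> = v + 2 * q * w" by (simp add: lyap_def v_def w_def q_def)
  have vZ: "v \<le> lyap n s x \<xi>" unfolding Z using q w by simp
  have wZ: "w \<le> 1 / (2 * q) * lyap n s x \<xi>" unfolding Z using q v by (simp add: field_simps)
  have Pe: "Pm n 1 = P_expl n 1" using n by (simp add: Pm_expl)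
  have \<eta>: "dotp n (sc_xi n s \<xi>) (sc_xi n s \<xi>) \<le> L * v"
    unfolding L_def v_def Pe by (rule P_lower_bound[OF n])
  have \<epsilon>: "dotp n (sc_err n s x \<xi>) (sc_err n s x \<xi>) \<le> L * w"
    unfolding L_def w_def by (rule R_lower_bound[OF n])
  have "dotp n \<xi> \<xi> \<le> b * dotp n (sc_xi n s \<xi>) (sc_xi n s \<xi>)"
    unfolding b_def by (rule dotp_le_scaled) (unfold sc_xi_def, rule abs_le_pow_div[OF s], simp)
  also have "\<dots> \<le> b * (L * lyap n s x \<xi>)"
    by (rule mult_left_mono[OF order_trans[OF \<eta> mult_left_mono[OF vZ]] b]) (use L in simp)
  finally show "dotp n \<xi> \<xi> \<le> (pow_bound n T)\<^sup>2 * Lam n * lyap n s x \<xi>" by (simp add: b_def L_def mult.assoc)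
  have "dotp n x x \<le> b * dotp n (sc_x n s x) (sc_x n s x)"
    unfolding b_def by (rule dotp_le_scaled) (unfold sc_x_def, rule abs_le_pow_div[OF s], simp)
  also have "\<dots> \<le> b * (2 * (L * lyap n s x \<xi> + L * (1 / (2 * q) * lyap n s x \<xi>)))"
  proof (rule mult_left_mono[OF _ b])
    have "sc_x n s x = (\<lambda>i. sc_xi n s \<xi> i + sc_err n s x \<xi> i)" by (simp add: sc_err_def)
    hence "dotp n (sc_x n s x) (sc_x n s x) \<le> 2 * (dotp n (sc_xi n s \<xi>) (sc_xi n s \<xi>) + dotp n (sc_err n s x \<xi>) (sc_err n s x \<xi>))"
      using dotp_add_sq_le[of n "sc_xi n s \<xi>" "sc_err n s x \<xi>"] by simp
    also have "\<dots> \<le> 2 * (L * v + L * w)" using \<eta> \<epsilon> by simp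
    also have "\<dots> \<le> 2 * (L * lyap n s x \<xi> + L * (1 / (2 * q) * lyap n s x \<xi>))"
      using L by (intro mult_left_mono add_mono vZ wZ) auto
    finally show "dotp n (sc_x n s x) (sc_x n s x) \<le> 2 * (L * lyap n s x \<xi> + L * (1 / (2 * q) * lyap n s x \<xi>))" .
  qed
  also have "\<dots> = b * L * (2 + 1 / q) * lyap n s x \<xi>" using q by (simp add: field_simps)
  finally show "dotp n x x \<le> (pow_bound n T)\<^sup>2 * Lam n * (2 + 1 / cQPQc n) * lyap n s x \<xi>"
    by (simp add: b_def L_def q_def)
  have Psym: "Pm n 1 i j = Pm n 1 j i" for i j using n by (simp add: Pm_expl P_expl_sym)
  have e: "dotp n (bvec n) u = u n" for u unfolding bvec_def by (rule dotp_unit) (use n in simp)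
  have "(mvec n (Pm n 1) (sc_xi n s \<xi>) n)\<^sup>2 = (dotp n (bvec n) (mvec n (Pm n 1) (sc_xi n s \<xi>)))\<^sup>2" by (simp only: e)
  also have "\<dots> \<le> dotp n (bvec n) (mvec n (Pm n 1) (bvec n)) * v"
    unfolding v_def by (rule psd_cauchy_schwarz[OF Psym Pm_nonneg[OF n]])
  also have "\<dots> \<le> L * lyap n s x \<xi>"
  proof (rule mult_mono)
    have "dotp n (bvec n) (bvec n) = 1" by (subst e) (simp add: bvec_def)
    thus "dotp n (bvec n) (mvec n (Pm n 1) (bvec n)) \<le> L"
      using Lam_bound[OF n, of "bvec n"] n by (simp add: Pm_expl L_def)
  qed (use vZ v L in auto)
  finally show "(mvec n (Pm n 1) (sc_xi n s \<xi>) n)\<^sup>2 \<le> Lam n * lyap n s x \<xi>" by (simp add: L_def)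
qed

text \<open>Used with \<open>k = 3\<close> for the states and \<open>k = 1\<close> for the control.
  The exponential is kept as a square so that the root halves its rate.\<close>

lemma le_sqrt_decay:
  assumes "y\<^sup>2 \<le> C * s ^ k * (exp a)\<^sup>2 * N\<^sup>2" and "s > 0" "N \<ge> 0" "C \<ge> 0"
  shows "y \<le> sqrt C * exp a * s powr (real k / 2) * N"
proof -
  have "(s powr (real k / 2))\<^sup>2 = s powr (real k)" using assms(2)
    by (simp add: power2_eq_square flip: powr_add)
  also have "\<dots> = s ^ k" using assms(2) by (simp add: powr_realpow)
  finally have p: "(s powr (real k / 2))\<^sup>2 = s ^ k" .
  have "y\<^sup>2 \<le> (sqrt C * exp a * s powr (real k / 2) * N)\<^sup>2"
    using assms by (simp add: power_mult_distrib p mult_ac)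
  moreover have "0 \<le> sqrt C * exp a * s powr (real k / 2) * N" using assms by simp
  ultimately show ?thesis by (rule power2_le_imp_le)
qed

theorem theorem2:
  fixes n :: nat and T :: real and c :: "nat \<Rightarrow> nat \<Rightarrow> real"
    and \<phi> :: "nat \<Rightarrow> real \<Rightarrow> real \<Rightarrow> real \<Rightarrow> (nat \<Rightarrow> real) \<Rightarrow> real"
  assumes n: "n \<ge> 1"
    and T: "T > 0"
    and c_nonneg: "\<forall>i\<in>{1..n}. \<forall>j\<in>{1..i}. c i j \<ge> 0"
    and phi_local: "\<forall>i t u0 u x y. (\<forall>k\<in>{1..n}. x k = y k) \<longrightarrow> \<phi> i t u0 u x = \<phi> i t u0 u y"
    and phi_cont: "\<forall>i\<in>{1..n}. continuous_on UNIV
         (\<lambda>p :: real \<times> real \<times> real \<times> (nat \<Rightarrow> real). \<phi> i (fst p) (fst (snd p)) (fst (snd (snd p))) (snd (snd (snd p))))"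
    and phi_bound: "\<forall>i\<in>{1..n}. \<forall>t u0 u x. \<bar>\<phi> i t u0 u x\<bar> \<le> (\<Sum>j=1..i. c i j * \<bar>x j\<bar>)"
  shows "\<exists>v3 v30 v4 v40 v5 v50 :: real. v3 > 0 \<and> v30 > 0 \<and> v4 > 0 \<and> v40 > 0 \<and> v5 > 0 \<and> v50 > 0 \<and>
    (\<forall>x0 x \<xi>. closed_loop n c T \<phi> x0 x \<xi> \<longrightarrow>
      (\<forall>t\<in>{0..<T}.
         \<bar>x0 t\<bar> \<le> (T - t)\<^sup>2 * ((T - t) / T ^ 3 * \<bar>x0 0\<bar> + beta n c T * t / (2 * T)) \<and>
         \<bar>u0_fb n c T t (x0 t)\<bar> \<le> (T - t) * (3 * (T - t) * (\<bar>x0 0\<bar> / T ^ 3 + beta n c T / (2 * T)) + beta n c T) \<and>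
         vnorm n (x t) \<le> v3 * exp (v30 * \<bar>x0 0\<bar> * t) * (T - t) powr (3/2) * (vnorm n (x 0) + vnorm n (\<xi> 0)) \<and>
         vnorm n (\<xi> t) \<le> v4 * exp (v40 * \<bar>x0 0\<bar> * t) * (T - t) powr (3/2) * (vnorm n (x 0) + vnorm n (\<xi> 0)) \<and>
         \<bar>u_fb n c T t (\<xi> t)\<bar> \<le> v5 * exp (v50 * \<bar>x0 0\<bar> * t) * (T - t) powr (1/2) * (vnorm n (x 0) + vnorm n (\<xi> 0))))"
proof -
  \<comment> \<open>All constants are built from \<open>n\<close>, \<open>T\<close> and
    \<open>c\<close>, before any trajectory is given.\<close>
  define L b q B where "L = Lam n" and "b = (pow_bound n T)\<^sup>2" and "q = cQPQc n" and "B = beta n c T"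
  define K where "K = 2 * sqrt 2 * L * (1 + q)"
  \<comment> \<open>Half of the coefficient \<open>3 * K / T ^ 3\<close> of |x_0(0)| in the growth
    rate of Z, as the norms are compared with square roots of Z.\<close>
  define a where "a = 3 * K / (2 * T ^ 3)"
  \<comment> \<open>\<open>1 / T ^ 3\<close> stems from \<open>(s / T) ^ 3\<close> and the last
    factor from \<open>lyap_initial_bound\<close>. The exponential absorbs the part of the rate that
    is independent of x_0(0), by t \<le> T.\<close>
  define D where "D = exp (3 * K * B / 2) / T ^ 3 * (L * b * (1 + 4 * q))"
  have L: "L > 0" and q: "q > 0" using Lam_pos[OF n] cQPQc_pos[OF n] by (auto simp: L_def q_def)
  have b: "b > 0"
  proof -
    have "pow_bound n T \<ge> T ^ 0" by (rule pow_bound_ge(1)[OF T]) simp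
    thus ?thesis by (simp add: b_def)
  qed
  have K: "K > 0" using L q by (simp add: K_def)
  have a: "a > 0" using K T by (simp add: a_def)
  have D: "D > 0" using T L b q by (simp add: D_def)
  \<comment> \<open>Zero vectors satisfy the row bounds of \<open>dcoef_bound\<close> trivially,
    which gives access to its second conclusion.\<close>
  have "dcoef n c T \<ge> 0"
    by (rule dcoef_bound(2)[OF n T, of c "\<lambda>_. 0" "\<lambda>_. 0"]) (use c_nonneg in auto)
  hence B: "B > 0" unfolding B_def by (rule beta_pos[OF n])
  define C\<xi> Cx Cu where "C\<xi> = b * L * D" and "Cx = b * L * (2 + 1 / q) * D" and "Cu = B\<^sup>2 * L * D"
  have C: "C\<xi> > 0" "Cx > 0" "Cu > 0" using b L q D B by (auto simp: C\<xi>_def Cx_def Cu_def add_pos_pos)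
  show ?thesis
  proof (rule exI[of _ "sqrt Cx"], rule exI[of _ a], rule exI[of _ "sqrt C\<xi>"], rule exI[of _ a],
      rule exI[of _ "sqrt Cu"], rule exI[of _ a], intro conjI allI impI ballI)
    fix x0 x \<xi> t
    assume cl: "closed_loop n c T \<phi> x0 x \<xi>" and t: "t \<in> {0..<T}"
    define s where "s = T - t"
    have s: "s > 0" "s \<le> T" and t0: "t \<ge> 0" "t < T" using t by (auto simp: s_def)
    have x0: "x0 t = s ^ 3 * x0 0 / T ^ 3 - B * t * s\<^sup>2 / (2 * T)"
      unfolding s_def B_def by (rule x0_solution[OF T _ t]) (use cl in \<open>auto simp: closed_loop_def\<close>)
    have u0: "u0_fb n c T t (x0 t) = s * (B - 3 * s * (x0 0 / T ^ 3 + B / (2 * T)))"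
      unfolding s_def B_def by (rule u0_fb_solution[of T t x0 n c, OF T t x0[unfolded s_def B_def]])
    show "\<bar>x0 t\<bar> \<le> (T - t)\<^sup>2 * ((T - t) / T ^ 3 * \<bar>x0 0\<bar> + beta n c T * t / (2 * T))"
    proof -
      have "\<bar>x0 t\<bar> \<le> \<bar>s ^ 3 * x0 0 / T ^ 3\<bar> + \<bar>B * t * s\<^sup>2 / (2 * T)\<bar>" unfolding x0 by (rule abs_triangle_ineq4)
      also have "\<dots> = s ^ 3 * \<bar>x0 0\<bar> / T ^ 3 + B * t * s\<^sup>2 / (2 * T)"
        using s T t0 B by (simp add: abs_mult)
      also have "\<dots> = s\<^sup>2 * (s / T ^ 3 * \<bar>x0 0\<bar> + B * t / (2 * T))"
        by (simp add: algebra_simps power2_eq_square power3_eq_cube)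
      finally show ?thesis by (simp add: s_def B_def)
    qed
    show "\<bar>u0_fb n c T t (x0 t)\<bar> \<le> (T - t) * (3 * (T - t) * (\<bar>x0 0\<bar> / T ^ 3 + beta n c T / (2 * T)) + beta n c T)"
    proof -
      define X W where "X = x0 0 / T ^ 3 + B / (2 * T)" and "W = \<bar>x0 0\<bar> / T ^ 3 + B / (2 * T)"
      have "\<bar>X\<bar> \<le> W"
        using T B abs_triangle_ineq[of "x0 0 / T ^ 3" "B / (2 * T)"] by (simp add: abs_divide X_def W_def)
      hence "3 * s * \<bar>X\<bar> \<le> 3 * s * W" using s by (intro mult_left_mono) auto
      moreover have "\<bar>B - 3 * s * X\<bar> \<le> B + 3 * s * \<bar>X\<bar>"
        using abs_triangle_ineq4[of B "3 * s * X"] s B by (simp add: abs_mult)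
      ultimately have "\<bar>B - 3 * s * X\<bar> \<le> 3 * s * W + B" by linarith
      hence "s * \<bar>B - 3 * s * X\<bar> \<le> s * (3 * s * W + B)"
        using s by (intro mult_left_mono) auto
      hence "\<bar>u0_fb n c T t (x0 t)\<bar> \<le> s * (3 * s * W + B)"
        unfolding u0 X_def[symmetric] using s by (simp add: abs_mult)
      thus ?thesis by (simp add: W_def s_def B_def)
    qed
    define N where "N = vnorm n (x 0) + vnorm n (\<xi> 0)"
    have N: "N \<ge> 0" by (simp add: N_def vnorm_dotp dotp_self_nonneg)
    define Z where "Z = lyap n s (x t) (\<xi> t)"
    define e where "e = exp (a * \<bar>x0 0\<bar> * t)"
    have Z: "Z \<le> D * s ^ 3 * e\<^sup>2 * N\<^sup>2"
    proof -
      have 1: "2 * sqrt 2 * Lam n * (1 + cQPQc n) * (3 * (\<bar>x0 0\<bar> / T ^ 3 + \<bar>beta n c T\<bar> / (2 * T))) * t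
         = 2 * (a * \<bar>x0 0\<bar> * t) + 3 * K * B / 2 * (t / T)"
        using T B unfolding B_def[symmetric] L_def[symmetric] q_def[symmetric] a_def K_def by (simp add: field_simps)
      have "3 * K * B / 2 * (t / T) \<le> 3 * K * B / 2 * 1"
        by (rule mult_left_mono) (use K B t0 T in auto)
      hence "exp (2 * sqrt 2 * Lam n * (1 + cQPQc n) * (3 * (\<bar>x0 0\<bar> / T ^ 3 + \<bar>beta n c T\<bar> / (2 * T))) * t)
         \<le> exp (2 * (a * \<bar>x0 0\<bar> * t) + 3 * K * B / 2)" unfolding 1 by simp
      also have "\<dots> = e\<^sup>2 * exp (3 * K * B / 2)"
        by (simp add: e_def exp_add exp_double)
      finally have E: "exp (2 * sqrt 2 * Lam n * (1 + cQPQc n) * (3 * (\<bar>x0 0\<bar> / T ^ 3 + \<bar>beta n c T\<bar> / (2 * T))) * t)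
         \<le> e\<^sup>2 * exp (3 * K * B / 2)" .
      have "Z \<le> (s / T) ^ 3 * lyap n T (x 0) (\<xi> 0) *
        exp (2 * sqrt 2 * Lam n * (1 + cQPQc n) * (3 * (\<bar>x0 0\<bar> / T ^ 3 + \<bar>beta n c T\<bar> / (2 * T))) * t)"
        unfolding Z_def s_def by (rule lyap_decay[OF n T c_nonneg phi_bound cl t])
      also have "\<dots> \<le> (s / T) ^ 3 * (L * b * (1 + 4 * q) * N\<^sup>2) * (e\<^sup>2 * exp (3 * K * B / 2))"
        using lyap_initial_bound[OF n T, of "x 0" "\<xi> 0"] s T L b q
        unfolding L_def[symmetric] b_def[symmetric] q_def[symmetric] N_def[symmetric]
        by (intro mult_mono[OF mult_left_mono] E[unfolded L_def[symmetric] q_def[symmetric]]) auto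
      also have "\<dots> = D * s ^ 3 * e\<^sup>2 * N\<^sup>2" by (simp add: D_def power_divide)
      finally show ?thesis .
    qed
    have sq: "(vnorm n v)\<^sup>2 = dotp n v v" for v by (simp add: vnorm_dotp dotp_self_nonneg)
    note le = state_le_lyap[where x = "x t" and \<xi> = "\<xi> t", OF n s, folded L_def b_def q_def]
    have "(vnorm n (\<xi> t))\<^sup>2 \<le> b * L * (D * s ^ 3 * e\<^sup>2 * N\<^sup>2)"
      unfolding sq using b L by (intro order_trans[OF le(1)] mult_left_mono Z[unfolded Z_def]) auto
    hence "(vnorm n (\<xi> t))\<^sup>2 \<le> C\<xi> * s ^ 3 * e\<^sup>2 * N\<^sup>2" by (simp add: C\<xi>_def mult_ac)
    from le_sqrt_decay[OF this[unfolded e_def] s(1) N] C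
    show "vnorm n (\<xi> t) \<le> sqrt C\<xi> * exp (a * \<bar>x0 0\<bar> * t) * (T - t) powr (3/2) * (vnorm n (x 0) + vnorm n (\<xi> 0))"
      by (simp add: s_def N_def)
    have "(vnorm n (x t))\<^sup>2 \<le> b * L * (2 + 1 / q) * (D * s ^ 3 * e\<^sup>2 * N\<^sup>2)"
      unfolding sq using b L q by (intro order_trans[OF le(2)] mult_left_mono Z[unfolded Z_def]) auto
    hence "(vnorm n (x t))\<^sup>2 \<le> Cx * s ^ 3 * e\<^sup>2 * N\<^sup>2" by (simp add: Cx_def mult_ac)
    from le_sqrt_decay[OF this[unfolded e_def] s(1) N] C
    show "vnorm n (x t) \<le> sqrt Cx * exp (a * \<bar>x0 0\<bar> * t) * (T - t) powr (3/2) * (vnorm n (x 0) + vnorm n (\<xi> 0))"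
      by (simp add: s_def N_def)
    have us: "u_fb n c T t (\<xi> t) = - B * mvec n (Pm n 1) (sc_xi n s (\<xi> t)) n / s"
    proof -
      have "s * dotp n (bvec n) (mvec n (Pm n (gam T t)) (\<xi> t)) = mvec n (Pm n 1) (sc_xi n s (\<xi> t)) n"
        using Pm_gam_last_row[OF n T t0(2), of "\<xi> t"] by (simp add: sc_xi_def s_def)
      hence "mvec n (Pm n 1) (sc_xi n s (\<xi> t)) n / s = dotp n (bvec n) (mvec n (Pm n (gam T t)) (\<xi> t))"
        using s by (simp add: field_simps)
      thus ?thesis by (simp add: u_fb_def B_def flip: times_divide_eq_right)
    qed
    \<comment> \<open>The division by \<open>s\<close> costs two powers in the square, which leaves
      one of the three in the bound on Z.\<close>
    have "\<bar>u_fb n c T t (\<xi> t)\<bar>\<^sup>2 = B\<^sup>2 / s\<^sup>2 * (mvec n (Pm n 1) (sc_xi n s (\<xi> t)) n)\<^sup>2"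
      unfolding us by (simp add: power_divide power_mult_distrib)
    also have "\<dots> \<le> B\<^sup>2 / s\<^sup>2 * (L * (D * s ^ 3 * e\<^sup>2 * N\<^sup>2))"
      using L by (intro mult_left_mono order_trans[OF le(3)] Z[unfolded Z_def]) auto
    also have "\<dots> = Cu * s ^ 1 * e\<^sup>2 * N\<^sup>2"
      using s by (simp add: Cu_def power2_eq_square power3_eq_cube)
    finally have "\<bar>u_fb n c T t (\<xi> t)\<bar>\<^sup>2 \<le> Cu * s ^ 1 * e\<^sup>2 * N\<^sup>2" .
    from le_sqrt_decay[OF this[unfolded e_def] s(1) N] C
    show "\<bar>u_fb n c T t (\<xi> t)\<bar> \<le> sqrt Cu * exp (a * \<bar>x0 0\<bar> * t) * (T - t) powr (1/2) * (vnorm n (x 0) + vnorm n (\<xi> 0))"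
      by (simp add: s_def N_def)
  qed (use C a in auto)
qed

end
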